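(* For any persistent spaces $X_\bullet,Y_\bullet:(\mathbb{R},\leq)\to\mathrm{Top}$, the persistent cup-length invariants satisfy $$d_{\mathrm{E}}(\mathbf{cup}(X_\bullet),\mathbf{cup}(Y_\bullet))\leq d_{\mathrm{HI}}(X_\bullet,Y_\bullet),$$ and for the Vietoris-Rips filtrations of compact metric spaces $X$ and $Y$, $$d_{\mathrm{E}}\left(\mathbf{cup}(\mathrm{VR}_\bullet(X)),\mathbf{cup}(\mathrm{VR}_\bullet(Y))\right)\leq 2\cdot d_{\mathrm{GH}}(X,Y).$$
   Context: $\mathrm{Top}$ is the category of compactly generated weak Hausdorff spaces. A persistent space is a functor $X_\bullet:(\mathbb{R},\leq)\to\mathrm{Top}$. Cohomology is taken over a fixed field $K$; $\mathbf{H}^*(X)=\bigoplus_{p\geq0}\mathbf{H}^p(X)$ is the graded cohomology ring under cup product. The length $\mathbf{len}(R)$ of a graded ring $R=\bigoplus_{p\geq0}R_p$ is the largest $\ell\geq0$ such that there are homogeneous elements $\eta_1,\dots,\eta_\ell$ of positive degree with $\eta_1\cdots\eta_\ell\neq0$ (it is $0$ if no nonzero positive-degree elements exist, and $\infty$ if there is no largest such $\ell$). Let $\mathrm{Int}$ be the set of closed intervals $[a,b]$, $a\leq b$ in $\mathbb{R}$. The persistent cup-length invariant of $X_\bullet$ is $\mathbf{cup}(X_\bullet):\mathrm{Int}\to\mathbb{N}\cup\{\infty\}$, $[a,b]\mapsto\mathbf{len}\left(\mathrm{im}(\mathbf{H}^*(X_b)\to\mathbf{H}^*(X_a))\right)$.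 Erosion distance: $\mathbf{J}_1,\mathbf{J}_2$ on $\mathrm{Int}$ (order-reversing for inclusion) are $\epsilon$-eroded if $\mathbf{J}_1([a,b])\geq\mathbf{J}_2([a-\epsilon,b+\epsilon])$ and $\mathbf{J}_2([a,b])\geq\mathbf{J}_1([a-\epsilon,b+\epsilon])$ for all $[a,b]$; $d_{\mathrm{E}}(\mathbf{J}_1,\mathbf{J}_2)$ is the infimum of such $\epsilon\geq0$ ($\infty$ if none). Persistent spaces $X_\bullet,Y_\bullet$ with transition maps $f_a^b,g_a^b$ are $\epsilon$-interleaved if there are maps $\varphi_t:X_t\to Y_{t+\epsilon}$, $\psi_t:Y_t\to X_{t+\epsilon}$, commuting with transition maps, with $\psi_{t+\epsilon}\circ\varphi_t=f_t^{t+2\epsilon}$ and $\varphi_{t+\epsilon}\circ\psi_t=g_t^{t+2\epsilon}$; $d_{\mathrm{I}}^{\mathrm{Top}}$ is the infimum of such $\epsilon\geq 0$. $X_\bullet\simeq X'_\bullet$ (weakly equivalent) means there are a persistent space $Z_\bullet$ and natural transformations $Z_\bullet\Rightarrow X_\bullet$, $Z_\bullet\Rightarrow X'_\bullet$ that are objectwise weak homotopy equivalences. $d_{\mathrm{HI}}(X_\bullet,Y_\bullet)=\inf\{d_{\mathrm{I}}^{\mathrm{Top}}(X'_\bullet,Y'_\bullet): X'_\bullet\simeq X_\bullet,\ Y'_\bullet\simeq Y_\bullet\}$. $\mathrm{VR}_t(X)$ is the geometric realization of the simplicial complex of finite nonempty subsets of $X$ of diameter at most $t$ (empty for $t<0$).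 $d_{\mathrm{GH}}$ is the Gromov-Hausdorff distance. *)

theory Defs
  imports "HOL-Analysis.Analysis" "HOL-Homology.Homology" "HOL-Algebra.QuotRing"
begin

section \<open>Compactly generated weak Hausdorff spaces\<close>

text \<open>
  The test spaces \<open>T\<close> below should range over all compact Hausdorff spaces.  For a space
  on the type \<open>'a\<close>, test spaces on the type \<open>'a set set\<close> suffice.
  For \<open>weak_Hausdorff_space\<close>: given \<open>u\<close> from a compact Hausdorff \<open>T\<close> into \<open>X\<close>, choose one
  preimage of each point of the image; the closure of the set of chosen points is compact
  Hausdorff, has the same image, and (having a dense subset of size at most
  that of \<open>'a\<close>) injects into \<open>'a set set\<close>.
  For \<open>compactly_generated\<close> on a weak Hausdorff space: the image of a compact Hausdorff space is
  itself a compact Hausdorff subspace, so inclusions of subspaces of \<open>X\<close> suffice as tests.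
\<close>

definition weak_Hausdorff_space :: "'a topology \<Rightarrow> bool" where
  "weak_Hausdorff_space X \<longleftrightarrow>
     (\<forall>(T :: 'a set set topology) u. compact_space T \<and> Hausdorff_space T \<and> continuous_map T X u
        \<longrightarrow> closedin X (u ` topspace T))"

definition compactly_generated :: "'a topology \<Rightarrow> bool" where
  "compactly_generated X \<longleftrightarrow>
     (\<forall>A \<subseteq> topspace X.
        (\<forall>(T :: 'a set set topology) u. compact_space T \<and> Hausdorff_space T \<and> continuous_map T X u
           \<longrightarrow> closedin T {x \<in> topspace T. u x \<in> A})
        \<longrightarrow> closedin X A)"

definition cgwh_space :: "'a topology \<Rightarrow> bool" where
  "cgwh_space X \<longleftrightarrow> compactly_generated X \<and> weak_Hausdorff_space X"


section \<open>Persistent spaces\<close>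

record 'a pspace =
  Sp :: "real \<Rightarrow> 'a topology"
  Tr :: "real \<Rightarrow> real \<Rightarrow> 'a \<Rightarrow> 'a"

text \<open>
  \<open>Tr X s t\<close> is the transition map from \<open>Sp X s\<close> to \<open>Sp X t\<close>; it is only meaningful for
  \<open>s \<le> t\<close> and on the points of \<open>Sp X s\<close>.
\<close>

definition persistent_space :: "'a pspace \<Rightarrow> bool" where
  "persistent_space X \<longleftrightarrow>
     (\<forall>t. cgwh_space (Sp X t)) \<and>
     (\<forall>s t. s \<le> t \<longrightarrow> continuous_map (Sp X s) (Sp X t) (Tr X s t)) \<and>
     (\<forall>t. \<forall>x \<in> topspace (Sp X t). Tr X t t x = x) \<and>
     (\<forall>r s t. r \<le> s \<longrightarrow> s \<le> t \<longrightarrow>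
        (\<forall>x \<in> topspace (Sp X r). Tr X s t (Tr X r s x) = Tr X r t x))"

definition shift_map :: "real \<Rightarrow> 'a pspace \<Rightarrow> 'b pspace \<Rightarrow> (real \<Rightarrow> 'a \<Rightarrow> 'b) \<Rightarrow> bool" where
  "shift_map \<epsilon> X Y \<phi> \<longleftrightarrow>
     (\<forall>t. continuous_map (Sp X t) (Sp Y (t + \<epsilon>)) (\<phi> t)) \<and>
     (\<forall>s t. s \<le> t \<longrightarrow>
        (\<forall>x \<in> topspace (Sp X s). \<phi> t (Tr X s t x) = Tr Y (s + \<epsilon>) (t + \<epsilon>) (\<phi> s x)))"

definition natural_transformation :: "'a pspace \<Rightarrow> 'b pspace \<Rightarrow> (real \<Rightarrow> 'a \<Rightarrow> 'b) \<Rightarrow> bool" where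
  "natural_transformation X Y \<phi> \<longleftrightarrow> shift_map 0 X Y \<phi>"

definition interleaved :: "real \<Rightarrow> 'a pspace \<Rightarrow> 'b pspace \<Rightarrow> bool" where
  "interleaved \<epsilon> X Y \<longleftrightarrow>
     (\<exists>\<phi> \<psi>. shift_map \<epsilon> X Y \<phi> \<and> shift_map \<epsilon> Y X \<psi> \<and>
        (\<forall>t. \<forall>x \<in> topspace (Sp X t). \<psi> (t + \<epsilon>) (\<phi> t x) = Tr X t (t + 2 * \<epsilon>) x) \<and>
        (\<forall>t. \<forall>y \<in> topspace (Sp Y t). \<phi> (t + \<epsilon>) (\<psi> t y) = Tr Y t (t + 2 * \<epsilon>) y))"

definition interleaving_distance :: "'a pspace \<Rightarrow> 'b pspace \<Rightarrow> ereal" where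
  "interleaving_distance X Y = Inf {ereal \<epsilon> |\<epsilon>. 0 \<le> \<epsilon> \<and> interleaved \<epsilon> X Y}"


section \<open>Weak homotopy equivalences and the homotopy interleaving distance\<close>

definition cube :: "nat \<Rightarrow> (nat \<Rightarrow> real) set" where
  "cube n = {s. (\<forall>i<n. 0 \<le> s i \<and> s i \<le> 1) \<and> (\<forall>i\<ge>n. s i = 0)}"

definition cube_boundary :: "nat \<Rightarrow> (nat \<Rightarrow> real) set" where
  "cube_boundary n = {s \<in> cube n. \<exists>i<n. s i = 0 \<or> s i = 1}"

definition loop_homotopic ::
    "nat \<Rightarrow> 'a topology \<Rightarrow> 'a \<Rightarrow> ((nat \<Rightarrow> real) \<Rightarrow> 'a) \<Rightarrow> ((nat \<Rightarrow> real) \<Rightarrow> 'a) \<Rightarrow> bool" where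
  "loop_homotopic n X x =
     homotopic_with (\<lambda>g. g ` cube_boundary n \<subseteq> {x}) (subtopology (powertop_real UNIV) (cube n)) X"

text \<open>
  The underlying set of \<open>\<pi>\<^sub>n(X,x)\<close>, for \<open>n \<ge> 1\<close>: homotopy classes, relative to the boundary, of
  maps from the \<open>n\<close>-cube to \<open>X\<close> sending the boundary to \<open>x\<close>.  As postcomposition with a
  continuous map is always a homomorphism for the concatenation product, being an isomorphism
  on \<open>\<pi>\<^sub>n\<close> means being bijective on these sets.
\<close>

definition homotopy_classes :: "nat \<Rightarrow> 'a topology \<Rightarrow> 'a \<Rightarrow> ((nat \<Rightarrow> real) \<Rightarrow> 'a) set set" where
  "homotopy_classes n X x = {Collect (loop_homotopic n X x g) |g. loop_homotopic n X x g g}"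

definition homotopy_classes_map ::
    "nat \<Rightarrow> 'b topology \<Rightarrow> ('a \<Rightarrow> 'b) \<Rightarrow> 'a \<Rightarrow>
       ((nat \<Rightarrow> real) \<Rightarrow> 'a) set \<Rightarrow> ((nat \<Rightarrow> real) \<Rightarrow> 'b) set" where
  "homotopy_classes_map n Y f x C = (\<Union>g\<in>C. Collect (loop_homotopic n Y (f x) (f \<circ> g)))"

definition path_components_map :: "'b topology \<Rightarrow> ('a \<Rightarrow> 'b) \<Rightarrow> 'a set \<Rightarrow> 'b set" where
  "path_components_map Y f C = (\<Union>x\<in>C. Collect (path_component_of Y (f x)))"

definition weak_homotopy_equivalence :: "'a topology \<Rightarrow> 'b topology \<Rightarrow> ('a \<Rightarrow> 'b) \<Rightarrow> bool" where
  "weak_homotopy_equivalence X Y f \<longleftrightarrow>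
     continuous_map X Y f \<and>
     bij_betw (path_components_map Y f) (path_components_of X) (path_components_of Y) \<and>
     (\<forall>n\<ge>1. \<forall>x \<in> topspace X.
        bij_betw (homotopy_classes_map n Y f x) (homotopy_classes n X x) (homotopy_classes n Y (f x)))"

text \<open>
  The persistent spaces \<open>Z\<close>, \<open>X'\<close>, \<open>Y'\<close> below should range over all persistent spaces; in HOL
  they have to live on some type \<open>'u\<close>, which is made an explicit parameter.  Any set of
  persistent spaces fits into one type, so enlarging \<open>'u\<close> can only decrease
  \<open>homotopy_interleaving_distance TYPE('u) X Y\<close>, and \<open>d\<^sub>H\<^sub>I(X,Y)\<close> is its infimum over all \<open>'u\<close>.  In
  particular, \<open>c \<le> d\<^sub>H\<^sub>I(X,Y)\<close> says exactly that
  \<open>c \<le> homotopy_interleaving_distance TYPE('u) X Y\<close> for every type \<open>'u\<close>.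
\<close>

definition weakly_equivalent :: "'u itself \<Rightarrow> 'a pspace \<Rightarrow> 'b pspace \<Rightarrow> bool" where
  "weakly_equivalent U X X' \<longleftrightarrow>
     (\<exists>(Z :: 'u pspace) \<alpha> \<beta>. persistent_space Z \<and>
        natural_transformation Z X \<alpha> \<and> natural_transformation Z X' \<beta> \<and>
        (\<forall>t. weak_homotopy_equivalence (Sp Z t) (Sp X t) (\<alpha> t)) \<and>
        (\<forall>t. weak_homotopy_equivalence (Sp Z t) (Sp X' t) (\<beta> t)))"

definition homotopy_interleaving_distance ::
    "'u itself \<Rightarrow> 'a pspace \<Rightarrow> 'b pspace \<Rightarrow> ereal" where
  "homotopy_interleaving_distance U X Y =
     Inf {interleaving_distance X' Y' |(X' :: 'u pspace) (Y' :: 'u pspace).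
            persistent_space X' \<and> persistent_space Y' \<and>
            weakly_equivalent U X' X \<and> weakly_equivalent U Y' Y}"


section \<open>The singular cohomology ring\<close>

text \<open>
  The total cochain ring is \<open>C\<^sup>*(X) = \<Oplus>\<^sub>p C\<^sup>p(X)\<close>: a cochain \<open>c\<close> assigns to each \<open>p\<close> and each
  singular \<open>p\<close>-simplex a coefficient, is \<open>0\<close> off the singular simplices, and has only
  finitely many nonzero homogeneous components \<open>c p\<close>.
\<close>

type_synonym ('a, 'k) cochain = "nat \<Rightarrow> ((nat \<Rightarrow> real) \<Rightarrow> 'a) \<Rightarrow> 'k"

definition cochains :: "'a topology \<Rightarrow> ('a, 'k::field) cochain set" where
  "cochains X = {c. (\<forall>p \<sigma>. \<not> singular_simplex p X \<sigma> \<longrightarrow> c p \<sigma> = 0) \<and>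
                    finite {p. \<exists>\<sigma>. c p \<sigma> \<noteq> 0}}"

definition coboundary :: "'a topology \<Rightarrow> ('a, 'k::field) cochain \<Rightarrow> ('a, 'k) cochain" where
  "coboundary X c = (\<lambda>n \<sigma>.
     if 0 < n \<and> singular_simplex n X \<sigma>
     then \<Sum>i\<le>n. (-1) ^ i * c (n - 1) (singular_face n i \<sigma>) else 0)"

definition front_face :: "nat \<Rightarrow> ((nat \<Rightarrow> real) \<Rightarrow> 'a) \<Rightarrow> (nat \<Rightarrow> real) \<Rightarrow> 'a" where
  "front_face p \<sigma> = restrict \<sigma> (standard_simplex p)"

text \<open>The restriction of a \<open>(p+q)\<close>-simplex to the face spanned by the vertices \<open>p, \<dots>, p+q\<close>.\<close>

definition back_face :: "nat \<Rightarrow> nat \<Rightarrow> ((nat \<Rightarrow> real) \<Rightarrow> 'a) \<Rightarrow> (nat \<Rightarrow> real) \<Rightarrow> 'a" where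
  "back_face p q \<sigma> =
     restrict (\<lambda>x. \<sigma> (\<lambda>i. if i < p then 0 else x (i - p))) (standard_simplex q)"

definition cup_product ::
    "'a topology \<Rightarrow> ('a, 'k::field) cochain \<Rightarrow> ('a, 'k) cochain \<Rightarrow> ('a, 'k) cochain" where
  "cup_product X c d = (\<lambda>n \<sigma>.
     if singular_simplex n X \<sigma>
     then \<Sum>p\<le>n. c p (front_face p \<sigma>) * d (n - p) (back_face p (n - p) \<sigma>) else 0)"

definition cocycles :: "'a topology \<Rightarrow> ('a, 'k::field) cochain set" where
  "cocycles X = {c \<in> cochains X. coboundary X c = (\<lambda>_ _. 0)}"

definition coboundaries :: "'a topology \<Rightarrow> ('a, 'k::field) cochain set" where
  "coboundaries X = coboundary X ` cochains X"

definition cocycle_ring :: "'a topology \<Rightarrow> ('a, 'k::field) cochain ring" where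
  "cocycle_ring X =
     \<lparr>carrier = cocycles X,
      mult = cup_product X,
      one = (\<lambda>p \<sigma>. if p = 0 \<and> singular_simplex 0 X \<sigma> then 1 else 0),
      zero = (\<lambda>_ _. 0),
      add = (\<lambda>c d p \<sigma>. c p \<sigma> + d p \<sigma>)\<rparr>"

definition cohomology_ring :: "'a topology \<Rightarrow> ('a, 'k::field) cochain set ring" where
  "cohomology_ring X = cocycle_ring X Quot coboundaries X"

definition cohomology_class :: "'a topology \<Rightarrow> ('a, 'k::field) cochain \<Rightarrow> ('a, 'k) cochain set" where
  "cohomology_class X c = a_r_coset (cocycle_ring X) (coboundaries X) c"

text \<open>\<open>H\<^sup>p(X)\<close> as the degree \<open>p\<close> part of the cohomology ring.\<close>

definition cohomology :: "nat \<Rightarrow> 'a topology \<Rightarrow> ('a, 'k::field) cochain set set" where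
  "cohomology p X = {cohomology_class X c |c. c \<in> cocycles X \<and> (\<forall>q \<sigma>. q \<noteq> p \<longrightarrow> c q \<sigma> = 0)}"

definition cochain_map ::
    "'a topology \<Rightarrow> ('a \<Rightarrow> 'b) \<Rightarrow> ('b, 'k::field) cochain \<Rightarrow> ('a, 'k) cochain" where
  "cochain_map X f c = (\<lambda>p \<sigma>. if singular_simplex p X \<sigma> then c p (simplex_map p f \<sigma>) else 0)"

text \<open>The map \<open>H\<^sup>*(Y) \<rightarrow> H\<^sup>*(X)\<close> induced by \<open>f\<close> from \<open>X\<close> to \<open>Y\<close>.\<close>

definition cohomology_map ::
    "'a topology \<Rightarrow> ('a \<Rightarrow> 'b) \<Rightarrow> ('b, 'k::field) cochain set \<Rightarrow> ('a, 'k) cochain set" where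
  "cohomology_map X f C = (\<Union>c\<in>C. cohomology_class X (cochain_map X f c))"


section \<open>Persistent cup-length and erosion distance\<close>

text \<open>
  \<open>G p\<close> is the set of homogeneous elements of degree \<open>p\<close> of the ring \<open>R\<close>.  In \<open>enat\<close>, \<open>Sup {}\<close>
  is \<open>0\<close> (relevant only for the zero ring), and the supremum is attained unless it is infinite.
\<close>

definition graded_length :: "('r, 'm) ring_scheme \<Rightarrow> (nat \<Rightarrow> 'r set) \<Rightarrow> enat" where
  "graded_length R G =
     Sup {enat (length \<eta>s) |\<eta>s. (\<forall>\<eta> \<in> set \<eta>s. \<exists>p>0. \<eta> \<in> G p) \<and>
                               foldr (mult R) \<eta>s (one R) \<noteq> zero R}"

definition persistent_cup_length :: "'k::field itself \<Rightarrow> 'a pspace \<Rightarrow> real \<Rightarrow> real \<Rightarrow> enat" where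
  "persistent_cup_length K X a b =
     (let f = (cohomology_map (Sp X a) (Tr X a b)
                 :: ('a, 'k) cochain set \<Rightarrow> ('a, 'k) cochain set)
      in graded_length
           ((cohomology_ring (Sp X a))\<lparr>carrier := f ` carrier (cohomology_ring (Sp X b))\<rparr>)
           (\<lambda>p. f ` cohomology p (Sp X b)))"

text \<open>Functions on closed intervals \<open>[a,b]\<close> are written as functions of \<open>a\<close> and \<open>b\<close> with \<open>a \<le> b\<close>.\<close>

definition eroded :: "real \<Rightarrow> (real \<Rightarrow> real \<Rightarrow> enat) \<Rightarrow> (real \<Rightarrow> real \<Rightarrow> enat) \<Rightarrow> bool" where
  "eroded \<epsilon> J1 J2 \<longleftrightarrow>
     (\<forall>a b. a \<le> b \<longrightarrow> J1 a b \<ge> J2 (a - \<epsilon>) (b + \<epsilon>) \<and> J2 a b \<ge> J1 (a - \<epsilon>) (b + \<epsilon>))"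

definition erosion_distance :: "(real \<Rightarrow> real \<Rightarrow> enat) \<Rightarrow> (real \<Rightarrow> real \<Rightarrow> enat) \<Rightarrow> ereal" where
  "erosion_distance J1 J2 = Inf {ereal \<epsilon> |\<epsilon>. 0 \<le> \<epsilon> \<and> eroded \<epsilon> J1 J2}"


section \<open>Vietoris--Rips filtrations\<close>

text \<open>
  Points of the geometric realization are given by their barycentric coordinates.  The topology
  is the weak one: a set is open iff its intersection with each closed simplex is open there.
\<close>

definition closed_simplex :: "'a set \<Rightarrow> ('a \<Rightarrow> real) set" where
  "closed_simplex S = {\<alpha>. (\<forall>x\<in>S. 0 \<le> \<alpha> x) \<and> (\<forall>x. x \<notin> S \<longrightarrow> \<alpha> x = 0) \<and> (\<Sum>x\<in>S. \<alpha> x) = 1}"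

definition realization_open :: "'a set set \<Rightarrow> ('a \<Rightarrow> real) set \<Rightarrow> bool" where
  "realization_open \<K> U \<longleftrightarrow>
     U \<subseteq> (\<Union>S\<in>\<K>. closed_simplex S) \<and>
     (\<forall>S\<in>\<K>. openin (subtopology (powertop_real UNIV) (closed_simplex S)) (U \<inter> closed_simplex S))"

definition geometric_realization :: "'a set set \<Rightarrow> ('a \<Rightarrow> real) topology" where
  "geometric_realization \<K> = topology (realization_open \<K>)"

lemma istopology_realization_open: "istopology (realization_open \<K>)"
  unfolding istopology_def
proof (intro conjI allI impI)
  fix U V assume U: "realization_open \<K> U" and V: "realization_open \<K> V"
  have "(U \<inter> V) \<inter> closed_simplex S = (U \<inter> closed_simplex S) \<inter> (V \<inter> closed_simplex S)" for S
    by blast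
  with U V show "realization_open \<K> (U \<inter> V)"
    unfolding realization_open_def by (auto intro: openin_Int)
next
  fix \<U> assume *: "\<forall>U\<in>\<U>. realization_open \<K> U"
  have "openin (subtopology (powertop_real UNIV) (closed_simplex S)) (\<Union>\<U> \<inter> closed_simplex S)"
    if "S \<in> \<K>" for S
  proof -
    have "\<Union>\<U> \<inter> closed_simplex S = (\<Union>U\<in>\<U>. U \<inter> closed_simplex S)"
      by blast
    then show ?thesis
      using * that unfolding realization_open_def by (metis (no_types, lifting) imageE openin_Union)
  qed
  with * show "realization_open \<K> (\<Union>\<U>)"
    unfolding realization_open_def by blast
qed

lemma openin_geometric_realization: "openin (geometric_realization \<K>) = realization_open \<K>"
  by (simp add: geometric_realization_def topology_inverse' istopology_realization_open)

definition vr_complex :: "'a set \<Rightarrow> ('a \<Rightarrow> 'a \<Rightarrow> real) \<Rightarrow> real \<Rightarrow> 'a set set" where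
  "vr_complex M d t = {S. finite S \<and> S \<noteq> {} \<and> S \<subseteq> M \<and> (\<forall>x\<in>S. \<forall>y\<in>S. d x y \<le> t)}"

definition vietoris_rips :: "'a set \<Rightarrow> ('a \<Rightarrow> 'a \<Rightarrow> real) \<Rightarrow> ('a \<Rightarrow> real) pspace" where
  "vietoris_rips M d = \<lparr>Sp = (\<lambda>t. geometric_realization (vr_complex M d t)), Tr = (\<lambda>s t \<alpha>. \<alpha>)\<rparr>"


section \<open>Gromov--Hausdorff distance\<close>

definition Hausdorff_distance :: "('a \<Rightarrow> 'a \<Rightarrow> real) \<Rightarrow> 'a set \<Rightarrow> 'a set \<Rightarrow> ereal" where
  "Hausdorff_distance d A B =
     Inf {ereal r |r. 0 \<le> r \<and> (\<forall>a\<in>A. \<exists>b\<in>B. d a b \<le> r) \<and> (\<forall>b\<in>B. \<exists>a\<in>A. d a b \<le> r)}"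

definition isometric_embedding ::
    "'a set \<Rightarrow> ('a \<Rightarrow> 'a \<Rightarrow> real) \<Rightarrow> 'b set \<Rightarrow> ('b \<Rightarrow> 'b \<Rightarrow> real) \<Rightarrow> ('a \<Rightarrow> 'b) \<Rightarrow> bool" where
  "isometric_embedding M d N e f \<longleftrightarrow> f ` M \<subseteq> N \<and> (\<forall>x\<in>M. \<forall>y\<in>M. e (f x) (f y) = d x y)"

text \<open>
  The infimum over all metric spaces \<open>Z\<close> containing isometric copies of both spaces.  Only the
  union of the two copies matters, so it is enough that \<open>Z\<close> is a subset of \<open>'a + 'b\<close>.
\<close>

definition Gromov_Hausdorff_distance ::
    "'a set \<Rightarrow> ('a \<Rightarrow> 'a \<Rightarrow> real) \<Rightarrow> 'b set \<Rightarrow> ('b \<Rightarrow> 'b \<Rightarrow> real) \<Rightarrow> ereal" where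
  "Gromov_Hausdorff_distance M d N e =
     Inf {Hausdorff_distance m (f ` M) (g ` N) |(Z :: ('a + 'b) set) m f g.
            Metric_space Z m \<and> isometric_embedding M d Z m f \<and> isometric_embedding N e Z m g}"

end

theory Submission
  imports Defs
begin

text \<open>
  If \<open>T'\<close> factors through \<open>T\<close> up to homotopy, then the image of \<open>T'\<close> in cohomology is at most as long
  as that of \<open>T\<close>.  An \<open>\<epsilon>\<close>-interleaving factors each transition map over \<open>[a-\<epsilon>, b+\<epsilon>]\<close> of one
  persistent space through the transition map over \<open>[a, b]\<close> of the other one, and a correspondence of
  distortion \<open>2r\<close> does the same for Vietoris--Rips filtrations with \<open>\<epsilon> = 2r\<close>, up to a straight-line
  homotopy.  What remains is that a weak homotopy equivalence \<open>f : Z \<rightarrow> X\<close> induces an isomorphism in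
  cohomology.  For this, every singular simplex of \<open>X\<close> is deformed, compatibly with faces, into one of the form
  \<open>f \<circ> \<tau>\<close>, by lifting homotopies from the boundary of a simplex to the simplex; the prism operator then
  relates a cochain on \<open>X\<close> to its pullback along the deformation.  Making \<open>f\<close> injective, by
  taking the product of \<open>X\<close> with the points of \<open>Z\<close> in the indiscrete topology, avoids a mapping cylinder and
  allows the simplices of \<open>Z\<close> to stay fixed.
\<close>

section \<open>The cochain algebra\<close>

text \<open>The definition of a weak homotopy equivalence speaks only of path components and of
  cubes whose boundary goes to one point, whereas a deformation of singular simplices that respects
  faces needs lifts with an arbitrary prescribed map on the boundary. Most of the topology below
  bridges this gap: injectivity on homotopy classes provides some extension over the disc, and
  surjectivity then corrects it until a homotopy relative to the boundary exists. The maps that a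
  correspondence induces between Vietoris--Rips complexes compose to the transition maps only up to
  homotopy, so they are not an interleaving of spaces. The common criterion
  \<open>persistent_cup_length_shift\<close> therefore asks for a homotopy. Interleavings satisfy it
  with equality, and the second inequality comes from it directly instead of passing through the
  homotopy interleaving distance. Ring computations are carried out with cocycles: a product of
  classes in the image ring vanishes exactly if the product of the pulled-back representatives is a
  coboundary on the source.\<close>

lemma singular_face_singular_face:
  assumes "i \<le> j" "j \<le> Suc m"
  shows "singular_face (Suc m) i (singular_face (Suc (Suc m)) (Suc j) \<sigma>) =
         singular_face (Suc m) j (singular_face (Suc (Suc m)) i \<sigma>)"
proof (rule ext)
  fix t
  show "singular_face (Suc m) i (singular_face (Suc (Suc m)) (Suc j) \<sigma>) t =
        singular_face (Suc m) j (singular_face (Suc (Suc m)) i \<sigma>) t"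
  proof (cases "t \<in> standard_simplex m")
    case True
    have "simplical_face i t \<in> standard_simplex (Suc m)" "simplical_face j t \<in> standard_simplex (Suc m)"
      using True assms by (simp_all add: simplical_face_in_standard_simplex)
    moreover have "simplical_face (Suc j) (simplical_face i t) = simplical_face i (simplical_face j t)"
      using assms unfolding simplical_face_def by fastforce
    ultimately show ?thesis
      using True by (simp add: singular_face_def)
  qed (simp add: singular_face_def)
qed

text \<open>The pairs with \<open>j < i\<close> are matched with those with \<open>i \<le> j\<close>
  by sending \<open>(i, j)\<close> to \<open>(j, i - 1)\<close>. Matched terms carry the same value,
  and the exponents of their signs differ by one.\<close>

lemma alternating_face_sum_eq_0:
  fixes a :: "nat \<Rightarrow> nat \<Rightarrow> 'k::comm_ring_1"
  assumes "\<And>i j. \<lbrakk>i \<le> j; j \<le> m\<rbrakk> \<Longrightarrow> a (Suc j) i = a i j"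
  shows "(\<Sum>i\<le>Suc m. \<Sum>j\<le>m. (-1) ^ (i + j) * a i j) = 0"
proof -
  let ?S = "{..Suc m} \<times> {..m}"
  let ?g = "\<lambda>(i, j). (-1) ^ (i + j) * a i j"
  let ?L = "{(i, j). i \<in> {..Suc m} \<and> j \<in> {..m} \<and> j < i}"
  let ?U = "{(i, j). i \<in> {..Suc m} \<and> j \<in> {..m} \<and> i \<le> j}"
  have S: "?S = ?L \<union> ?U" "?L \<inter> ?U = {}"
    by auto
  have fin: "finite ?L" "finite ?U"
    by (rule finite_subset [of _ ?S]; auto)+
  have L: "sum ?g ?L = (\<Sum>(i, j)\<in>?U. - ((-1) ^ (i + j) * a i j))"
    by (rule sum.reindex_bij_witness [where i = "\<lambda>(i, j). (Suc j, i)" and j = "\<lambda>(i, j). (j, i - 1)"])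
       (auto simp: gr0_conv_Suc dest!: less_imp_Suc_add simp: assms add.commute)
  have "(\<Sum>i\<le>Suc m. \<Sum>j\<le>m. (-1) ^ (i + j) * a i j) = sum ?g ?S"
    by (simp only: sum.cartesian_product)
  also have "\<dots> = sum ?g ?L + sum ?g ?U"
    by (simp only: S(1) sum.union_disjoint [OF fin S(2)])
  also have "\<dots> = 0"
    unfolding L by (simp add: case_prod_unfold sum_negf)
  finally show ?thesis .
qed

lemma coboundary_0: "coboundary X c 0 \<sigma> = 0"
  by (simp add: coboundary_def)

lemma coboundary_coboundary:
  "coboundary X (coboundary X c) = (\<lambda>_ _. 0)"
proof (intro ext)
  fix n \<sigma>
  show "coboundary X (coboundary X c) n \<sigma> = 0"
  proof (cases "singular_simplex n X \<sigma> \<and> 1 < n")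
    case True
    then obtain m where n: "n = Suc (Suc m)"
      using less_imp_Suc_add [of 1 n] by auto
    have face: "singular_simplex (Suc m) X (singular_face n i \<sigma>)" if "i \<le> n" for i
      using that True singular_simplex_singular_face [of n X \<sigma> i] by (simp add: n)
    have "coboundary X (coboundary X c) n \<sigma> =
      (\<Sum>i\<le>Suc (Suc m). \<Sum>j\<le>Suc m. (-1) ^ (i + j) *
         c m (singular_face (Suc m) j (singular_face (Suc (Suc m)) i \<sigma>)))"
      using True face
      by (simp add: coboundary_def n sum_distrib_left power_add mult.assoc del: sum.atMost_Suc)
    also have "\<dots> = 0"
      by (rule alternating_face_sum_eq_0) (simp add: singular_face_singular_face)
    finally show ?thesis .
  next
    case False
    then consider "\<not> singular_simplex n X \<sigma>" | "n = 0" | "n = 1"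
      by linarith
    then show ?thesis
      by cases (simp_all add: coboundary_def)
  qed
qed

section \<open>Front and back faces and the Leibniz rule\<close>

definition back_shift :: "nat \<Rightarrow> (nat \<Rightarrow> real) \<Rightarrow> nat \<Rightarrow> real" where
  "back_shift p x = (\<lambda>i. if i < p then 0 else x (i - p))"

lemma back_face_eq: "back_face p q \<sigma> = restrict (\<sigma> \<circ> back_shift p) (standard_simplex q)"
  by (simp add: back_face_def back_shift_def comp_def)

lemma back_shift_in_standard_simplex:
  assumes "x \<in> standard_simplex q"
  shows "back_shift p x \<in> standard_simplex (p + q)"
proof -
  have "(\<Sum>i\<le>p + q. back_shift p x i) = (\<Sum>i\<in>{p..p + q}. x (i - p))"
    by (rule sum.mono_neutral_cong_right) (auto simp: back_shift_def)
  also have "\<dots> = (\<Sum>i\<le>q. x i)"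
    by (rule sum.reindex_bij_witness [where i = "\<lambda>i. i + p" and j = "\<lambda>i. i - p"]) auto
  finally show ?thesis
    using assms by (auto simp: standard_simplex_def back_shift_def)
qed

lemma simplical_face_eq_self:
  assumes "x \<in> standard_simplex p" "p < i"
  shows "simplical_face i x = x"
  using assms by (auto simp: standard_simplex_def simplical_face_def)

lemma singular_simplex_front_face:
  assumes "singular_simplex n X \<sigma>" "p \<le> n"
  shows "singular_simplex p X (front_face p \<sigma>)"
proof -
  have "continuous_map (subtopology (powertop_real UNIV) (standard_simplex p)) X \<sigma>"
    using assms continuous_map_from_subtopology_mono standard_simplex_mono
    unfolding singular_simplex_def by blast
  then show ?thesis
    unfolding singular_simplex_def front_face_def
    by (auto intro: continuous_map_eq)
qed

lemma continuous_map_back_shift: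
  "continuous_map (subtopology (powertop_real UNIV) (standard_simplex q))
     (subtopology (powertop_real UNIV) (standard_simplex (p + q))) (back_shift p)"
proof -
  have "continuous_map (powertop_real UNIV) euclideanreal (\<lambda>x. back_shift p x i)" for i
    by (cases "i < p") (auto simp: back_shift_def intro: continuous_map_product_projection)
  then show ?thesis
    by (auto simp: continuous_map_in_subtopology continuous_map_componentwise_UNIV
        back_shift_in_standard_simplex intro: continuous_map_from_subtopology)
qed

lemma singular_simplex_back_face:
  assumes "singular_simplex (p + q) X \<sigma>"
  shows "singular_simplex q X (back_face p q \<sigma>)"
proof -
  have "continuous_map (subtopology (powertop_real UNIV) (standard_simplex q)) X (\<sigma> \<circ> back_shift p)"
    using assms continuous_map_compose [OF continuous_map_back_shift]
    unfolding singular_simplex_def by blast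
  then show ?thesis
    unfolding singular_simplex_def back_face_eq
    by (auto intro: continuous_map_eq)
qed

text \<open>Both formulas apply at \<open>i = Suc p\<close>. Comparing them there gives
  \<open>singular_face_front_face\<close>, the face that cancels in the Leibniz rule.\<close>

lemma front_face_singular_face:
  assumes "p \<le> m"
  shows "i \<le> Suc p \<Longrightarrow> front_face p (singular_face (Suc m) i \<sigma>) = singular_face (Suc p) i (front_face (Suc p) \<sigma>)"
    and "p < i \<Longrightarrow> front_face p (singular_face (Suc m) i \<sigma>) = front_face p \<sigma>"
  using standard_simplex_mono [OF assms]
  by (auto simp: front_face_def singular_face_def fun_eq_iff restrict_def
      simplical_face_in_standard_simplex simplical_face_eq_self)

lemma singular_face_front_face:
  "singular_face (Suc p) (Suc p) (front_face (Suc p) \<sigma>) = front_face p \<sigma>"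
  using front_face_singular_face [of p p "Suc p" \<sigma>] by simp

lemma simplical_face_back_shift:
  "i \<le> p \<Longrightarrow> simplical_face i (back_shift p x) = back_shift (Suc p) x"
  "p < i \<Longrightarrow> simplical_face i (back_shift p x) = back_shift p (simplical_face (i - p) x)"
  "back_shift p (simplical_face 0 x) = back_shift (Suc p) x"
  by (auto simp: simplical_face_def back_shift_def fun_eq_iff)

lemma back_face_singular_face:
  shows "i \<le> p \<Longrightarrow> back_face p q (singular_face (Suc (p + q)) i \<sigma>) = back_face (Suc p) q \<sigma>"
    and "\<lbrakk>p < i; i \<le> Suc (p + q)\<rbrakk> \<Longrightarrow> back_face p q (singular_face (Suc (p + q)) i \<sigma>) =
           singular_face (Suc q) (i - p) (back_face p (Suc q) \<sigma>)"
  by (auto simp: back_face_eq singular_face_def fun_eq_iff restrict_def simplical_face_back_shift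
      back_shift_in_standard_simplex simplical_face_in_standard_simplex)

lemma singular_face_back_face:
  "singular_face (Suc q) 0 (back_face p (Suc q) \<sigma>) = back_face (Suc p) q \<sigma>"
  by (auto simp: back_face_eq singular_face_def fun_eq_iff restrict_def simplical_face_back_shift
      simplical_face_in_standard_simplex)

text \<open>A total cochain has components in several degrees, so the sign of the graded Leibniz
  rule cannot be a scalar factor and becomes an operator.\<close>

definition alternate_sign :: "('a, 'k::field) cochain \<Rightarrow> ('a, 'k) cochain" where
  "alternate_sign c = (\<lambda>p \<sigma>. (-1) ^ p * c p \<sigma>)"

lemma sum_atMost_Suc_reindex:
  fixes f :: "nat \<Rightarrow> 'k::comm_monoid_add"
  assumes "p \<le> m"
  shows "(\<Sum>i\<in>{Suc p..Suc m}. f i) = (\<Sum>j\<le>m - p. f (Suc (p + j)))"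
  by (rule sum.reindex_bij_witness [where i = "\<lambda>j. Suc (p + j)" and j = "\<lambda>i. i - Suc p"])
     (use assms in auto)

text \<open>For every splitting degree \<open>p\<close> the faces of a simplex are divided according
  to whether the deleted vertex lies in the front or in the back part. Each of the two products on
  the right has one further face per \<open>p\<close>, and these cancel.\<close>

lemma coboundary_cup_product:
  fixes c d :: "('a, 'k::field) cochain"
  shows "coboundary X (cup_product X c d) =
    (\<lambda>n \<sigma>. cup_product X (coboundary X c) d n \<sigma> +
            cup_product X (alternate_sign c) (coboundary X d) n \<sigma>)"
proof (intro ext)
  fix n \<sigma>
  show "coboundary X (cup_product X c d) n \<sigma> =
    cup_product X (coboundary X c) d n \<sigma> + cup_product X (alternate_sign c) (coboundary X d) n \<sigma>"
  proof (cases "singular_simplex n X \<sigma> \<and> 0 < n")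
    case False
    then consider "\<not> singular_simplex n X \<sigma>" | "n = 0"
      by blast
    then show ?thesis
      by cases (simp_all add: coboundary_def cup_product_def)
  next
    case True
    then obtain m where n: "n = Suc m" and \<sigma>: "singular_simplex (Suc m) X \<sigma>"
      using gr0_implies_Suc by blast
    have face: "singular_simplex m X (singular_face (Suc m) i \<sigma>)" if "i \<le> Suc m" for i
      using that \<sigma> singular_simplex_singular_face [of "Suc m" X \<sigma> i] by simp
    \<comment> \<open>\<open>A p\<close> gathers the faces that delete one of the vertices
      \<open>0, \<dots>, p\<close>, and \<open>B p\<close> those that delete one of the vertices
      \<open>p+1, \<dots>, m+1\<close>.\<close>
    define A where "A p = (\<Sum>i\<le>p. (-1) ^ i * c p (singular_face (Suc p) i (front_face (Suc p) \<sigma>)))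
                            * d (m - p) (back_face (Suc p) (m - p) \<sigma>)" for p
    \<comment> \<open>In \<open>E p\<close> the front factor stops at vertex \<open>p\<close> and
      the back factor starts at vertex \<open>p+1\<close>. It arises as the last face of the front
      \<open>(p+1)\<close>-face and as face \<open>0\<close> of the back face starting at
      \<open>p\<close>, with opposite signs.\<close>
    define E where "E p = (-1) ^ p * c p (front_face p \<sigma>) * d (m - p) (back_face (Suc p) (m - p) \<sigma>)" for p
    define B where "B p = (-1) ^ p * c p (front_face p \<sigma>) *
      (\<Sum>j\<le>m - p. (-1) ^ Suc j * d (m - p) (singular_face (Suc (m - p)) (Suc j) (back_face p (Suc (m - p)) \<sigma>)))" for p
    have inner: "(\<Sum>i\<le>Suc m. (-1) ^ i * (c p (front_face p (singular_face (Suc m) i \<sigma>)) *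
           d (m - p) (back_face p (m - p) (singular_face (Suc m) i \<sigma>)))) = A p + B p"
      (is "?S = _") if "p \<le> m" for p
    proof -
      have bf1: "back_face p (m - p) (singular_face (Suc m) i \<sigma>) = back_face (Suc p) (m - p) \<sigma>" if "i \<le> p" for i
        using back_face_singular_face(1)[OF that, of "m - p" \<sigma>] \<open>p \<le> m\<close> by simp
      have bf2: "back_face p (m - p) (singular_face (Suc m) (Suc (p + j)) \<sigma>) =
           singular_face (Suc (m - p)) (Suc j) (back_face p (Suc (m - p)) \<sigma>)" if "j \<le> m - p" for j
        using back_face_singular_face(2)[of p "Suc (p + j)" "m - p" \<sigma>] \<open>p \<le> m\<close> that by (simp add: Suc_diff_le)
      have "?S = (\<Sum>i\<le>p. (-1) ^ i * (c p (front_face p (singular_face (Suc m) i \<sigma>)) *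
                     d (m - p) (back_face p (m - p) (singular_face (Suc m) i \<sigma>))))
               + (\<Sum>i\<in>{Suc p..Suc m}. (-1) ^ i * (c p (front_face p (singular_face (Suc m) i \<sigma>)) *
                     d (m - p) (back_face p (m - p) (singular_face (Suc m) i \<sigma>))))"
      proof -
        have "{..Suc m} = {..p} \<union> {Suc p..Suc m}" "{..p} \<inter> {Suc p..Suc m} = {}"
          using that by auto
        then show ?thesis
          by (metis (no_types, lifting) sum.union_disjoint finite_atMost finite_atLeastAtMost)
      qed
      also have "(\<Sum>i\<le>p. (-1) ^ i * (c p (front_face p (singular_face (Suc m) i \<sigma>)) *
                     d (m - p) (back_face p (m - p) (singular_face (Suc m) i \<sigma>)))) = A p"
        unfolding A_def sum_distrib_right
        by (intro sum.cong) (simp_all add: mult.assoc bf1 front_face_singular_face(1)[OF that])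
      also have "(\<Sum>i\<in>{Suc p..Suc m}. (-1) ^ i * (c p (front_face p (singular_face (Suc m) i \<sigma>)) *
                     d (m - p) (back_face p (m - p) (singular_face (Suc m) i \<sigma>)))) = B p"
        unfolding B_def sum_distrib_left sum_atMost_Suc_reindex [OF that]
        by (intro sum.cong) (simp_all add: bf2 front_face_singular_face(2)[OF that] power_add mult_ac)
      finally show ?thesis .
    qed
    have "coboundary X (cup_product X c d) n \<sigma> =
        (\<Sum>i\<le>Suc m. \<Sum>p\<le>m. (-1) ^ i * (c p (front_face p (singular_face (Suc m) i \<sigma>)) *
           d (m - p) (back_face p (m - p) (singular_face (Suc m) i \<sigma>))))"
      using \<sigma> face
      by (simp add: n coboundary_def cup_product_def sum_distrib_left del: sum.atMost_Suc)
    also have "\<dots> = (\<Sum>p\<le>m. A p + B p)"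
      by (subst sum.swap) (rule sum.cong [OF refl], simp only: atMost_iff inner)
    finally have L: "coboundary X (cup_product X c d) n \<sigma> = (\<Sum>p\<le>m. A p + B p)" .
    have dc: "coboundary X c (Suc p) (front_face (Suc p) \<sigma>) * d (m - p) (back_face (Suc p) (m - p) \<sigma>) = A p - E p"
      if "p \<le> m" for p
    proof -
      have "singular_simplex (Suc p) X (front_face (Suc p) \<sigma>)"
        using \<sigma> that by (intro singular_simplex_front_face) auto
      then have "coboundary X c (Suc p) (front_face (Suc p) \<sigma>) =
          (\<Sum>i\<le>p. (-1) ^ i * c p (singular_face (Suc p) i (front_face (Suc p) \<sigma>))) - (-1) ^ p * c p (front_face p \<sigma>)"
        by (simp add: coboundary_def singular_face_front_face)
      then show ?thesis
        by (simp only: A_def E_def left_diff_distrib)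
    qed
    have R1: "cup_product X (coboundary X c) d n \<sigma> = (\<Sum>p\<le>m. A p - E p)"
    proof -
      have "cup_product X (coboundary X c) d n \<sigma> =
         (\<Sum>p\<le>Suc m. coboundary X c p (front_face p \<sigma>) * d (Suc m - p) (back_face p (Suc m - p) \<sigma>))"
        using \<sigma> by (simp only: cup_product_def n if_True)
      also have "\<dots> = (\<Sum>p\<le>m. coboundary X c (Suc p) (front_face (Suc p) \<sigma>) * d (m - p) (back_face (Suc p) (m - p) \<sigma>))"
        unfolding sum.atMost_Suc_shift by (simp add: coboundary_0)
      also have "\<dots> = (\<Sum>p\<le>m. A p - E p)"
        by (rule sum.cong) (simp_all only: dc atMost_iff)
      finally show ?thesis .
    qed
    have dd: "(-1) ^ p * c p (front_face p \<sigma>) * coboundary X d (Suc m - p) (back_face p (Suc m - p) \<sigma>) = E p + B p"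
      if "p \<le> m" for p
    proof -
      have "singular_simplex (Suc (m - p)) X (back_face p (Suc (m - p)) \<sigma>)"
        using \<sigma> that by (intro singular_simplex_back_face) simp
      then have "coboundary X d (Suc (m - p)) (back_face p (Suc (m - p)) \<sigma>) =
          (\<Sum>j\<le>Suc (m - p). (-1) ^ j * d (m - p) (singular_face (Suc (m - p)) j (back_face p (Suc (m - p)) \<sigma>)))"
        by (simp only: coboundary_def) simp
      also have "\<dots> = d (m - p) (back_face (Suc p) (m - p) \<sigma>) +
          (\<Sum>j\<le>m - p. (-1) ^ Suc j * d (m - p) (singular_face (Suc (m - p)) (Suc j) (back_face p (Suc (m - p)) \<sigma>)))"
        unfolding sum.atMost_Suc_shift by (simp only: singular_face_back_face power_0 mult_1)
      finally show ?thesis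
        using that by (simp only: Suc_diff_le B_def E_def distrib_left)
    qed
    have R2: "cup_product X (alternate_sign c) (coboundary X d) n \<sigma> = (\<Sum>p\<le>m. E p + B p)"
    proof -
      have "cup_product X (alternate_sign c) (coboundary X d) n \<sigma> =
         (\<Sum>p\<le>Suc m. (-1) ^ p * c p (front_face p \<sigma>) * coboundary X d (Suc m - p) (back_face p (Suc m - p) \<sigma>))"
        using \<sigma> by (simp only: cup_product_def alternate_sign_def n if_True)
      also have "\<dots> = (\<Sum>p\<le>m. (-1) ^ p * c p (front_face p \<sigma>) * coboundary X d (Suc m - p) (back_face p (Suc m - p) \<sigma>))"
        by (simp add: coboundary_0)
      also have "\<dots> = (\<Sum>p\<le>m. E p + B p)"
        by (rule sum.cong) (simp_all only: dd atMost_iff)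
      finally show ?thesis .
    qed
    show ?thesis
      unfolding L R1 R2 by (simp only: sum.distrib sum_subtractf) simp
  qed
qed

section \<open>Linearity, and closure of cochains and cocycles under the operations\<close>

lemma coboundary_add:
  "coboundary X (\<lambda>p \<sigma>. c p \<sigma> + d p \<sigma>) = (\<lambda>p \<sigma>. coboundary X c p \<sigma> + coboundary X d p \<sigma>)"
  by (auto simp: coboundary_def fun_eq_iff sum.distrib algebra_simps simp del: sum.atMost_Suc)

lemma coboundary_minus:
  "coboundary X (\<lambda>p \<sigma>. - c p \<sigma>) = (\<lambda>p \<sigma>. - coboundary X c p \<sigma>)"
  by (auto simp: coboundary_def fun_eq_iff sum_negf simp del: sum.atMost_Suc)

lemma coboundary_zero: "coboundary X (\<lambda>_ _. 0) = (\<lambda>_ _. 0)"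
  by (auto simp: coboundary_def fun_eq_iff)

lemma cup_product_add_left:
  "cup_product X (\<lambda>p \<sigma>. c p \<sigma> + c' p \<sigma>) d =
   (\<lambda>p \<sigma>. cup_product X c d p \<sigma> + cup_product X c' d p \<sigma>)"
  by (auto simp: cup_product_def fun_eq_iff sum.distrib algebra_simps simp del: sum.atMost_Suc)

lemma cup_product_add_right:
  "cup_product X c (\<lambda>p \<sigma>. d p \<sigma> + d' p \<sigma>) =
   (\<lambda>p \<sigma>. cup_product X c d p \<sigma> + cup_product X c d' p \<sigma>)"
  by (auto simp: cup_product_def fun_eq_iff sum.distrib algebra_simps simp del: sum.atMost_Suc)

lemma cup_product_zero:
  "cup_product X (\<lambda>_ _. 0) d = (\<lambda>_ _. 0)" "cup_product X c (\<lambda>_ _. 0) = (\<lambda>_ _. 0)"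
  by (auto simp: cup_product_def fun_eq_iff)

lemma coboundary_alternate_sign:
  "coboundary X (alternate_sign c) = (\<lambda>n \<sigma>. - alternate_sign (coboundary X c) n \<sigma>)"
proof (intro ext)
  fix n \<sigma>
  show "coboundary X (alternate_sign c) n \<sigma> = - alternate_sign (coboundary X c) n \<sigma>"
    by (cases n) (simp_all add: coboundary_def alternate_sign_def sum_distrib_left mult.left_commute sum_negf
        del: sum.atMost_Suc)
qed

lemma alternate_sign_alternate_sign: "alternate_sign (alternate_sign c) = c"
  by (auto simp: alternate_sign_def fun_eq_iff simp flip: mult.assoc power_add)

lemma cochains_zero: "(\<lambda>_ _. 0) \<in> cochains X"
  by (simp add: cochains_def)

lemma cochains_add:
  assumes "c \<in> cochains X" "d \<in> cochains X"
  shows "(\<lambda>p \<sigma>. c p \<sigma> + d p \<sigma>) \<in> cochains X"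
proof -
  have "{p. \<exists>\<sigma>. c p \<sigma> + d p \<sigma> \<noteq> 0} \<subseteq> {p. \<exists>\<sigma>. c p \<sigma> \<noteq> 0} \<union> {p. \<exists>\<sigma>. d p \<sigma> \<noteq> 0}"
    by auto
  then show ?thesis
    using assms finite_subset unfolding cochains_def by fastforce
qed

lemma cochains_minus: "c \<in> cochains X \<Longrightarrow> (\<lambda>p \<sigma>. - c p \<sigma>) \<in> cochains X"
  by (simp add: cochains_def)

lemma cochains_alternate_sign: "c \<in> cochains X \<Longrightarrow> alternate_sign c \<in> cochains X"
  by (simp add: cochains_def alternate_sign_def)

text \<open>The degrees in which the product is nonzero lie in the sumset of two finite
  sets.\<close>

lemma cochains_cup_product:
  assumes "c \<in> cochains X" "d \<in> cochains X"
  shows "cup_product X c d \<in> cochains X"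
proof -
  let ?S = "\<lambda>c. {p. \<exists>\<sigma>. c p \<sigma> \<noteq> 0}"
  have "?S (cup_product X c d) \<subseteq> (\<lambda>(p, q). p + q) ` (?S c \<times> ?S d)"
  proof clarify
    fix n \<sigma>
    assume nz: "cup_product X c d n \<sigma> \<noteq> 0"
    then have "(\<Sum>p\<le>n. c p (front_face p \<sigma>) * d (n - p) (back_face p (n - p) \<sigma>)) \<noteq> 0"
      by (auto simp: cup_product_def split: if_splits)
    then obtain p where "p \<le> n" "c p (front_face p \<sigma>) * d (n - p) (back_face p (n - p) \<sigma>) \<noteq> 0"
      by (meson atMost_iff sum.neutral)
    then have "n = p + (n - p)" "p \<in> ?S c" "n - p \<in> ?S d"
      by auto
    then show "n \<in> (\<lambda>(p, q). p + q) ` (?S c \<times> ?S d)"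
      by (auto simp: image_iff intro!: bexI [of _ "(p, n - p)"])
  qed
  moreover have "finite (?S c)" "finite (?S d)"
    using assms by (auto simp: cochains_def)
  ultimately have "finite (?S (cup_product X c d))"
    by (meson finite_SigmaI finite_imageI finite_subset)
  then show ?thesis
    by (simp add: cochains_def cup_product_def)
qed

lemma cochains_coboundary:
  assumes "c \<in> cochains X"
  shows "coboundary X c \<in> cochains X"
proof -
  have "{p. \<exists>\<sigma>. coboundary X c p \<sigma> \<noteq> 0} \<subseteq> Suc ` {p. \<exists>\<sigma>. c p \<sigma> \<noteq> 0}"
  proof clarify
    fix n \<sigma>
    assume nz: "coboundary X c n \<sigma> \<noteq> 0"
    then have "(\<Sum>i\<le>n. (-1) ^ i * c (n - 1) (singular_face n i \<sigma>)) \<noteq> 0" "0 < n"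
      by (auto simp: coboundary_def split: if_splits)
    then obtain i where "c (n - 1) (singular_face n i \<sigma>) \<noteq> 0"
      by (metis (no_types, lifting) mult_zero_right sum.neutral)
    then show "n \<in> Suc ` {p. \<exists>\<sigma>. c p \<sigma> \<noteq> 0}"
      using \<open>0 < n\<close> by (intro image_eqI [of _ _ "n - 1"]) auto
  qed
  moreover have "finite (Suc ` {p. \<exists>\<sigma>. c p \<sigma> \<noteq> 0})"
    using assms by (simp add: cochains_def)
  ultimately have "finite {p. \<exists>\<sigma>. coboundary X c p \<sigma> \<noteq> 0}"
    using finite_subset by blast
  then show ?thesis
    by (simp add: cochains_def) (simp add: coboundary_def)
qed

definition unit_cochain :: "'a topology \<Rightarrow> ('a, 'k::field) cochain" where
  "unit_cochain X = (\<lambda>p \<sigma>. if p = 0 \<and> singular_simplex 0 X \<sigma> then 1 else 0)"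

lemma unit_cochain_cocycle: "(unit_cochain X :: ('a, 'k::field) cochain) \<in> cocycles X"
proof -
  have "coboundary X (unit_cochain X) n \<sigma> = (0 :: 'k)" for n \<sigma>
  proof (cases "n = 1 \<and> singular_simplex n X \<sigma>")
    \<comment> \<open>An edge has two end points, on each of which the unit takes the value 1, and
      they enter with opposite signs.\<close>
    case True
    then have "singular_simplex 0 X (singular_face 1 0 \<sigma>)" "singular_simplex 0 X (singular_face 1 1 \<sigma>)"
      using singular_simplex_singular_face [of 1 X \<sigma>] by auto
    with True show ?thesis
      by (simp add: coboundary_def unit_cochain_def)
  next
    case False
    then consider "\<not> singular_simplex n X \<sigma>" | "n = 0" | "n - 1 \<noteq> 0"
      by linarith
    then show ?thesis
      by cases (simp_all add: coboundary_def unit_cochain_def)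
  qed
  moreover have "{p. \<exists>\<sigma>. (unit_cochain X p \<sigma> :: 'k) \<noteq> 0} \<subseteq> {0}"
    by (auto simp: unit_cochain_def split: if_splits)
  then have "finite {p. \<exists>\<sigma>. (unit_cochain X p \<sigma> :: 'k) \<noteq> 0}"
    using finite_subset by blast
  ultimately show ?thesis
    by (auto simp: cocycles_def cochains_def unit_cochain_def)
qed

lemma cocycles_cup_product:
  assumes "c \<in> cocycles X" "d \<in> cocycles X"
  shows "cup_product X c d \<in> cocycles X"
  using assms by (simp add: cocycles_def cochains_cup_product coboundary_cup_product cup_product_zero)

section \<open>Cohomologous cochains and the quotient ring\<close>

definition cohomologous :: "'a topology \<Rightarrow> ('a, 'k::field) cochain \<Rightarrow> ('a, 'k) cochain \<Rightarrow> bool" where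
  "cohomologous X c d \<longleftrightarrow> (\<exists>b\<in>cochains X. c = (\<lambda>p \<sigma>. coboundary X b p \<sigma> + d p \<sigma>))"

lemma cohomologous_refl: "cohomologous X c c"
  unfolding cohomologous_def by (rule bexI [of _ "\<lambda>_ _. 0"]) (simp_all add: coboundary_zero cochains_zero)

lemma cohomologous_sym: "cohomologous X c d \<Longrightarrow> cohomologous X d c"
  unfolding cohomologous_def
proof clarify
  fix b :: "('a, 'b) cochain"
  assume "b \<in> cochains X"
  then show "\<exists>b'\<in>cochains X. d = (\<lambda>p \<sigma>. coboundary X b' p \<sigma> + (coboundary X b p \<sigma> + d p \<sigma>))"
    by (intro bexI [of _ "\<lambda>p \<sigma>. - b p \<sigma>"]) (simp_all add: coboundary_minus cochains_minus)
qed

lemma cohomologous_trans: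
  assumes "cohomologous X c d" "cohomologous X d e"
  shows "cohomologous X c e"
proof -
  from assms obtain a b where "a \<in> cochains X" "b \<in> cochains X"
    "c = (\<lambda>p \<sigma>. coboundary X a p \<sigma> + d p \<sigma>)" "d = (\<lambda>p \<sigma>. coboundary X b p \<sigma> + e p \<sigma>)"
    by (auto simp: cohomologous_def)
  then show ?thesis
    unfolding cohomologous_def
    by (intro bexI [of _ "\<lambda>p \<sigma>. a p \<sigma> + b p \<sigma>"]) (simp_all add: coboundary_add cochains_add add.assoc)
qed

lemma cohomologous_cocycles:
  assumes "cohomologous X c d" "d \<in> cocycles X"
  shows "c \<in> cocycles X"
  using assms
  by (auto simp: cohomologous_def cocycles_def coboundary_add coboundary_coboundary
      intro: cochains_add cochains_coboundary)

text \<open>One factor is changed at a time. By the Leibniz rule, the product of a primitive of the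
  difference with the other, closed factor is a primitive of the difference of the products.\<close>

lemma cohomologous_cup_product:
  assumes "cohomologous X c c'" "cohomologous X d d'" "c' \<in> cocycles X" "d' \<in> cocycles X"
  shows "cohomologous X (cup_product X c d) (cup_product X c' d')"
proof (rule cohomologous_trans)
  have d: "d \<in> cocycles X"
    using assms cohomologous_cocycles by blast
  from assms(1) obtain a where a: "a \<in> cochains X" "c = (\<lambda>p \<sigma>. coboundary X a p \<sigma> + c' p \<sigma>)"
    by (auto simp: cohomologous_def)
  have "coboundary X (cup_product X a d) = cup_product X (coboundary X a) d"
    using d by (simp add: coboundary_cup_product cocycles_def cup_product_zero)
  then show "cohomologous X (cup_product X c d) (cup_product X c' d)"
    unfolding cohomologous_def
    using a d by (intro bexI [of _ "cup_product X a d"])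
      (simp_all add: cup_product_add_left cochains_cup_product cocycles_def)
  from assms(2) obtain b where b: "b \<in> cochains X" "d = (\<lambda>p \<sigma>. coboundary X b p \<sigma> + d' p \<sigma>)"
    by (auto simp: cohomologous_def)
  \<comment> \<open>The primitive now stands on the right, so the Leibniz rule twists
    \<open>c'\<close>. Twisting it beforehand undoes this, since \<open>alternate_sign\<close> is an
    involution and preserves closedness.\<close>
  have "alternate_sign c' \<in> cochains X" "coboundary X (alternate_sign c') = (\<lambda>_ _. 0)"
    using assms(3) by (simp_all add: cocycles_def cochains_alternate_sign coboundary_alternate_sign)
      (simp add: alternate_sign_def)
  moreover from this have "coboundary X (cup_product X (alternate_sign c') b) = cup_product X c' (coboundary X b)"
    by (simp add: coboundary_cup_product cup_product_zero alternate_sign_alternate_sign)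
  ultimately show "cohomologous X (cup_product X c' d) (cup_product X c' d')"
    unfolding cohomologous_def
    using b by (intro bexI [of _ "cup_product X (alternate_sign c') b"])
      (simp_all add: cup_product_add_right cochains_cup_product)
qed

text \<open>Additive cosets of the coboundaries are the classes of \<open>cohomologous\<close>,
  which lets all later arguments use representatives.\<close>

lemma cohomology_class_eq: "cohomology_class X c = {d. cohomologous X d c}"
  by (auto simp: cohomology_class_def a_r_coset_def r_coset_def cocycle_ring_def coboundaries_def
      cohomologous_def)

lemma cohomology_class_eq_iff: "cohomology_class X c = cohomology_class X d \<longleftrightarrow> cohomologous X c d"
  unfolding cohomology_class_eq
  using cohomologous_refl cohomologous_sym cohomologous_trans by blast

lemma coboundaries_eq: "coboundaries X = {c. cohomologous X c (\<lambda>_ _. 0)}"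
  by (auto simp: coboundaries_def cohomologous_def)

lemma cohomology_ring_zero: "\<zero>\<^bsub>cohomology_ring X\<^esub> = coboundaries X"
  by (simp add: cohomology_ring_def FactRing_def)

lemma cohomology_ring_one: "\<one>\<^bsub>cohomology_ring X\<^esub> = cohomology_class X (unit_cochain X)"
  by (simp add: cohomology_ring_def FactRing_def cohomology_class_def unit_cochain_def)
    (simp add: cocycle_ring_def)

text \<open>The multiplication of the quotient ring is a union of cosets over all pairs of
  representatives. These cosets coincide, and the index sets are nonempty because
  \<open>cohomologous\<close> is reflexive.\<close>

lemma cohomology_ring_mult:
  assumes "c \<in> cocycles X" "d \<in> cocycles X"
  shows "cohomology_class X c \<otimes>\<^bsub>cohomology_ring X\<^esub> cohomology_class X d =
         cohomology_class X (cup_product X c d)"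
proof -
  have "cohomology_class X c \<otimes>\<^bsub>cohomology_ring X\<^esub> cohomology_class X d =
    (\<Union>a\<in>cohomology_class X c. \<Union>b\<in>cohomology_class X d. cohomology_class X (cup_product X a b))"
    by (simp add: cohomology_ring_def FactRing_def rcoset_mult_def cohomology_class_def)
      (simp add: cocycle_ring_def)
  also have "\<dots> = (\<Union>a\<in>cohomology_class X c. \<Union>b\<in>cohomology_class X d. cohomology_class X (cup_product X c d))"
    by (intro SUP_cong refl)
      (use assms in \<open>auto simp: cohomology_class_eq cohomology_class_eq_iff [unfolded cohomology_class_eq]
         intro: cohomologous_cup_product\<close>)
  also have "\<dots> = cohomology_class X (cup_product X c d)"
    unfolding cohomology_class_eq using cohomologous_refl by blast
  finally show ?thesis .
qed

lemma foldr_mult_cohomology_class: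
  assumes "set cs \<subseteq> cocycles X"
  shows "foldr (cup_product X) cs (unit_cochain X) \<in> cocycles X"
    and "foldr (mult (cohomology_ring X)) (map (cohomology_class X) cs) \<one>\<^bsub>cohomology_ring X\<^esub> =
         cohomology_class X (foldr (cup_product X) cs (unit_cochain X))"
  using assms
  by (induction cs)
    (simp_all add: unit_cochain_cocycle cocycles_cup_product cohomology_ring_one cohomology_ring_mult)

subsection \<open>Induced maps\<close>

lemma cochain_map_coboundary:
  assumes f: "continuous_map X Y f"
  shows "cochain_map X f (coboundary Y c) = coboundary X (cochain_map X f c)"
proof (intro ext)
  fix n \<sigma>
  show "cochain_map X f (coboundary Y c) n \<sigma> = coboundary X (cochain_map X f c) n \<sigma>"
  proof (cases "0 < n \<and> singular_simplex n X \<sigma>")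
    case True
    have "simplex_map (n - 1) f (singular_face n i \<sigma>) = singular_face n i (simplex_map n f \<sigma>)" if "i \<le> n" for i
      using that True by (simp add: singular_face_simplex_map) (simp add: singular_face_def simplex_map_def fun_eq_iff)
    with True show ?thesis
      using singular_simplex_simplex_map [OF _ f, of n \<sigma>] singular_simplex_singular_face [of n X \<sigma>]
      by (simp add: cochain_map_def coboundary_def)
  next
    case False
    then show ?thesis
      by (auto simp: cochain_map_def coboundary_def)
  qed
qed

lemma cochain_map_cup_product:
  assumes f: "continuous_map X Y f"
  shows "cochain_map X f (cup_product Y c d) = cup_product X (cochain_map X f c) (cochain_map X f d)"
proof (intro ext)
  fix n \<sigma>
  show "cochain_map X f (cup_product Y c d) n \<sigma> = cup_product X (cochain_map X f c) (cochain_map X f d) n \<sigma>"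
  proof (cases "singular_simplex n X \<sigma>")
    case True
    have ff: "front_face p (simplex_map n f \<sigma>) = simplex_map p f (front_face p \<sigma>)"
      and bf: "back_face p (n - p) (simplex_map n f \<sigma>) = simplex_map (n - p) f (back_face p (n - p) \<sigma>)"
      if "p \<le> n" for p
      using standard_simplex_mono [OF that] that back_shift_in_standard_simplex [of _ "n - p" p]
      by (auto simp: front_face_def back_face_eq simplex_map_def fun_eq_iff)
    show ?thesis
      using True singular_simplex_simplex_map [OF True f]
        singular_simplex_front_face [OF True] singular_simplex_back_face [of _ "n - _" X \<sigma>]
      by (simp add: cochain_map_def cup_product_def ff bf)
  qed (simp add: cochain_map_def cup_product_def)
qed

lemma cochain_map_unit_cochain:
  "continuous_map X Y f \<Longrightarrow> cochain_map X f (unit_cochain Y) = unit_cochain X"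
  by (auto simp: cochain_map_def unit_cochain_def fun_eq_iff singular_simplex_simplex_map)

lemma cochain_map_cochains:
  assumes "c \<in> cochains Y"
  shows "cochain_map X f c \<in> cochains X"
proof -
  have "{p. \<exists>\<sigma>. cochain_map X f c p \<sigma> \<noteq> 0} \<subseteq> {p. \<exists>\<sigma>. c p \<sigma> \<noteq> 0}"
    by (auto simp: cochain_map_def split: if_splits)
  moreover have "finite {p. \<exists>\<sigma>. c p \<sigma> \<noteq> 0}"
    using assms by (simp add: cochains_def)
  ultimately have "finite {p. \<exists>\<sigma>. cochain_map X f c p \<sigma> \<noteq> 0}"
    using finite_subset by blast
  then show ?thesis
    by (simp add: cochains_def) (simp add: cochain_map_def)
qed

lemma cochain_map_zero: "cochain_map X f (\<lambda>_ _. 0) = (\<lambda>_ _. 0)"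
  by (simp add: cochain_map_def)

lemma cochain_map_add:
  "cochain_map X f (\<lambda>p \<sigma>. c p \<sigma> + d p \<sigma>) = (\<lambda>p \<sigma>. cochain_map X f c p \<sigma> + cochain_map X f d p \<sigma>)"
  by (auto simp: cochain_map_def fun_eq_iff)

lemma cochain_map_cocycles:
  assumes "continuous_map X Y f" "c \<in> cocycles Y"
  shows "cochain_map X f c \<in> cocycles X"
  using assms cochain_map_cochains [of c Y X f]
  by (simp add: cocycles_def cochain_map_zero flip: cochain_map_coboundary)

lemma cochain_map_cohomologous:
  assumes f: "continuous_map X Y f" and "cohomologous Y c d"
  shows "cohomologous X (cochain_map X f c) (cochain_map X f d)"
proof -
  from assms obtain b where "b \<in> cochains Y" "c = (\<lambda>p \<sigma>. coboundary Y b p \<sigma> + d p \<sigma>)"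
    by (auto simp: cohomologous_def)
  then show ?thesis
    unfolding cohomologous_def
    by (intro bexI [of _ "cochain_map X f b"])
      (simp_all add: cochain_map_add cochain_map_coboundary [OF f] cochain_map_cochains [of b Y])
qed

lemma cochain_map_compose:
  assumes "continuous_map X Y f"
  shows "cochain_map X f (cochain_map Y g c) = cochain_map X (g \<circ> f) c"
  using assms
  by (auto simp: cochain_map_def fun_eq_iff simplex_map_compose singular_simplex_simplex_map)

lemma cochain_map_cong:
  assumes "\<And>x. x \<in> topspace X \<Longrightarrow> f x = g x"
  shows "cochain_map X f c = cochain_map X g c"
proof -
  have "simplex_map p f \<sigma> = simplex_map p g \<sigma>" if "singular_simplex p X \<sigma>" for p \<sigma>
    using that assms by (rule simplex_map_eq)
  then show ?thesis
    unfolding cochain_map_def by (intro ext) simp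
qed

lemma cohomology_map_class:
  assumes "continuous_map X Y f"
  shows "cohomology_map X f (cohomology_class Y c) = cohomology_class X (cochain_map X f c)"
  unfolding cohomology_map_def
proof safe
  fix d e
  assume "d \<in> cohomology_class Y c" "e \<in> cohomology_class X (cochain_map X f d)"
  then show "e \<in> cohomology_class X (cochain_map X f c)"
    unfolding cohomology_class_eq by (blast intro: cochain_map_cohomologous [OF assms] cohomologous_trans)
next
  fix e
  assume "e \<in> cohomology_class X (cochain_map X f c)"
  then show "e \<in> (\<Union>c\<in>cohomology_class Y c. cohomology_class X (cochain_map X f c))"
    using cohomologous_refl by (auto simp: cohomology_class_eq)
qed

subsection \<open>Cup-length of a map\<close>

definition homogeneous_cocycles :: "'a topology \<Rightarrow> nat \<Rightarrow> ('a, 'k::field) cochain set" where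
  "homogeneous_cocycles X p = {c \<in> cocycles X. \<forall>q \<sigma>. q \<noteq> p \<longrightarrow> c q \<sigma> = 0}"

lemma cochain_map_homogeneous_cocycles:
  assumes "continuous_map X Y f" "c \<in> homogeneous_cocycles Y p"
  shows "cochain_map X f c \<in> homogeneous_cocycles X p"
  using assms cochain_map_cocycles by (auto simp: homogeneous_cocycles_def cochain_map_def)

lemma cohomology_eq: "cohomology p X = cohomology_class X ` homogeneous_cocycles X p"
  by (auto simp: cohomology_def homogeneous_cocycles_def)

text \<open>The length of the image of the induced map, written with cocycle representatives. It
  refers to a single map, so maps between unrelated spaces, even on different types, can be
  compared.\<close>

definition map_cup_length :: "'k::field itself \<Rightarrow> 'a topology \<Rightarrow> 'b topology \<Rightarrow> ('a \<Rightarrow> 'b) \<Rightarrow> enat" where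
  "map_cup_length K X Y f =
     Sup {enat (length cs) |cs :: ('b, 'k) cochain list.
            (\<forall>c\<in>set cs. \<exists>p>0. c \<in> homogeneous_cocycles Y p) \<and>
            foldr (cup_product X) (map (cochain_map X f) cs) (unit_cochain X) \<notin> coboundaries X}"

text \<open>Each homogeneous element of the image is the class of a pulled-back homogeneous cocycle.
  Choosing one for every member of a list of classes translates lists of classes into lists of
  cocycles of the same length.\<close>

lemma persistent_cup_length_eq:
  assumes f: "continuous_map (Sp X a) (Sp X b) (Tr X a b)"
  shows "persistent_cup_length TYPE('k::field) X a b = map_cup_length TYPE('k) (Sp X a) (Sp X b) (Tr X a b)"
proof -
  let ?A = "Sp X a" and ?B = "Sp X b" and ?f = "Tr X a b"
  let ?F = "cohomology_map ?A ?f :: (_, 'k) cochain set \<Rightarrow> _"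
  let ?R = "cohomology_ring ?A :: (_, 'k) cochain set ring"
  have nonzero: "foldr (mult ?R) (map (cohomology_class ?A) (map (cochain_map ?A ?f) cs)) \<one>\<^bsub>?R\<^esub> \<noteq> \<zero>\<^bsub>?R\<^esub> \<longleftrightarrow>
      foldr (cup_product ?A) (map (cochain_map ?A ?f) cs) (unit_cochain ?A) \<notin> coboundaries ?A"
    if "\<forall>c\<in>set cs. \<exists>p>0. c \<in> homogeneous_cocycles ?B p" for cs :: "(_, 'k) cochain list"
  proof -
    have *: "set (map (cochain_map ?A ?f) cs) \<subseteq> cocycles ?A"
      using that cochain_map_cocycles [OF f] by (auto simp: homogeneous_cocycles_def)
    have z: "\<zero>\<^bsub>?R\<^esub> = cohomology_class ?A (\<lambda>_ _. 0)"
      by (simp add: cohomology_ring_zero coboundaries_eq cohomology_class_eq)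
    show ?thesis
      unfolding foldr_mult_cohomology_class(2) [OF *] z cohomology_class_eq_iff
      by (simp add: coboundaries_eq)
  qed
  have img: "?F ` cohomology p ?B = (\<lambda>c. cohomology_class ?A (cochain_map ?A ?f c)) ` homogeneous_cocycles ?B p" for p
    unfolding cohomology_eq image_image cohomology_map_class [OF f] ..
  have "{enat (length \<eta>s) |\<eta>s. (\<forall>\<eta>\<in>set \<eta>s. \<exists>p>0. \<eta> \<in> ?F ` cohomology p ?B) \<and>
            foldr (mult ?R) \<eta>s \<one>\<^bsub>?R\<^esub> \<noteq> \<zero>\<^bsub>?R\<^esub>} =
        {enat (length cs) |cs :: (_, 'k) cochain list. (\<forall>c\<in>set cs. \<exists>p>0. c \<in> homogeneous_cocycles ?B p) \<and>
            foldr (cup_product ?A) (map (cochain_map ?A ?f) cs) (unit_cochain ?A) \<notin> coboundaries ?A}"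
  proof (intro Collect_cong iffI; elim exE conjE)
    fix l \<eta>s
    assume l: "l = enat (length \<eta>s)" and \<eta>: "\<forall>\<eta>\<in>set \<eta>s. \<exists>p>0. \<eta> \<in> ?F ` cohomology p ?B"
      and nz: "foldr (mult ?R) \<eta>s \<one>\<^bsub>?R\<^esub> \<noteq> \<zero>\<^bsub>?R\<^esub>"
    from \<eta> have "\<forall>\<eta>\<in>set \<eta>s. \<exists>c. (\<exists>p>0. c \<in> homogeneous_cocycles ?B p) \<and>
        \<eta> = cohomology_class ?A (cochain_map ?A ?f c)"
      unfolding img by blast
    then obtain g where g: "\<And>\<eta>. \<eta> \<in> set \<eta>s \<Longrightarrow> (\<exists>p>0. g \<eta> \<in> homogeneous_cocycles ?B p) \<and>
        \<eta> = cohomology_class ?A (cochain_map ?A ?f (g \<eta>))"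
      by metis
    have "map (cohomology_class ?A) (map (cochain_map ?A ?f) (map g \<eta>s)) = \<eta>s"
      using g by (simp add: map_idI)
    with nz nonzero [of "map g \<eta>s"] g
    have "foldr (cup_product ?A) (map (cochain_map ?A ?f) (map g \<eta>s)) (unit_cochain ?A) \<notin> coboundaries ?A"
      by auto
    moreover have "\<forall>c\<in>set (map g \<eta>s). \<exists>p>0. c \<in> homogeneous_cocycles ?B p"
      using g by auto
    ultimately show "\<exists>cs :: (_, 'k) cochain list. l = enat (length cs) \<and>
        (\<forall>c\<in>set cs. \<exists>p>0. c \<in> homogeneous_cocycles ?B p) \<and>
        foldr (cup_product ?A) (map (cochain_map ?A ?f) cs) (unit_cochain ?A) \<notin> coboundaries ?A"
      by (intro exI [of _ "map g \<eta>s"] conjI) (simp_all add: l)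
  next
    fix l and cs :: "(_, 'k) cochain list"
    assume l: "l = enat (length cs)" and cs: "\<forall>c\<in>set cs. \<exists>p>0. c \<in> homogeneous_cocycles ?B p"
      and nz: "foldr (cup_product ?A) (map (cochain_map ?A ?f) cs) (unit_cochain ?A) \<notin> coboundaries ?A"
    show "\<exists>\<eta>s. l = enat (length \<eta>s) \<and>
        (\<forall>\<eta>\<in>set \<eta>s. \<exists>p>0. \<eta> \<in> ?F ` cohomology p ?B) \<and> foldr (mult ?R) \<eta>s \<one>\<^bsub>?R\<^esub> \<noteq> \<zero>\<^bsub>?R\<^esub>"
    proof (intro exI [of _ "map (cohomology_class ?A) (map (cochain_map ?A ?f) cs)"] conjI)
      show "foldr (mult ?R) (map (cohomology_class ?A) (map (cochain_map ?A ?f) cs)) \<one>\<^bsub>?R\<^esub> \<noteq> \<zero>\<^bsub>?R\<^esub>"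
        using nonzero [OF cs] nz by blast
      show "\<forall>\<eta>\<in>set (map (cohomology_class ?A) (map (cochain_map ?A ?f) cs)). \<exists>p>0. \<eta> \<in> ?F ` cohomology p ?B"
      proof
        fix \<eta>
        assume "\<eta> \<in> set (map (cohomology_class ?A) (map (cochain_map ?A ?f) cs))"
        then obtain c where c: "c \<in> set cs" "\<eta> = cohomology_class ?A (cochain_map ?A ?f c)"
          by auto
        with cs obtain p where "p > 0" "c \<in> homogeneous_cocycles ?B p"
          by blast
        with c show "\<exists>p>0. \<eta> \<in> ?F ` cohomology p ?B"
          unfolding img by blast
      qed
    qed (simp add: l)
  qed
  then show ?thesis
    by (simp add: persistent_cup_length_def graded_length_def map_cup_length_def)
qed

lemma foldr_cup_product_cohomologous:
  assumes "list_all2 (cohomologous X) cs ds" "set ds \<subseteq> cocycles X"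
  shows "cohomologous X (foldr (cup_product X) cs (unit_cochain X)) (foldr (cup_product X) ds (unit_cochain X))"
  using assms
  by (induction rule: list_all2_induct)
    (simp_all add: cohomologous_refl cohomologous_cup_product foldr_mult_cohomology_class(1))

lemma cochain_map_foldr_cup_product:
  assumes f: "continuous_map X Y f"
  shows "cochain_map X f (foldr (cup_product Y) cs (unit_cochain Y)) =
         foldr (cup_product X) (map (cochain_map X f) cs) (unit_cochain X)"
  by (induction cs) (simp_all add: f cochain_map_unit_cochain cochain_map_cup_product)

text \<open>A nonvanishing product for \<open>T\<close> is transferred, factor by factor, to one for
  \<open>T'\<close> of the same length. The relation \<open>R\<close> is left open because the two
  applications compare the factors on different sources: on \<open>A\<close> in
  \<open>map_cup_length_le\<close> and on \<open>A'\<close> in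
  \<open>map_cup_length_le_inj\<close>.\<close>

lemma map_cup_length_le_gen:
  assumes T: "continuous_map A B T" and T': "continuous_map A' B' T'"
    and lift: "\<And>p (c :: (_, 'k) cochain). \<lbrakk>0 < p; c \<in> homogeneous_cocycles B p\<rbrakk> \<Longrightarrow>
       \<exists>c'\<in>homogeneous_cocycles B' p. R (cochain_map A T c) (cochain_map A' T' c')"
    and R: "\<And>(cs :: (_, 'k) cochain list) (cs' :: (_, 'k) cochain list). \<lbrakk>list_all2 R cs cs'; set cs \<subseteq> cocycles A; set cs' \<subseteq> cocycles A';
       foldr (cup_product A') cs' (unit_cochain A') \<in> coboundaries A'\<rbrakk>
       \<Longrightarrow> foldr (cup_product A) cs (unit_cochain A) \<in> coboundaries A"
  shows "map_cup_length TYPE('k::field) A B T \<le> map_cup_length TYPE('k) A' B' T'"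
  unfolding map_cup_length_def
proof (rule Sup_mono, clarify)
  fix cs :: "(_, 'k) cochain list"
  assume cs: "\<forall>c\<in>set cs. \<exists>p>0. c \<in> homogeneous_cocycles B p"
    and nz: "foldr (cup_product A) (map (cochain_map A T) cs) (unit_cochain A) \<notin> coboundaries A"
  have "\<forall>c\<in>set cs. \<exists>c'. (\<exists>p>0. c' \<in> homogeneous_cocycles B' p) \<and> R (cochain_map A T c) (cochain_map A' T' c')"
    using cs lift by blast
  then obtain g where g: "\<And>c. c \<in> set cs \<Longrightarrow> (\<exists>p>0. g c \<in> homogeneous_cocycles B' p) \<and>
      R (cochain_map A T c) (cochain_map A' T' (g c))"
    by metis
  have "foldr (cup_product A') (map (cochain_map A' T') (map g cs)) (unit_cochain A') \<notin> coboundaries A'"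
  proof
    assume "foldr (cup_product A') (map (cochain_map A' T') (map g cs)) (unit_cochain A') \<in> coboundaries A'"
    moreover have "list_all2 R (map (cochain_map A T) cs) (map (cochain_map A' T') (map g cs))"
      using g by (simp add: list_all2_conv_all_nth)
    moreover have "set (map (cochain_map A T) cs) \<subseteq> cocycles A"
      using cs cochain_map_cocycles [OF T] by (auto simp: homogeneous_cocycles_def)
    moreover have "set (map (cochain_map A' T') (map g cs)) \<subseteq> cocycles A'"
      using g cochain_map_cocycles [OF T'] by (fastforce simp: homogeneous_cocycles_def)
    ultimately show False
      using R nz by blast
  qed
  moreover have "\<forall>c\<in>set (map g cs). \<exists>p>0. c \<in> homogeneous_cocycles B' p"
    using g by auto
  ultimately have "enat (length (map g cs)) \<in> {enat (length cs) |cs :: (_, 'k) cochain list. (\<forall>c\<in>set cs. \<exists>p>0. c \<in> homogeneous_cocycles B' p) \<and>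
      foldr (cup_product A') (map (cochain_map A' T') cs) (unit_cochain A') \<notin> coboundaries A'}"
    by (intro CollectI exI [of _ "map g cs"] conjI refl)
  then show "\<exists>a\<in>{enat (length cs) |cs :: (_, 'k) cochain list. (\<forall>c\<in>set cs. \<exists>p>0. c \<in> homogeneous_cocycles B' p) \<and>
      foldr (cup_product A') (map (cochain_map A' T') cs) (unit_cochain A') \<notin> coboundaries A'}. enat (length cs) \<le> a"
    by (rule bexI [rotated]) simp
qed

text \<open>Up to coboundaries, the factors on \<open>A\<close> are pullbacks along \<open>p\<close>
  of factors on \<open>A'\<close>. Were the product on \<open>A'\<close> a coboundary, its pullback
  would be one as well.\<close>

lemma map_cup_length_le:
  assumes T: "continuous_map A B T" and T': "continuous_map A' B' T'" and p: "continuous_map A A' p"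
    and lift: "\<And>q (c :: (_, 'k) cochain). \<lbrakk>0 < q; c \<in> homogeneous_cocycles B q\<rbrakk> \<Longrightarrow>
       \<exists>c'\<in>homogeneous_cocycles B' q. cohomologous A (cochain_map A T c) (cochain_map A p (cochain_map A' T' c'))"
  shows "map_cup_length TYPE('k::field) A B T \<le> map_cup_length TYPE('k) A' B' T'"
proof (rule map_cup_length_le_gen [OF T T', where R = "\<lambda>c c'. cohomologous A c (cochain_map A p c')"])
  fix cs :: "(_, 'k) cochain list" and cs' :: "(_, 'k) cochain list"
  assume R: "list_all2 (\<lambda>c c'. cohomologous A c (cochain_map A p c')) cs cs'"
    and cs': "set cs' \<subseteq> cocycles A'"
    and b: "foldr (cup_product A') cs' (unit_cochain A') \<in> coboundaries A'"
  have "cohomologous A (foldr (cup_product A) cs (unit_cochain A))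
     (foldr (cup_product A) (map (cochain_map A p) cs') (unit_cochain A))"
  proof (rule foldr_cup_product_cohomologous)
    show "list_all2 (cohomologous A) cs (map (cochain_map A p) cs')"
      using R by (simp add: list_all2_map2)
    show "set (map (cochain_map A p) cs') \<subseteq> cocycles A"
      using cs' cochain_map_cocycles [OF p] by auto
  qed
  moreover have "cohomologous A (foldr (cup_product A) (map (cochain_map A p) cs') (unit_cochain A)) (\<lambda>_ _. 0)"
  proof -
    have "cohomologous A' (foldr (cup_product A') cs' (unit_cochain A')) (\<lambda>_ _. 0)"
      using b by (simp add: coboundaries_eq)
    from cochain_map_cohomologous [OF p this] show ?thesis
      by (simp only: cochain_map_foldr_cup_product [OF p] cochain_map_zero)
  qed
  ultimately show "foldr (cup_product A) cs (unit_cochain A) \<in> coboundaries A"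
    unfolding coboundaries_eq mem_Collect_eq by (rule cohomologous_trans)
qed (use lift in auto)

text \<open>Here the comparison map runs from \<open>A'\<close> to \<open>A\<close>. The product on
  \<open>A'\<close> is the pullback of the one on \<open>A\<close>, and it cannot become a
  coboundary because pullback along \<open>p\<close> is injective on cohomology.\<close>

lemma map_cup_length_le_inj:
  assumes T: "continuous_map A B T" and T': "continuous_map A' B' T'"
    and p: "continuous_map A' A p" and q: "continuous_map B' B q"
    and comm: "\<And>x. x \<in> topspace A' \<Longrightarrow> T (p x) = q (T' x)"
    and inj: "\<And>(c :: (_, 'k) cochain). \<lbrakk>c \<in> cocycles A; cochain_map A' p c \<in> coboundaries A'\<rbrakk> \<Longrightarrow> c \<in> coboundaries A"
  shows "map_cup_length TYPE('k::field) A B T \<le> map_cup_length TYPE('k) A' B' T'"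
proof (rule map_cup_length_le_gen [OF T T', where R = "\<lambda>c c'. c' = cochain_map A' p c"])
  fix n and c :: "(_, 'k) cochain"
  assume "c \<in> homogeneous_cocycles B n"
  moreover have "cochain_map A' T' (cochain_map B' q c) = cochain_map A' p (cochain_map A T c)"
    unfolding cochain_map_compose [OF T'] cochain_map_compose [OF p]
    by (rule cochain_map_cong) (simp add: comm)
  ultimately show "\<exists>c'\<in>homogeneous_cocycles B' n. cochain_map A' T' c' = cochain_map A' p (cochain_map A T c)"
    using cochain_map_homogeneous_cocycles [OF q] by blast
next
  fix cs :: "(_, 'k) cochain list" and cs' :: "(_, 'k) cochain list"
  assume R: "list_all2 (\<lambda>c c'. c' = cochain_map A' p c) cs cs'" and cs: "set cs \<subseteq> cocycles A"
    and b: "foldr (cup_product A') cs' (unit_cochain A') \<in> coboundaries A'"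
  have "cs' = map (cochain_map A' p) cs"
    using R by (simp add: list_all2_conv_all_nth nth_equalityI)
  then show "foldr (cup_product A) cs (unit_cochain A) \<in> coboundaries A"
    using b by (intro inj foldr_mult_cohomology_class(1) [OF cs])
      (simp only: cochain_map_foldr_cup_product [OF p])
qed

section \<open>The prism operator\<close>

text \<open>The affine degeneracy of simplices that sends the vertices \<open>i\<close> and
  \<open>i+1\<close> to the same vertex \<open>i\<close>.\<close>

definition degenerate :: "nat \<Rightarrow> (nat \<Rightarrow> real) \<Rightarrow> nat \<Rightarrow> real" where
  "degenerate i x = (\<lambda>j. if j < i then x j else if j = i then x i + x (Suc i) else x (Suc j))"

text \<open>In the \<open>i\<close>-th prism simplex the vertices \<open>0, \<dots>, i\<close> lie at time \<open>0\<close>, the others at time \<open>1\<close>.\<close>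

definition prism_time :: "nat \<Rightarrow> (nat \<Rightarrow> real) \<Rightarrow> real" where
  "prism_time i x = 1 - (\<Sum>j\<le>i. x j)"

lemma sum_degenerate:
  "i \<le> n \<Longrightarrow> (\<Sum>j\<le>n. degenerate i x j) = (\<Sum>j\<le>Suc n. x j)"
proof (induction n rule: nat_induct)
  case (Suc n)
  show ?case
  proof (cases "i \<le> n")
    case True
    with Suc show ?thesis
      by (simp add: degenerate_def)
  next
    case False
    with Suc.prems have i: "i = Suc n"
      by simp
    have "(\<Sum>j\<le>n. degenerate i x j) = (\<Sum>j\<le>n. x j)"
      by (rule sum.cong) (auto simp: degenerate_def i)
    then show ?thesis
      by (simp add: degenerate_def i)
  qed
qed (simp add: degenerate_def)

lemma degenerate_in_standard_simplex:
  assumes "x \<in> standard_simplex (Suc n)" "i \<le> n"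
  shows "degenerate i x \<in> standard_simplex n"
proof -
  have nn: "0 \<le> degenerate i x j" for j
    using assms by (auto simp: degenerate_def standard_simplex_def)
  have z: "degenerate i x j = 0" if "n < j" for j
    using assms that by (auto simp: degenerate_def standard_simplex_def)
  have s: "(\<Sum>j\<le>n. degenerate i x j) = 1"
    using assms by (simp add: sum_degenerate standard_simplex_def del: sum.atMost_Suc)
  have "degenerate i x j \<le> 1" for j
  proof (cases "j \<le> n")
    case True
    then show ?thesis
      using member_le_sum [of j "{..n}" "degenerate i x"] nn s by simp
  qed (simp add: z)
  with nn z s show ?thesis
    by (simp add: standard_simplex_def)
qed

lemma sum_standard_simplex_le_1:
  assumes "x \<in> standard_simplex n" "finite A"
  shows "sum x A \<le> 1"
proof -
  have "sum x A = sum x (A \<inter> {..n})"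
    using assms by (intro sum.mono_neutral_right) (auto simp: standard_simplex_def not_le)
  also have "\<dots> \<le> sum x {..n}"
    using assms by (intro sum_mono2) (auto simp: standard_simplex_def)
  finally show ?thesis
    using assms by (simp add: standard_simplex_def)
qed

lemma prism_time_in_01: "x \<in> standard_simplex n \<Longrightarrow> prism_time i x \<in> {0..1}"
  using sum_standard_simplex_le_1 [of x n "{..i}"]
  by (auto simp: prism_time_def standard_simplex_def intro: sum_nonneg)

abbreviation simplex_top :: "nat \<Rightarrow> (nat \<Rightarrow> real) topology" where
  "simplex_top n \<equiv> subtopology (powertop_real UNIV) (standard_simplex n)"

abbreviation unit_interval :: "real topology" where
  "unit_interval \<equiv> top_of_set {0..1}"

lemma continuous_map_prism:
  assumes "i \<le> n"
  shows "continuous_map (simplex_top (Suc n)) (prod_topology unit_interval (simplex_top n))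
           (\<lambda>x. (prism_time i x, degenerate i x))"
proof -
  have *: "continuous_map (powertop_real UNIV) euclideanreal (\<lambda>x. x j)" for j
    by (rule continuous_map_product_projection) simp
  have "continuous_map (powertop_real UNIV) euclideanreal (prism_time i)"
    unfolding prism_time_def by (intro continuous_intros) (simp_all add: *)
  moreover have "continuous_map (powertop_real UNIV) euclideanreal (\<lambda>x. degenerate i x j)" for j
  proof -
    consider "j < i" | "j = i" | "j > i"
      by linarith
    then show ?thesis
      by cases (simp_all add: degenerate_def * continuous_map_add)
  qed
  then have "continuous_map (powertop_real UNIV) (powertop_real UNIV) (degenerate i)"
    by (simp add: continuous_map_componentwise_UNIV)
  ultimately show ?thesis
    using assms prism_time_in_01
    by (auto simp: continuous_map_paired continuous_map_in_subtopology degenerate_in_standard_simplex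
        intro: continuous_map_from_subtopology)
qed

text \<open>Since \<open>prism_time\<close> is one minus a partial sum of coordinates, these
  formulas give the times on the faces of a prism simplex.\<close>

lemma simplical_face_sums:
  fixes x :: "nat \<Rightarrow> real"
  shows
  "k < i \<Longrightarrow> (\<Sum>j\<le>i. simplical_face k x j) = (\<Sum>j\<le>i - 1. x j)"
  "i < k \<Longrightarrow> (\<Sum>j\<le>i. simplical_face k x j) = (\<Sum>j\<le>i. x j)"
  "(\<Sum>j\<le>i. simplical_face i x j) = (\<Sum>j<i. x j)"
proof -
  show gt: "(\<Sum>j\<le>i. simplical_face k x j) = (\<Sum>j\<le>i. x j)" if "i < k" for i k
    by (rule sum.cong) (use that in \<open>auto simp: simplical_face_def\<close>)
  show eq: "(\<Sum>j\<le>i. simplical_face i x j) = (\<Sum>j<i. x j)" for i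
  proof (cases i)
    case (Suc m)
    then show ?thesis
      using gt [of m i] by (simp add: lessThan_Suc_atMost) (simp add: simplical_face_def)
  qed (simp add: simplical_face_def)
  have "(\<Sum>j\<le>k + Suc m. simplical_face k x j) = (\<Sum>j\<le>k + m. x j)" for k m
  proof (induction m)
    case 0
    then show ?case
      using eq [of k] by (simp add: simplical_face_def flip: lessThan_Suc_atMost)
  next
    case (Suc m)
    then show ?case
      by (simp add: simplical_face_def)
  qed
  then show "(\<Sum>j\<le>i. simplical_face k x j) = (\<Sum>j\<le>i - 1. x j)" if "k < i" for i k
    using less_imp_Suc_add [OF that] by auto
qed

lemma degenerate_simplical_face:
  "k < i \<Longrightarrow> degenerate i (simplical_face k x) = simplical_face k (degenerate (i - 1) x)"
  "Suc i < k \<Longrightarrow> degenerate i (simplical_face k x) = simplical_face (k - 1) (degenerate i x)"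
  "degenerate i (simplical_face i x) = x"
  "degenerate i (simplical_face (Suc i) x) = x"
proof -
  show "degenerate i (simplical_face k x) = simplical_face k (degenerate (i - 1) x)" if "k < i"
  proof
    fix j
    consider "j < k" | "j = k" | "k < j" "j < i" | "j = i" | "i < j"
      by linarith
    then show "degenerate i (simplical_face k x) j = simplical_face k (degenerate (i - 1) x) j"
      by cases (use that in \<open>auto simp: degenerate_def simplical_face_def\<close>)
  qed
  show "degenerate i (simplical_face k x) = simplical_face (k - 1) (degenerate i x)" if "Suc i < k"
  proof
    fix j
    consider "j < i" | "j = i" | "i < j" "Suc j < k" | "Suc j = k" | "k < Suc j"
      by linarith
    then show "degenerate i (simplical_face k x) j = simplical_face (k - 1) (degenerate i x) j"
      by cases (use that in \<open>auto simp: degenerate_def simplical_face_def\<close>)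
  qed
qed (auto simp: degenerate_def simplical_face_def fun_eq_iff)

text \<open>\<open>F i k\<close> stands for face \<open>k\<close> of the \<open>i\<close>-th prism
  simplex, \<open>G i j\<close> for the \<open>i\<close>-th prism simplex over face \<open>j\<close>
  of the base, and \<open>D l\<close> for the walls inside the prism. Faces with
  \<open>k = i\<close> or \<open>k = Suc i\<close> are walls and telescope. In the remaining ones
  either \<open>i\<close> or \<open>k\<close> drops by one, which accounts for the minus
  sign.\<close>

lemma alternating_prism_sum:
  fixes F :: "nat \<Rightarrow> nat \<Rightarrow> 'k::comm_ring_1"
  assumes lo: "\<And>i k. \<lbrakk>k < i; i \<le> n\<rbrakk> \<Longrightarrow> F i k = G (i - 1) k"
    and hi: "\<And>i k. \<lbrakk>Suc i < k; k \<le> Suc n\<rbrakk> \<Longrightarrow> F i k = G i (k - 1)"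
    and d0: "\<And>i. i \<le> n \<Longrightarrow> F i i = D i"
    and d1: "\<And>i. i \<le> n \<Longrightarrow> F i (Suc i) = D (Suc i)"
  shows "(\<Sum>i\<le>n. (-1) ^ i * (\<Sum>k\<le>Suc n. (-1) ^ k * F i k)) =
         D 0 - D (Suc n) - (\<Sum>j\<le>n. (-1) ^ j * (\<Sum>i<n. (-1) ^ i * G i j))"
proof -
  let ?f = "\<lambda>(i, k). (-1) ^ (i + k) * F i k"
  let ?g = "\<lambda>(i, j). (-1) ^ (i + j) * G i j"
  let ?S = "{..n} \<times> {..Suc n}"
  let ?L = "{(i, k). i \<le> n \<and> k < i}"
  let ?D = "{(i, k). i \<le> n \<and> (k = i \<or> k = Suc i)}"
  let ?U = "{(i, k). k \<le> Suc n \<and> Suc i < k}"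
  let ?L' = "{(i, j). i < n \<and> j \<le> i}"
  let ?U' = "{(i, j). j \<le> n \<and> i < j}"
  have S: "?S = ?L \<union> (?D \<union> ?U)" "?L \<inter> (?D \<union> ?U) = {}" "?D \<inter> ?U = {}"
    by auto
  have finS: "finite ?S"
    by simp
  have fin: "finite ?L" "finite ?D" "finite ?U"
    by (rule finite_subset [OF _ finS]; auto)+
  have T: "{..<n} \<times> {..n} = ?L' \<union> ?U'" "?L' \<inter> ?U' = {}"
    by auto
  have fin': "finite ?L'" "finite ?U'"
    by (rule finite_subset [OF _ finS]; auto)+
  have L: "sum ?f ?L = (\<Sum>z\<in>?L'. - ?g z)"
    by (rule sum.reindex_bij_witness [where i = "\<lambda>(i, j). (Suc i, j)" and j = "\<lambda>(i, k). (i - 1, k)"])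
      (auto simp: gr0_conv_Suc lo dest!: less_imp_Suc_add)
  have U: "sum ?f ?U = (\<Sum>z\<in>?U'. - ?g z)"
    by (rule sum.reindex_bij_witness [where i = "\<lambda>(i, j). (i, Suc j)" and j = "\<lambda>(i, k). (i, k - 1)"])
      (auto simp: gr0_conv_Suc hi dest!: less_imp_Suc_add)
  have D: "sum ?f ?D = D 0 - D (Suc n)"
  proof -
    have *: "?D = Sigma {..n} (\<lambda>i. {i, Suc i})"
      by auto
    have sq: "(-1) ^ (i + i) = (1 :: 'k)" for i :: nat
      by (simp add: power_add flip: power_mult_distrib)
    have "sum ?f ?D = (\<Sum>i\<le>n. \<Sum>k\<in>{i, Suc i}. (-1) ^ (i + k) * F i k)"
      unfolding * by (subst sum.Sigma) auto
    also have "\<dots> = (\<Sum>i\<le>n. D i - D (Suc i))"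
      by (rule sum.cong) (simp_all add: d0 d1 sq)
    also have "\<dots> = D 0 - D (Suc n)"
      by (rule sum_telescope)
    finally show ?thesis .
  qed
  have "(\<Sum>i\<le>n. (-1) ^ i * (\<Sum>k\<le>Suc n. (-1) ^ k * F i k)) = sum ?f ?S"
    by (simp only: sum.cartesian_product [symmetric] sum_distrib_left power_add mult.assoc)
  also have "\<dots> = sum ?f ?L + (sum ?f ?D + sum ?f ?U)"
    by (simp only: S(1) sum.union_disjoint [OF fin(1) finite_UnI [OF fin(2,3)] S(2)]
        sum.union_disjoint [OF fin(2,3) S(3)])
  also have "\<dots> = D 0 - D (Suc n) - (sum ?g ?L' + sum ?g ?U')"
    unfolding L U D sum_negf by simp
  also have "sum ?g ?L' + sum ?g ?U' = sum ?g ({..<n} \<times> {..n})"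
    by (simp only: T(1) sum.union_disjoint [OF fin' T(2)])
  also have "\<dots> = (\<Sum>i<n. \<Sum>j\<le>n. (-1) ^ (i + j) * G i j)"
    by (simp only: sum.cartesian_product)
  also have "\<dots> = (\<Sum>j\<le>n. (-1) ^ j * (\<Sum>i<n. (-1) ^ i * G i j))"
    by (subst sum.swap) (simp only: sum_distrib_left power_add mult.assoc mult.left_commute)
  finally show ?thesis .
qed

text \<open>The homotopies are indexed by the singular simplices of \<open>W\<close> and need not
  come from a map of \<open>W\<close> into \<open>X\<close>. Thus the notion covers an ordinary
  homotopy as well as a deformation of simplices that is chosen one simplex at a time and matched
  only along faces.\<close>

definition natural_homotopy ::
    "'w topology \<Rightarrow> 'a topology \<Rightarrow> (nat \<Rightarrow> ((nat \<Rightarrow> real) \<Rightarrow> 'w) \<Rightarrow> real \<times> (nat \<Rightarrow> real) \<Rightarrow> 'a) \<Rightarrow> bool" where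
  "natural_homotopy W X H \<longleftrightarrow>
     (\<forall>n \<sigma>. singular_simplex n W \<sigma> \<longrightarrow>
        continuous_map (prod_topology unit_interval (simplex_top n)) X (H n \<sigma>)) \<and>
     (\<forall>n \<sigma> i t x. singular_simplex (Suc n) W \<sigma> \<longrightarrow> i \<le> Suc n \<longrightarrow> t \<in> {0..1} \<longrightarrow> x \<in> standard_simplex n \<longrightarrow>
        H (Suc n) \<sigma> (t, simplical_face i x) = H n (singular_face (Suc n) i \<sigma>) (t, x))"

definition homotopy_end ::
    "'w topology \<Rightarrow> (nat \<Rightarrow> ((nat \<Rightarrow> real) \<Rightarrow> 'w) \<Rightarrow> real \<times> (nat \<Rightarrow> real) \<Rightarrow> 'a) \<Rightarrow> real \<Rightarrow>
       ('a, 'k::field) cochain \<Rightarrow> ('w, 'k) cochain" where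
  "homotopy_end W H s c = (\<lambda>n \<sigma>. if singular_simplex n W \<sigma>
     then c n (restrict (\<lambda>x. H n \<sigma> (s, x)) (standard_simplex n)) else 0)"

text \<open>The transpose of the prism operator on chains; it lowers the degree by one.\<close>

definition prism_operator ::
    "'w topology \<Rightarrow> (nat \<Rightarrow> ((nat \<Rightarrow> real) \<Rightarrow> 'w) \<Rightarrow> real \<times> (nat \<Rightarrow> real) \<Rightarrow> 'a) \<Rightarrow>
       ('a, 'k::field) cochain \<Rightarrow> ('w, 'k) cochain" where
  "prism_operator W H c = (\<lambda>n \<sigma>. if singular_simplex n W \<sigma>
     then \<Sum>i\<le>n. (-1) ^ i * c (Suc n)
            (restrict (\<lambda>x. H n \<sigma> (prism_time i x, degenerate i x)) (standard_simplex (Suc n))) else 0)"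

lemma cochains_prism_operator:
  fixes c :: "('a, 'k::field) cochain"
  assumes "c \<in> cochains X"
  shows "prism_operator W H c \<in> cochains W"
proof -
  have "Suc ` {p. \<exists>\<sigma>. prism_operator W H c p \<sigma> \<noteq> 0} \<subseteq> {p. \<exists>\<sigma>. c p \<sigma> \<noteq> 0}"
  proof clarify
    fix n \<sigma>
    assume nz: "prism_operator W H c n \<sigma> \<noteq> 0"
    then have "(\<Sum>i\<le>n. (-1) ^ i * c (Suc n)
            (restrict (\<lambda>x. H n \<sigma> (prism_time i x, degenerate i x)) (standard_simplex (Suc n)))) \<noteq> 0"
      by (auto simp: prism_operator_def split: if_splits)
    then show "\<exists>\<tau>. c (Suc n) \<tau> \<noteq> 0"
      by (metis (no_types, lifting) mult_zero_right sum.neutral)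
  qed
  moreover have "finite {p. \<exists>\<sigma>. c p \<sigma> \<noteq> 0}"
    using assms by (simp add: cochains_def)
  ultimately have "finite (Suc ` {p. \<exists>\<sigma>. prism_operator W H c p \<sigma> \<noteq> 0})"
    using finite_subset by blast
  then have "finite {p. \<exists>\<sigma>. prism_operator W H c p \<sigma> \<noteq> 0}"
    by (rule finite_imageD) simp
  then show ?thesis
    by (simp add: cochains_def) (simp add: prism_operator_def)
qed

text \<open>A closed cochain has zero alternating sum over the faces of every prism simplex. Adding
  these relations with alternating signs leaves the top, the bottom and the prisms over the faces of
  \<sigma>.\<close>

lemma coboundary_prism_operator:
  fixes c :: "('a, 'k::field) cochain"
  assumes H: "natural_homotopy W X H" and c: "coboundary X c = (\<lambda>_ _. 0)"
  shows "coboundary W (prism_operator W H c) n \<sigma> = homotopy_end W H 1 c n \<sigma> - homotopy_end W H 0 c n \<sigma>"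
proof (cases "singular_simplex n W \<sigma>")
  case \<sigma>: True
  define F where "F i k = c n (restrict (\<lambda>x. H n \<sigma> (prism_time i (simplical_face k x), degenerate i (simplical_face k x)))
      (standard_simplex n))" for i k
  define G where "G i j = c n (restrict (\<lambda>x. H n \<sigma> (prism_time i x, simplical_face j (degenerate i x)))
      (standard_simplex n))" for i j
  \<comment> \<open>\<open>D l\<close> is the wall in which the vertices before \<open>l\<close> lie
    at time 0 and the others at time 1; \<open>D 0\<close> is the end at time 1 and
    \<open>D (Suc n)\<close> the end at time 0.\<close>
  define D where "D l = c n (restrict (\<lambda>x. H n \<sigma> (1 - (\<Sum>j<l. x j), x)) (standard_simplex n))" for l
  have pt: "k < i \<Longrightarrow> prism_time i (simplical_face k x) = prism_time (i - 1) x"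
    "i < k \<Longrightarrow> prism_time i (simplical_face k x) = prism_time i x"
    "prism_time i (simplical_face i x) = 1 - (\<Sum>j<i. x j)" for i k x
    by (simp_all add: prism_time_def simplical_face_sums)
  have zero: "(\<Sum>k\<le>Suc n. (-1) ^ k * F i k) = 0" if "i \<le> n" for i
  proof -
    let ?\<tau> = "restrict (\<lambda>x. H n \<sigma> (prism_time i x, degenerate i x)) (standard_simplex (Suc n))"
    have "continuous_map (simplex_top (Suc n)) X (H n \<sigma> \<circ> (\<lambda>x. (prism_time i x, degenerate i x)))"
      using H \<sigma> continuous_map_compose [OF continuous_map_prism [OF that]]
      unfolding natural_homotopy_def by blast
    then have \<tau>: "singular_simplex (Suc n) X ?\<tau>"
      unfolding singular_simplex_def by (auto intro: continuous_map_eq)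
    have "singular_face (Suc n) k ?\<tau> = restrict (\<lambda>x. H n \<sigma> (prism_time i (simplical_face k x), degenerate i (simplical_face k x)))
      (standard_simplex n)" if "k \<le> Suc n" for k
      using that by (auto simp: singular_face_def fun_eq_iff restrict_def simplical_face_in_standard_simplex)
    then have "coboundary X c (Suc n) ?\<tau> = (\<Sum>k\<le>Suc n. (-1) ^ k * F i k)"
      using \<tau> by (simp add: coboundary_def F_def del: sum.atMost_Suc)
    with c show ?thesis
      by simp
  qed
  have sum0: "0 = D 0 - D (Suc n) - (\<Sum>j\<le>n. (-1) ^ j * (\<Sum>i<n. (-1) ^ i * G i j))"
  proof -
    have "0 = (\<Sum>i\<le>n. (-1) ^ i * (\<Sum>k\<le>Suc n. (-1) ^ k * F i k))"
      using zero by (simp del: sum.atMost_Suc)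
    also have "\<dots> = D 0 - D (Suc n) - (\<Sum>j\<le>n. (-1) ^ j * (\<Sum>i<n. (-1) ^ i * G i j))"
    proof (rule alternating_prism_sum)
      show "F i k = G (i - 1) k" if "k < i" for i k
        by (simp only: F_def G_def pt(1) [OF that] degenerate_simplical_face(1) [OF that])
      show "F i k = G i (k - 1)" if "Suc i < k" for i k
        by (simp only: F_def G_def pt(2) [OF Suc_lessD [OF that]] degenerate_simplical_face(2) [OF that])
      show "F i i = D i" for i
        by (simp only: F_def D_def pt(3) degenerate_simplical_face(3))
      show "F i (Suc i) = D (Suc i)" for i
        by (simp only: F_def D_def pt(2) [OF lessI] degenerate_simplical_face(4))
          (simp only: prism_time_def lessThan_Suc_atMost)
    qed
    finally show ?thesis .
  qed
  have "coboundary W (prism_operator W H c) n \<sigma> = (\<Sum>j\<le>n. (-1) ^ j * (\<Sum>i<n. (-1) ^ i * G i j))"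
  proof (cases n)
    case (Suc m)
    have "prism_operator W H c m (singular_face n j \<sigma>) = (\<Sum>i<n. (-1) ^ i * G i j)" if "j \<le> n" for j
    proof -
      have "singular_simplex m W (singular_face n j \<sigma>)"
        using singular_simplex_singular_face [OF \<sigma>, of j] that by (simp add: Suc)
      then have "prism_operator W H c m (singular_face n j \<sigma>) = (\<Sum>i\<le>m. (-1) ^ i * c (Suc m)
            (restrict (\<lambda>x. H m (singular_face n j \<sigma>) (prism_time i x, degenerate i x)) (standard_simplex (Suc m))))"
        by (simp add: prism_operator_def)
      also have "\<dots> = (\<Sum>i<n. (-1) ^ i * G i j)"
      proof (rule sum.cong)
        fix i
        assume "i \<in> {..<n}"
        then have "restrict (\<lambda>x. H m (singular_face n j \<sigma>) (prism_time i x, degenerate i x)) (standard_simplex (Suc m))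
          = restrict (\<lambda>x. H n \<sigma> (prism_time i x, simplical_face j (degenerate i x))) (standard_simplex n)"
          using H \<sigma> that prism_time_in_01 [of _ "Suc m"] degenerate_in_standard_simplex [of _ m i]
          unfolding natural_homotopy_def Suc by (intro restrict_ext) auto
        then show "(-1) ^ i * c (Suc m)
            (restrict (\<lambda>x. H m (singular_face n j \<sigma>) (prism_time i x, degenerate i x)) (standard_simplex (Suc m)))
            = (-1) ^ i * G i j"
          by (simp add: G_def Suc)
      qed (auto simp: Suc)
      finally show ?thesis .
    qed
    with \<sigma> show ?thesis
      by (simp add: coboundary_def Suc del: sum.atMost_Suc)
  qed (simp add: coboundary_def)
  moreover have "homotopy_end W H 1 c n \<sigma> = D 0"
    using \<sigma> by (simp add: homotopy_end_def D_def)
  moreover have "homotopy_end W H 0 c n \<sigma> = D (Suc n)"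
    using \<sigma> unfolding homotopy_end_def D_def lessThan_Suc_atMost
    by (auto simp: standard_simplex_def cong: restrict_cong)
  ultimately show ?thesis
    using sum0 by (simp add: algebra_simps)
qed (simp add: coboundary_def homotopy_end_def)

lemma homotopy_ends_cohomologous:
  assumes "natural_homotopy W X H" "c \<in> cocycles X"
  shows "cohomologous W (homotopy_end W H 1 c) (homotopy_end W H 0 c)"
  unfolding cohomologous_def
proof (rule bexI)
  show "homotopy_end W H 1 c = (\<lambda>p \<sigma>. coboundary W (prism_operator W H c) p \<sigma> + homotopy_end W H 0 c p \<sigma>)"
    using assms coboundary_prism_operator [of W X H c] by (auto simp: cocycles_def)
  show "prism_operator W H c \<in> cochains W"
    using assms cochains_prism_operator [of c X W H] by (simp add: cocycles_def)
qed

lemma homotopic_imp_cohomologous: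
  assumes fg: "homotopic_with (\<lambda>_. True) X Y f g" and c: "c \<in> cocycles Y"
  shows "cohomologous X (cochain_map X f c) (cochain_map X g c)"
proof -
  obtain h where h: "continuous_map (prod_topology unit_interval X) Y h"
    and h0: "\<And>x. h (0, x) = f x" and h1: "\<And>x. h (1, x) = g x"
    using fg unfolding homotopic_with_def by auto
  define H where "H n \<sigma> = h \<circ> (\<lambda>(t, x). (t, \<sigma> x))" for n :: nat and \<sigma> :: "(nat \<Rightarrow> real) \<Rightarrow> 'a"
  have nat: "natural_homotopy X Y H"
    unfolding natural_homotopy_def
  proof (intro conjI allI impI)
    fix n \<sigma>
    assume "singular_simplex n X \<sigma>"
    then have "continuous_map (simplex_top n) X \<sigma>"
      by (simp add: singular_simplex_def)
    then have "continuous_map (prod_topology unit_interval (simplex_top n)) (prod_topology unit_interval X)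
        (\<lambda>(t, x). (t, \<sigma> x))"
      using continuous_map_prod_top [of unit_interval "simplex_top n" unit_interval X id \<sigma>] by simp
    then show "continuous_map (prod_topology unit_interval (simplex_top n)) Y (H n \<sigma>)"
      unfolding H_def using h by (rule continuous_map_compose)
  qed (simp add: H_def singular_face_def)
  have "homotopy_end X H 0 c = cochain_map X f c" "homotopy_end X H 1 c = cochain_map X g c"
    by (auto simp: homotopy_end_def cochain_map_def H_def h0 h1 simplex_map_def comp_def fun_eq_iff)
  with homotopy_ends_cohomologous [OF nat c] show ?thesis
    using cohomologous_sym by metis
qed

section \<open>Discs and spheres\<close>

text \<open>With the supremum norm the unit disc is the cube with side \<open>[-1, 1]\<close>, which
  an affine map identifies with \<open>cube\<close>; the recursion reduces continuity to that of
  \<open>max\<close> and the absolute value.\<close>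

primrec max_norm :: "nat \<Rightarrow> (nat \<Rightarrow> real) \<Rightarrow> real" where
  "max_norm 0 x = 0"
| "max_norm (Suc n) x = max (max_norm n x) \<bar>x n\<bar>"

text \<open>Coordinates from \<open>n\<close> on vanish, so discs of all dimensions share one type;
  in dimension 0 the disc is a point and its sphere is empty. The radius is a parameter because a
  disc is later enlarged by a collar to radius 2.\<close>

definition max_ball :: "nat \<Rightarrow> real \<Rightarrow> (nat \<Rightarrow> real) set" where
  "max_ball n r = {x. max_norm n x \<le> r \<and> (\<forall>i\<ge>n. x i = 0)}"

abbreviation disc :: "nat \<Rightarrow> (nat \<Rightarrow> real) set" where
  "disc n \<equiv> max_ball n 1"

definition max_sphere :: "nat \<Rightarrow> (nat \<Rightarrow> real) set" where
  "max_sphere n = {x \<in> disc n. max_norm n x = 1}"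

definition scl :: "real \<Rightarrow> (nat \<Rightarrow> real) \<Rightarrow> nat \<Rightarrow> real" where
  "scl k x = (\<lambda>i. k * x i)"

lemma max_norm_nonneg [simp]: "0 \<le> max_norm n x"
  by (induction n) auto

lemma max_norm_le_iff: "0 \<le> r \<Longrightarrow> max_norm n x \<le> r \<longleftrightarrow> (\<forall>i<n. \<bar>x i\<bar> \<le> r)"
  by (induction n) (auto simp: less_Suc_eq)

lemma abs_le_max_norm: "i < n \<Longrightarrow> \<bar>x i\<bar> \<le> max_norm n x"
  using max_norm_le_iff [of "max_norm n x" n x] by simp

lemma max_norm_scl [simp]: "max_norm n (scl k x) = \<bar>k\<bar> * max_norm n x"
  by (induction n) (auto simp: scl_def abs_mult max_mult_distrib_left)

lemma max_norm_cong: "(\<And>i. i < n \<Longrightarrow> \<bar>x i\<bar> = \<bar>y i\<bar>) \<Longrightarrow> max_norm n x = max_norm n y"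
  by (induction n) auto

lemma max_norm_zero [simp]: "max_norm n (\<lambda>_. 0) = 0"
  by (induction n) auto

lemma max_norm_attained: "0 < n \<Longrightarrow> \<exists>i<n. \<bar>x i\<bar> = max_norm n x"
proof (induction n)
  case (Suc n)
  show ?case
  proof (cases "n = 0 \<or> max_norm n x \<le> \<bar>x n\<bar>")
    case True
    then have "max_norm (Suc n) x = \<bar>x n\<bar>"
      by auto
    then show ?thesis
      by (intro exI [of _ n]) simp
  next
    case False
    with Suc obtain i where "i < n" "\<bar>x i\<bar> = max_norm n x"
      by blast
    with False show ?thesis
      by (intro exI [of _ i]) simp
  qed
qed simp

lemma scl_scl [simp]: "scl a (scl b x) = scl (a * b) x"
  by (simp add: scl_def mult.assoc)

lemma scl_1 [simp]: "scl 1 x = x"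
  by (simp add: scl_def)

lemma scl_0 [simp]: "scl 0 x = (\<lambda>_. 0)"
  by (simp add: scl_def)

lemma scl_zero [simp]: "scl k (\<lambda>_. 0) = (\<lambda>_. 0)"
  by (simp add: scl_def)

lemma zero_in_max_ball [simp]: "(\<lambda>_. 0) \<in> max_ball n r \<longleftrightarrow> 0 \<le> r"
  by (simp add: max_ball_def)

lemma max_ball_max_norm_0:
  assumes "x \<in> max_ball n r" "max_norm n x = 0"
  shows "x = (\<lambda>_. 0)"
proof
  fix i
  show "x i = 0"
    using assms abs_le_max_norm [of i n x] by (cases "i < n") (auto simp: max_ball_def)
qed

lemma scl_in_max_ball: "\<lbrakk>x \<in> max_ball n r; \<bar>k\<bar> * max_norm n x \<le> s\<rbrakk> \<Longrightarrow> scl k x \<in> max_ball n s"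
  by (auto simp: max_ball_def) (simp add: scl_def)

lemma max_sphere_subset_disc: "max_sphere n \<subseteq> disc n"
  by (auto simp: max_sphere_def)

lemma max_sphere_0: "max_sphere 0 = {}"
  by (simp add: max_sphere_def)

lemma disc_0: "disc 0 = {\<lambda>_. 0}"
  by (auto simp: max_ball_def)

lemma continuous_on_funI: "(\<And>i. continuous_on S (\<lambda>z. f z i)) \<Longrightarrow> continuous_on S f"
  for f :: "'z::topological_space \<Rightarrow> nat \<Rightarrow> real"
  by (rule continuous_on_coordinatewise_then_product)

lemma continuous_on_coord:
  "continuous_on S f \<Longrightarrow> continuous_on S (\<lambda>z. f z i)"
  for f :: "'z::topological_space \<Rightarrow> nat \<Rightarrow> real"
  by (rule continuous_on_product_then_coordinatewise)

lemma continuous_on_max_norm [continuous_intros]: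
  "continuous_on S f \<Longrightarrow> continuous_on S (\<lambda>z. max_norm n (f z))"
  by (induction n) (simp_all add: continuous_on_max continuous_on_rabs continuous_on_coord)

lemma continuous_on_scl [continuous_intros]:
  "\<lbrakk>continuous_on S k; continuous_on S f\<rbrakk> \<Longrightarrow> continuous_on S (\<lambda>z. scl (k z) (f z))"
  unfolding scl_def by (rule continuous_on_funI) (rule continuous_on_mult [OF _ continuous_on_coord])

text \<open>The ball is closed in a product of compact intervals, which is compact by Tychonoff's
  theorem.\<close>

lemma compact_max_ball: "compact (max_ball n r)"
proof -
  have "compactin (powertop_real UNIV) (UNIV \<rightarrow>\<^sub>E {-\<bar>r\<bar>..\<bar>r\<bar>})"
    by (simp add: compactin_PiE)
  then have K: "compact (UNIV \<rightarrow>\<^sub>E {-\<bar>r\<bar>..\<bar>r\<bar>} :: (nat \<Rightarrow> real) set)"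
    by (simp add: euclidean_product_topology)
  have "closed {x. max_norm n x \<le> r}"
    by (intro closed_Collect_le continuous_on_max_norm continuous_on_const continuous_on_id)
  moreover have "closed (\<Inter>i\<in>{n..}. {x :: nat \<Rightarrow> real. x i = 0})"
    by (intro closed_INT ballI closed_Collect_eq) simp_all
  ultimately have "closed ({x. max_norm n x \<le> r} \<inter> (\<Inter>i\<in>{n..}. {x. x i = 0}))"
    by (rule closed_Int)
  also have "{x. max_norm n x \<le> r} \<inter> (\<Inter>i\<in>{n..}. {x. x i = 0}) = max_ball n r"
    by (auto simp: max_ball_def)
  finally have "closed (max_ball n r)" .
  moreover have "max_ball n r \<subseteq> UNIV \<rightarrow>\<^sub>E {-\<bar>r\<bar>..\<bar>r\<bar>}"
  proof
    fix x
    assume x: "x \<in> max_ball n r"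
    have "\<bar>x i\<bar> \<le> \<bar>r\<bar>" for i
      using x abs_le_max_norm [of i n x] by (cases "i < n") (auto simp: max_ball_def)
    then show "x \<in> UNIV \<rightarrow>\<^sub>E {-\<bar>r\<bar>..\<bar>r\<bar>}"
      by (auto simp: abs_le_iff minus_le_iff)
  qed
  ultimately show ?thesis
    using K by (metis compact_Int_closed inf.absorb2)
qed

lemma continuous_map_top_of_set_compose:
  "\<lbrakk>continuous_map (top_of_set T) X g; continuous_on S h; h \<in> S \<rightarrow> T\<rbrakk>
   \<Longrightarrow> continuous_map (top_of_set S) X (\<lambda>z. g (h z))"
  using continuous_map_compose [of "top_of_set S" "top_of_set T" h X g] by (simp add: o_def)

lemma continuous_map_top_of_set_cases:
  fixes p :: "'z::topological_space \<Rightarrow> real"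
  assumes "continuous_on S p"
    and "continuous_map (top_of_set {z \<in> S. p z \<le> c}) X f"
    and "continuous_map (top_of_set {z \<in> S. c \<le> p z}) X g"
    and "\<And>z. \<lbrakk>z \<in> S; p z = c\<rbrakk> \<Longrightarrow> f z = g z"
  shows "continuous_map (top_of_set S) X (\<lambda>z. if p z \<le> c then f z else g z)"
proof -
  have *: "S \<inter> {z \<in> S. P z} = {z \<in> S. P z}" for P
    by auto
  show ?thesis
    by (rule continuous_map_cases_le [where p = p and q = "\<lambda>_. c"])
      (use assms in \<open>auto simp: subtopology_subtopology *\<close>)
qed

abbreviation homotopic_rel ::
    "(nat \<Rightarrow> real) set \<Rightarrow> ((nat \<Rightarrow> real) \<Rightarrow> 'a) \<Rightarrow> (nat \<Rightarrow> real) set \<Rightarrow> 'a topology \<Rightarrow>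
       ((nat \<Rightarrow> real) \<Rightarrow> 'a) \<Rightarrow> ((nat \<Rightarrow> real) \<Rightarrow> 'a) \<Rightarrow> bool" where
  "homotopic_rel S c D X \<equiv> homotopic_with (\<lambda>k. \<forall>x\<in>S. k x = c x) (top_of_set D) X"

text \<open>Because \<open>S\<close> lies in \<open>D\<close>, the boundary condition only sees
  values on \<open>D\<close>. This invariance is what \<open>homotopic_with\<close> requires before
  a homotopy may be described by its values on \<open>D\<close> alone.\<close>

lemma homotopic_rel_iff:
  assumes "S \<subseteq> D"
  shows "homotopic_rel S c D X f g \<longleftrightarrow>
    (\<exists>h. continuous_map (top_of_set ({0..1::real} \<times> D)) X h \<and>
       (\<forall>x\<in>D. h (0, x) = f x) \<and> (\<forall>x\<in>D. h (1, x) = g x) \<and> (\<forall>t\<in>{0..1}. \<forall>x\<in>S. h (t, x) = c x))"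
proof -
  have "(\<And>x. x \<in> topspace (top_of_set D) \<Longrightarrow> h x = k x) \<Longrightarrow> (\<forall>x\<in>S. h x = c x) = (\<forall>x\<in>S. k x = c x)" for h k
    using assms by (metis topspace_euclidean_subtopology subsetD)
  from homotopic_with [of "top_of_set D" "\<lambda>k. \<forall>x\<in>S. k x = c x", OF this, of X f g]
  show ?thesis
    by simp
qed

lemma homotopic_rel_cong:
  assumes "S \<subseteq> D" "homotopic_rel S c D X f g"
    and "\<And>x. x \<in> D \<Longrightarrow> f x = f' x" "\<And>x. x \<in> D \<Longrightarrow> g x = g' x" "\<And>x. x \<in> S \<Longrightarrow> c x = c' x"
  shows "homotopic_rel S c' D X f' g'"
proof -
  obtain h where "continuous_map (top_of_set ({0..1::real} \<times> D)) X h"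
    "\<forall>x\<in>D. h (0, x) = f x" "\<forall>x\<in>D. h (1, x) = g x" "\<forall>t\<in>{0..1}. \<forall>x\<in>S. h (t, x) = c x"
    using assms(2) unfolding homotopic_rel_iff [OF assms(1)] by blast
  then show ?thesis
    unfolding homotopic_rel_iff [OF assms(1)] using assms(3-5) by (intro exI [of _ h]) simp
qed

lemma homotopic_rel_compose:
  assumes "homotopic_rel S c D X f g" "continuous_on D' r" "r \<in> D' \<rightarrow> D" "r \<in> S' \<rightarrow> S"
  shows "homotopic_rel S' (c \<circ> r) D' X (f \<circ> r) (g \<circ> r)"
  using assms by (intro homotopic_with_compose_continuous_map_right [OF assms(1)]) auto

section \<open>Weak homotopy equivalences and discs\<close>

definition to_cube :: "nat \<Rightarrow> (nat \<Rightarrow> real) \<Rightarrow> nat \<Rightarrow> real" where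
  "to_cube n x = (\<lambda>i. if i < n then (1 + x i) / 2 else 0)"

definition of_cube :: "nat \<Rightarrow> (nat \<Rightarrow> real) \<Rightarrow> nat \<Rightarrow> real" where
  "of_cube n y = (\<lambda>i. if i < n then 2 * y i - 1 else 0)"

lemma disc_iff: "x \<in> disc n \<longleftrightarrow> (\<forall>i<n. \<bar>x i\<bar> \<le> 1) \<and> (\<forall>i\<ge>n. x i = 0)"
  by (simp add: max_ball_def max_norm_le_iff)

lemma max_sphere_iff: "x \<in> max_sphere n \<longleftrightarrow> x \<in> disc n \<and> (\<exists>i<n. \<bar>x i\<bar> = 1)"
proof -
  have "max_norm n x = 1 \<longleftrightarrow> (\<exists>i<n. \<bar>x i\<bar> = 1)" if "x \<in> disc n"
  proof
    assume "max_norm n x = 1"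
    moreover from this have "0 < n"
      by (cases n) auto
    ultimately show "\<exists>i<n. \<bar>x i\<bar> = 1"
      using max_norm_attained [of n x] by simp
  next
    assume "\<exists>i<n. \<bar>x i\<bar> = 1"
    then have "1 \<le> max_norm n x"
      using abs_le_max_norm by metis
    with that show "max_norm n x = 1"
      by (simp add: max_ball_def)
  qed
  then show ?thesis
    by (auto simp: max_sphere_def)
qed

lemma of_cube_to_cube: "x \<in> disc n \<Longrightarrow> of_cube n (to_cube n x) = x"
  by (auto simp: disc_iff of_cube_def to_cube_def fun_eq_iff field_simps)

lemma to_cube_of_cube: "x \<in> cube n \<Longrightarrow> to_cube n (of_cube n x) = x"
  by (auto simp: cube_def of_cube_def to_cube_def fun_eq_iff)

lemma to_cube_in:
  shows "to_cube n \<in> disc n \<rightarrow> cube n" "to_cube n \<in> max_sphere n \<rightarrow> cube_boundary n"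
proof -
  show *: "to_cube n \<in> disc n \<rightarrow> cube n"
  proof
    fix x
    assume x: "x \<in> disc n"
    have "0 \<le> to_cube n x i \<and> to_cube n x i \<le> 1" if "i < n" for i
    proof -
      have "\<bar>x i\<bar> \<le> 1"
        using x that by (simp add: disc_iff)
      then show ?thesis
        using that by (simp add: to_cube_def abs_le_iff)
    qed
    then show "to_cube n x \<in> cube n"
      by (simp add: cube_def) (simp add: to_cube_def)
  qed
  show "to_cube n \<in> max_sphere n \<rightarrow> cube_boundary n"
  proof
    fix x
    assume x: "x \<in> max_sphere n"
    then obtain i where "i < n" "x i = 1 \<or> x i = -1"
      by (auto simp: max_sphere_iff abs_eq_iff' abs_if split: if_splits)
    then have "i < n \<and> (to_cube n x i = 0 \<or> to_cube n x i = 1)"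
      by (auto simp: to_cube_def)
    with * x show "to_cube n x \<in> cube_boundary n"
      by (auto simp: cube_boundary_def max_sphere_def)
  qed
qed

lemma of_cube_in:
  shows "of_cube n \<in> cube n \<rightarrow> disc n" "of_cube n \<in> cube_boundary n \<rightarrow> max_sphere n"
proof -
  show *: "of_cube n \<in> cube n \<rightarrow> disc n"
    by (auto simp: disc_iff cube_def of_cube_def abs_le_iff)
  show "of_cube n \<in> cube_boundary n \<rightarrow> max_sphere n"
  proof
    fix x
    assume x: "x \<in> cube_boundary n"
    then obtain i where "i < n" "x i = 1 \<or> x i = 0"
      by (auto simp: cube_boundary_def)
    then have "i < n \<and> \<bar>of_cube n x i\<bar> = 1"
      by (auto simp: of_cube_def)
    with * x show "of_cube n x \<in> max_sphere n"
      by (auto simp: cube_boundary_def max_sphere_iff)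
  qed
qed

lemma continuous_on_to_cube: "continuous_on S (to_cube n)"
proof (rule continuous_on_funI)
  fix i
  show "continuous_on S (\<lambda>z. to_cube n z i)"
    by (cases "i < n") (auto simp: to_cube_def intro!: continuous_on_divide continuous_on_add continuous_on_const
        continuous_on_coord [OF continuous_on_id])
qed

lemma continuous_on_of_cube: "continuous_on S (of_cube n)"
proof (rule continuous_on_funI)
  fix i
  show "continuous_on S (\<lambda>z. of_cube n z i)"
    by (cases "i < n") (auto simp: of_cube_def intro!: continuous_on_diff continuous_on_mult continuous_on_const
        continuous_on_coord [OF continuous_on_id])
qed

lemma loop_homotopic_eq:
  "loop_homotopic n X x = homotopic_rel (cube_boundary n) (\<lambda>_. x) (cube n) X"
  unfolding loop_homotopic_def
  by (simp add: euclidean_product_topology image_subset_iff)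

lemma homotopic_rel_continuous_map:
  assumes "homotopic_rel S c D X f g" "continuous_map X Y k"
  shows "homotopic_rel S (\<lambda>x. k (c x)) D Y (k \<circ> f) (k \<circ> g)"
  by (rule homotopic_with_compose_continuous_map_left [OF assms]) auto

lemma loop_homotopic_refl_iff:
  "loop_homotopic n X x g g \<longleftrightarrow> continuous_map (top_of_set (cube n)) X g \<and> (\<forall>y\<in>cube_boundary n. g y = x)"
  by (simp add: loop_homotopic_eq)

lemma loop_homotopic_classes:
  "loop_homotopic n X x g h \<Longrightarrow> loop_homotopic n X x h g"
  "\<lbrakk>loop_homotopic n X x g h; loop_homotopic n X x h k\<rbrakk> \<Longrightarrow> loop_homotopic n X x g k"
  "loop_homotopic n X x g h \<Longrightarrow> loop_homotopic n X x g g"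
  "loop_homotopic n X x g h \<Longrightarrow> loop_homotopic n X x h h"
  unfolding loop_homotopic_eq
  using homotopic_with_symD homotopic_with_trans by blast+

lemma loop_homotopic_Collect_eq:
  assumes "loop_homotopic n X x g h"
  shows "Collect (loop_homotopic n X x g) = Collect (loop_homotopic n X x h)"
  using loop_homotopic_classes(2) [OF assms] loop_homotopic_classes(2) [OF loop_homotopic_classes(1) [OF assms]]
  by auto

context
  fixes Z :: "'z topology" and X :: "'x topology" and f :: "'z \<Rightarrow> 'x"
  assumes weq: "weak_homotopy_equivalence Z X f"
begin

lemma weq_continuous: "continuous_map Z X f"
  using weq by (simp add: weak_homotopy_equivalence_def)

lemma weq_path_surj:
  assumes "x \<in> topspace X"
  shows "\<exists>z\<in>topspace Z. path_component_of X x (f z)"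
proof -
  have "Collect (path_component_of X x) \<in> path_components_of X"
    using assms by (simp add: path_components_of_def)
  then obtain C where C: "C \<in> path_components_of Z" "path_components_map X f C = Collect (path_component_of X x)"
    using weq by (metis weak_homotopy_equivalence_def bij_betw_imp_surj_on imageE)
  have "x \<in> path_components_map X f C"
    unfolding C by (simp add: assms path_component_of_refl)
  then obtain z where "z \<in> C" "path_component_of X (f z) x"
    by (auto simp: path_components_map_def)
  moreover have "C \<subseteq> topspace Z"
    using C path_components_of_subset by blast
  ultimately show ?thesis
    using path_component_of_sym by fastforce
qed

lemma weq_path_inj:
  assumes z: "z \<in> topspace Z" "z' \<in> topspace Z" and p: "path_component_of X (f z) (f z')"
  shows "path_component_of Z z z'"
proof -
  have map: "path_components_map X f (Collect (path_component_of Z z)) = Collect (path_component_of X (f z))"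
    if "z \<in> topspace Z" for z
  proof -
    have "path_component_of X (f z) (f y)" if "path_component_of Z z y" for y
      using that weq_continuous unfolding path_component_of_def
      by (metis comp_apply pathin_compose)
    moreover have "z \<in> Collect (path_component_of Z z)"
      using that by (simp add: path_component_of_refl)
    ultimately show ?thesis
      unfolding path_components_map_def
      by (blast intro: path_component_of_trans path_component_of_sym)
  qed
  have "Collect (path_component_of X (f z)) = Collect (path_component_of X (f z'))"
    using p by (simp add: path_component_of_equiv)
  then have "path_components_map X f (Collect (path_component_of Z z)) =
      path_components_map X f (Collect (path_component_of Z z'))"
    using z by (simp add: map)
  moreover have "Collect (path_component_of Z z) \<in> path_components_of Z"
    "Collect (path_component_of Z z') \<in> path_components_of Z"
    using z by (auto simp: path_components_of_def)
  ultimately have "Collect (path_component_of Z z) = Collect (path_component_of Z z')"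
    using weq by (metis weak_homotopy_equivalence_def bij_betw_imp_inj_on inj_onD)
  then show ?thesis
    using z by (metis mem_Collect_eq path_component_of_refl)
qed

text \<open>Surjectivity on homotopy classes at the base point \<open>f z\<close>, transported from
  cubes to discs by the affine identification.\<close>

lemma weq_disc_surj:
  assumes n: "0 < n" and z: "z \<in> topspace Z" and \<gamma>: "continuous_map (top_of_set (disc n)) X \<gamma>"
    and \<gamma>s: "\<And>x. x \<in> max_sphere n \<Longrightarrow> \<gamma> x = f z"
  obtains \<delta> where "continuous_map (top_of_set (disc n)) Z \<delta>" "\<And>x. x \<in> max_sphere n \<Longrightarrow> \<delta> x = z"
    "homotopic_rel (max_sphere n) (\<lambda>_. f z) (disc n) X (f \<circ> \<delta>) \<gamma>"
proof -
  let ?g = "\<gamma> \<circ> of_cube n"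
  have bij: "bij_betw (homotopy_classes_map n X f z) (homotopy_classes n Z z) (homotopy_classes n X (f z))"
    using weq n z by (auto simp: weak_homotopy_equivalence_def)
  have g: "loop_homotopic n X (f z) ?g ?g"
    unfolding loop_homotopic_refl_iff o_def
    using \<gamma>s of_cube_in [of n] continuous_map_top_of_set_compose [OF \<gamma> continuous_on_of_cube of_cube_in(1)]
    by auto
  then have "Collect (loop_homotopic n X (f z) ?g) \<in> homotopy_classes n X (f z)"
    unfolding homotopy_classes_def by blast
  then have "Collect (loop_homotopic n X (f z) ?g) \<in> homotopy_classes_map n X f z ` homotopy_classes n Z z"
    unfolding bij_betw_imp_surj_on [OF bij] .
  then obtain h where "Collect (loop_homotopic n X (f z) ?g) =
      homotopy_classes_map n X f z (Collect (loop_homotopic n Z z h))"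
    unfolding homotopy_classes_def by blast
  \<comment> \<open>The induced map on classes is a union over representatives, so membership of
    \<open>?g\<close> itself exhibits a representative whose image under \<open>f\<close> is
    homotopic to \<open>?g\<close>.\<close>
  with g have "?g \<in> homotopy_classes_map n X f z (Collect (loop_homotopic n Z z h))"
    by blast
  then obtain \<delta> where \<delta>: "loop_homotopic n Z z h \<delta>" and hom: "loop_homotopic n X (f z) (f \<circ> \<delta>) ?g"
    by (auto simp: homotopy_classes_map_def)
  then have \<delta>c: "continuous_map (top_of_set (cube n)) Z \<delta>" "\<And>y. y \<in> cube_boundary n \<Longrightarrow> \<delta> y = z"
    using loop_homotopic_classes(4) [OF \<delta>] by (auto simp: loop_homotopic_refl_iff)
  show thesis
  proof
    show "continuous_map (top_of_set (disc n)) Z (\<lambda>x. \<delta> (to_cube n x))"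
      by (rule continuous_map_top_of_set_compose [OF \<delta>c(1) continuous_on_to_cube to_cube_in(1)])
    show "\<delta> (to_cube n x) = z" if "x \<in> max_sphere n" for x
      using \<delta>c(2) to_cube_in(2) [of n] that by auto
    have "homotopic_rel (max_sphere n) ((\<lambda>_. f z) \<circ> to_cube n) (disc n) X ((f \<circ> \<delta>) \<circ> to_cube n) (?g \<circ> to_cube n)"
      using hom unfolding loop_homotopic_eq
      by (rule homotopic_rel_compose) (rule continuous_on_to_cube to_cube_in)+
    then show "homotopic_rel (max_sphere n) (\<lambda>_. f z) (disc n) X (f \<circ> (\<lambda>x. \<delta> (to_cube n x))) \<gamma>"
      by (rule homotopic_rel_cong [OF max_sphere_subset_disc]) (simp_all add: of_cube_to_cube)
  qed
qed

text \<open>Injectivity on homotopy classes, applied to the class of \<open>g\<close> and that of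
  the constant map.\<close>

lemma weq_disc_inj:
  assumes n: "0 < n" and z: "z \<in> topspace Z" and g: "continuous_map (top_of_set (disc n)) Z g"
    and gs: "\<And>x. x \<in> max_sphere n \<Longrightarrow> g x = z"
    and hom: "homotopic_rel (max_sphere n) (\<lambda>_. f z) (disc n) X (f \<circ> g) (\<lambda>_. f z)"
  shows "homotopic_rel (max_sphere n) (\<lambda>_. z) (disc n) Z g (\<lambda>_. z)"
proof -
  let ?g = "g \<circ> of_cube n" and ?c = "\<lambda>_ :: nat \<Rightarrow> real. z"
  have bij: "bij_betw (homotopy_classes_map n X f z) (homotopy_classes n Z z) (homotopy_classes n X (f z))"
    using weq n z by (auto simp: weak_homotopy_equivalence_def)
  have lg: "loop_homotopic n Z z ?g ?g"
    unfolding loop_homotopic_refl_iff o_def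
    using gs of_cube_in [of n] continuous_map_top_of_set_compose [OF g continuous_on_of_cube of_cube_in(1)]
    by auto
  have lc: "loop_homotopic n Z z ?c ?c"
    unfolding loop_homotopic_refl_iff using z by simp
  have "homotopic_rel (cube_boundary n) ((\<lambda>_. f z) \<circ> of_cube n) (cube n) X ((f \<circ> g) \<circ> of_cube n) ((\<lambda>_. f z) \<circ> of_cube n)"
    using hom by (rule homotopic_rel_compose) (rule continuous_on_of_cube of_cube_in)+
  then have fgc: "loop_homotopic n X (f z) (f \<circ> ?g) (f \<circ> ?c)"
    by (simp add: loop_homotopic_eq o_def)
  \<comment> \<open>The union over representatives is constant: composing a homotopy with
    \<open>f\<close> shows that homotopic representatives contribute the same class.\<close>
  have map: "homotopy_classes_map n X f z (Collect (loop_homotopic n Z z k)) = Collect (loop_homotopic n X (f z) (f \<circ> k))"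
    if k: "loop_homotopic n Z z k k" for k
  proof -
    have *: "loop_homotopic n X (f z) (f \<circ> k) (f \<circ> k')" if "loop_homotopic n Z z k k'" for k'
      using homotopic_rel_continuous_map [OF that [unfolded loop_homotopic_eq] weq_continuous]
      unfolding loop_homotopic_eq .
    have "homotopy_classes_map n X f z (Collect (loop_homotopic n Z z k)) =
        (\<Union>k'\<in>Collect (loop_homotopic n Z z k). Collect (loop_homotopic n X (f z) (f \<circ> k)))"
      unfolding homotopy_classes_map_def
      by (rule SUP_cong [OF refl]) (simp only: mem_Collect_eq loop_homotopic_Collect_eq [OF *])
    also have "\<dots> = Collect (loop_homotopic n X (f z) (f \<circ> k))"
      using k by (intro UN_constant [THEN trans]) auto
    finally show ?thesis .
  qed
  have "homotopy_classes_map n X f z (Collect (loop_homotopic n Z z ?g)) =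
      homotopy_classes_map n X f z (Collect (loop_homotopic n Z z ?c))"
    unfolding map [OF lg] map [OF lc] by (rule loop_homotopic_Collect_eq [OF fgc])
  then have "Collect (loop_homotopic n Z z ?g) = Collect (loop_homotopic n Z z ?c)"
    using lg lc by (intro inj_onD [OF bij_betw_imp_inj_on [OF bij]]) (auto simp: homotopy_classes_def)
  then have "loop_homotopic n Z z ?g ?c"
    using lc by blast
  then have "homotopic_rel (max_sphere n) (?c \<circ> to_cube n) (disc n) Z (?g \<circ> to_cube n) (?c \<circ> to_cube n)"
    unfolding loop_homotopic_eq
    by (rule homotopic_rel_compose) (rule continuous_on_to_cube to_cube_in)+
  then show ?thesis
    by (rule homotopic_rel_cong [OF max_sphere_subset_disc]) (simp_all add: of_cube_to_cube)
qed

end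

section \<open>Extending maps from spheres\<close>

lemmas continuous_on_rules =
  continuous_on_Pair continuous_on_scl continuous_on_max_norm continuous_on_fst continuous_on_snd
  continuous_on_const continuous_on_id continuous_on_add continuous_on_diff continuous_on_mult
  continuous_on_divide continuous_on_min continuous_on_max

text \<open>
  \<open>wrap m\<close> wraps the \<open>m\<close>-disc around the \<open>m\<close>-sphere: the centre of the disc goes to the centre of
  the top face, and the whole boundary of the disc to the centre of the bottom face.
\<close>

definition wrap_scale :: "real \<Rightarrow> real" where
  "wrap_scale r = min 1 (3 - 3 * r) / max r (1 / 3)"

definition wrap_height :: "real \<Rightarrow> real" where
  "wrap_height r = max (-1) (min 1 (3 - 6 * r))"

definition wrap :: "nat \<Rightarrow> (nat \<Rightarrow> real) \<Rightarrow> nat \<Rightarrow> real" where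
  "wrap m x = (\<lambda>i. if i < m then wrap_scale (max_norm m x) * x i
                   else if i = m then wrap_height (max_norm m x) else 0)"

text \<open>A ray from the centre of the disc first crosses the top face outwards, with scaled
  radius \<open>3 * r\<close>, then descends along the side at scaled radius 1 while the height
  falls from 1 to -1, and finally crosses the bottom face inwards, with scaled radius
  \<open>3 - 3 * r\<close>.\<close>

lemma wrap_cases:
  assumes "0 \<le> r" "r \<le> 1"
  obtains "r \<le> 1 / 3" "wrap_scale r = 3" "r * wrap_scale r = 3 * r" "wrap_height r = 1"
  | "1 / 3 \<le> r" "r \<le> 2 / 3" "wrap_scale r = 1 / r" "r * wrap_scale r = 1" "wrap_height r = 3 - 6 * r"
  | "2 / 3 \<le> r" "wrap_scale r = (3 - 3 * r) / r" "r * wrap_scale r = 3 - 3 * r" "wrap_height r = -1"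
proof -
  consider "r \<le> 1 / 3" | "1 / 3 \<le> r" "r \<le> 2 / 3" | "2 / 3 \<le> r"
    by linarith
  then show thesis
  proof cases
    case 1
    then have "wrap_scale r = 3" "wrap_height r = 1"
      by (simp_all add: wrap_scale_def wrap_height_def)
    with 1 that(1) show thesis
      by simp
  next
    case 2
    then have "wrap_scale r = 1 / r" "wrap_height r = 3 - 6 * r" "r \<noteq> 0"
      by (auto simp: wrap_scale_def wrap_height_def)
    with 2 that(2) show thesis
      by simp
  next
    case 3
    then have "wrap_scale r = (3 - 3 * r) / r" "wrap_height r = -1" "r \<noteq> 0"
      by (auto simp: wrap_scale_def wrap_height_def)
    with 3 that(3) show thesis
      by simp
  qed
qed

lemma wrap_scale_nonneg: "r \<le> 1 \<Longrightarrow> 0 \<le> wrap_scale r"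
  by (simp add: wrap_scale_def)

lemma max_norm_wrap:
  assumes "x \<in> disc m"
  shows "max_norm m (wrap m x) = max_norm m x * wrap_scale (max_norm m x)"
proof -
  have "max_norm m (wrap m x) = max_norm m (scl (wrap_scale (max_norm m x)) x)"
    by (rule max_norm_cong) (simp add: wrap_def scl_def)
  then show ?thesis
    using assms wrap_scale_nonneg [of "max_norm m x"] by (simp add: max_ball_def mult.commute)
qed

lemma wrap_in_max_sphere: "wrap m \<in> disc m \<rightarrow> max_sphere (Suc m)"
proof
  fix x
  assume x: "x \<in> disc m"
  then have "0 \<le> max_norm m x" "max_norm m x \<le> 1"
    by (auto simp: max_ball_def)
  then have "max_norm (Suc m) (wrap m x) = 1"
    using max_norm_wrap [OF x] by (cases rule: wrap_cases) (auto simp: wrap_def max_def)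
  then show "wrap m x \<in> max_sphere (Suc m)"
    by (auto simp: max_sphere_def max_ball_def wrap_def)
qed

lemma continuous_on_wrap: "continuous_on S (wrap m)"
proof (rule continuous_on_funI)
  fix i
  have "continuous_on S (\<lambda>x. wrap_scale (max_norm m x))"
    unfolding wrap_scale_def
    by (intro continuous_on_rules) (auto simp: max_def)
  then have "continuous_on S (\<lambda>x. wrap_scale (max_norm m x) * x i)"
    by (rule continuous_on_mult) (rule continuous_on_coord [OF continuous_on_id])
  moreover have "continuous_on S (\<lambda>x. wrap_height (max_norm m x))"
    unfolding wrap_height_def by (intro continuous_on_rules)
  ultimately show "continuous_on S (\<lambda>x. wrap m x i)"
    by (cases "i < m"; cases "i = m") (simp_all add: wrap_def)
qed

text \<open>In dimension \<open>m = 0\<close> the disc is a point and reaches only the value 1 of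
  the two points of the sphere, hence \<open>0 < m\<close>.\<close>

lemma wrap_surj:
  assumes y: "y \<in> max_sphere (Suc m)" and m: "0 < m"
  shows "\<exists>x\<in>disc m. wrap m x = y"
proof -
  let ?\<rho> = "max_norm m y" and ?s = "y m"
  define y' where "y' = (\<lambda>i. if i < m then y i else 0)"
  have norm: "max ?\<rho> \<bar>?s\<bar> = 1" and y0: "\<And>i. i > m \<Longrightarrow> y i = 0"
    using y by (auto simp: max_sphere_def max_ball_def)
  then have y': "y' \<in> disc m" "max_norm m y' = ?\<rho>"
    using max_norm_cong [of m y' y] by (auto simp: max_ball_def y'_def)
  show ?thesis
  proof (cases "?\<rho> = 0")
    case True
    then have yi: "y i = 0" if "i < m" for i
      using abs_le_max_norm [OF that, of y] by simp
    from True norm have "?s = 1 \<or> ?s = -1"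
      by (auto simp: max_def split: if_splits)
    then show ?thesis
    proof
      assume s: "?s = 1"
      have "wrap m (\<lambda>_. 0) i = y i" for i
        using yi y0 s by (cases "i < m"; cases "i = m") (auto simp: wrap_def wrap_height_def)
      then show ?thesis
        by (intro bexI [of _ "\<lambda>_. 0"]) auto
    next
      assume s: "?s = -1"
      \<comment> \<open>Every boundary point of the disc is sent to the centre of the bottom face;
        the first unit vector is one, as \<open>m\<close> is positive.\<close>
      let ?x = "\<lambda>i::nat. if i = 0 then 1 else 0 :: real"
      have "max_norm m ?x \<le> 1"
        by (simp add: max_norm_le_iff)
      moreover have "\<bar>?x 0\<bar> \<le> max_norm m ?x"
        by (rule abs_le_max_norm [OF m])
      ultimately have "max_norm m ?x = 1"
        by simp
      moreover from this have "wrap m ?x i = y i" for i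
        using yi y0 s by (cases "i < m"; cases "i = m") (auto simp: wrap_def wrap_height_def wrap_scale_def)
      ultimately show ?thesis
        using m by (intro bexI [of _ ?x]) (auto simp: max_ball_def)
    qed
  next
    case False
    \<comment> \<open>It suffices to find a radius with the right scaled radius and height; the
      direction of the preimage is that of \<open>y'\<close>.\<close>
    have *: ?thesis if r: "0 < r" "r \<le> 1" "r * wrap_scale r = ?\<rho>" "wrap_height r = ?s" for r
    proof -
      let ?x = "scl (r / ?\<rho>) y'"
      have n: "max_norm m ?x = r"
        using False r y' by simp
      have "wrap_scale r * (r / ?\<rho> * y i) = y i" for i
      proof -
        have "wrap_scale r * (r / ?\<rho> * y i) = (r * wrap_scale r) / ?\<rho> * y i"
          by simp
        then show ?thesis
          using False by (simp add: r)
      qed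
      then have "wrap m ?x i = y i" for i
        unfolding wrap_def n using y0 r by (auto simp: scl_def y'_def not_less_iff_gr_or_eq)
      moreover have "?x \<in> disc m"
        using n r y' False by (intro scl_in_max_ball) auto
      ultimately show ?thesis
        by blast
    qed
    have \<rho>: "0 < ?\<rho>" "?\<rho> \<le> 1" "\<bar>?s\<bar> \<le> 1"
      using False norm max_norm_nonneg [of m y] by linarith+
    \<comment> \<open>Top face, bottom face and side, where the radius solves
      \<open>?\<rho> = 3 * r\<close>, \<open>?\<rho> = 3 - 3 * r\<close> and
      \<open>?s = 3 - 6 * r\<close> respectively.\<close>
    consider "?s = 1" | "?s = -1" | "?\<rho> = 1" "\<bar>?s\<bar> < 1"
      using norm by (auto simp: max_def abs_if split: if_splits)
    then show ?thesis
    proof cases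
      case 1
      show ?thesis
        by (rule * [of "?\<rho> / 3"]) (use 1 \<rho> in \<open>auto simp: wrap_scale_def wrap_height_def\<close>)
    next
      case 2
      show ?thesis
        by (rule * [of "1 - ?\<rho> / 3"]) (use 2 \<rho> in \<open>auto simp: wrap_scale_def wrap_height_def\<close>)
    next
      case 3
      show ?thesis
        by (rule * [of "(3 - ?s) / 6"]) (use 3 \<rho> in \<open>auto simp: wrap_scale_def wrap_height_def abs_less_iff field_simps\<close>)
    qed
  qed
qed

text \<open>Height and scaled radius together determine the radius. For radius below 1 the scaling
  factor is nonzero, so the point can be recovered; only the boundary sphere is collapsed.\<close>

lemma wrap_inj:
  assumes x: "x \<in> disc m" "x' \<in> disc m" and eq: "wrap m x = wrap m x'"
  shows "x = x' \<or> x \<in> max_sphere m \<and> x' \<in> max_sphere m"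
proof -
  let ?r = "max_norm m x" and ?r' = "max_norm m x'"
  have r: "0 \<le> ?r" "?r \<le> 1" "0 \<le> ?r'" "?r' \<le> 1"
    using x by (auto simp: max_ball_def)
  have "?r * wrap_scale ?r = ?r' * wrap_scale ?r'"
    by (simp only: max_norm_wrap [OF x(1), symmetric] max_norm_wrap [OF x(2), symmetric] eq)
  moreover have "wrap_height ?r = wrap_height ?r'"
    using fun_cong [OF eq, of m] by (simp add: wrap_def)
  ultimately have e: "?r * wrap_scale ?r = ?r' * wrap_scale ?r'" "wrap_height ?r = wrap_height ?r'" .
  have rr: "?r = ?r'"
    using r(1,2)
  proof (cases rule: wrap_cases)
    case 1
    show ?thesis
      using r(3,4) by (cases rule: wrap_cases) (use 1 e in auto)
  next
    case 2
    show ?thesis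
      using r(3,4) by (cases rule: wrap_cases) (use 2 e in auto)
  next
    case 3
    show ?thesis
      using r(3,4) by (cases rule: wrap_cases) (use 3 e in auto)
  qed
  show ?thesis
  proof (cases "?r = 1")
    case True
    with rr x show ?thesis
      by (auto simp: max_sphere_def)
  next
    case False
    with r have "wrap_scale ?r \<noteq> 0"
      by (auto simp: wrap_scale_def max_def)
    moreover have "wrap_scale ?r * x i = wrap_scale ?r * x' i" if "i < m" for i
      using fun_cong [OF eq, of i] that rr by (simp add: wrap_def)
    ultimately have "x i = x' i" for i
      using x by (cases "i < m") (auto simp: max_ball_def)
    then show ?thesis
      by auto
  qed
qed

lemma wrap_base:
  "x \<in> max_sphere m \<Longrightarrow> wrap m x = (\<lambda>i. if i = m then -1 else 0)"
  by (auto simp: wrap_def max_sphere_def wrap_scale_def wrap_height_def fun_eq_iff)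

lemma max_ball_convex:
  assumes "x \<in> max_ball n r" "y \<in> max_ball n r" "0 \<le> t" "t \<le> 1"
  shows "(\<lambda>i. (1 - t) * x i + t * y i) \<in> max_ball n r"
proof -
  have r: "0 \<le> r"
    using assms(1) max_norm_nonneg [of n x] by (simp add: max_ball_def del: max_norm_nonneg)
  have "\<bar>(1 - t) * x i + t * y i\<bar> \<le> r" if "i < n" for i
  proof -
    have "\<bar>x i\<bar> \<le> r" "\<bar>y i\<bar> \<le> r"
      using assms(1,2) that r by (auto simp: max_ball_def max_norm_le_iff)
    have "\<bar>(1 - t) * x i + t * y i\<bar> \<le> (1 - t) * \<bar>x i\<bar> + t * \<bar>y i\<bar>"
      using abs_triangle_ineq [of "(1 - t) * x i" "t * y i"] assms by (simp add: abs_mult)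
    also have "\<dots> \<le> (1 - t) * r + t * r"
      using assms \<open>\<bar>x i\<bar> \<le> r\<close> \<open>\<bar>y i\<bar> \<le> r\<close> by (intro add_mono mult_left_mono) auto
    finally show ?thesis
      by (simp add: algebra_simps)
  qed
  then show ?thesis
    using assms r by (auto simp: max_ball_def max_norm_le_iff)
qed

text \<open>For \<open>m > 0\<close>, wrapping turns \<open>v\<close> into a map of the
  \<open>m\<close>-disc that is constant on the boundary. The given extension makes its image in
  \<open>X\<close> null-homotopic relative to the boundary, so injectivity gives a null-homotopy in
  \<open>Z\<close>. The larger disc is the cone over the sphere, and the null-homotopy descends to
  it.\<close>

lemma extend_from_max_sphere:
  fixes Z :: "'z topology" and X :: "'x topology"
  assumes weq: "weak_homotopy_equivalence Z X f"
    and v: "continuous_map (top_of_set (max_sphere (Suc m))) Z v"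
    and u: "continuous_map (top_of_set (disc (Suc m))) X u"
    and uv: "\<And>x. x \<in> max_sphere (Suc m) \<Longrightarrow> u x = f (v x)"
  obtains w where "continuous_map (top_of_set (disc (Suc m))) Z w" "\<And>x. x \<in> max_sphere (Suc m) \<Longrightarrow> w x = v x"
proof (cases "m = 0")
  case True
  \<comment> \<open>For \<open>m = 0\<close> the disc is a segment with end points
    \<open>c 1\<close> and \<open>c (-1)\<close>, and the claim is injectivity on path
    components.\<close>
  define c where "c = (\<lambda>s::real. (\<lambda>i::nat. if i = 0 then s else 0 :: real))"
  have cont_c: "continuous_on S (\<lambda>z. c (g z))" if "continuous_on S g" for S :: "'t::topological_space set" and g
  proof (rule continuous_on_funI)
    fix i
    show "continuous_on S (\<lambda>z. c (g z) i)"
      using that by (cases "i = 0") (simp_all add: c_def)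
  qed
  have s01: "max_sphere (Suc m) = {c 1, c (-1)}"
    by (auto simp: True max_sphere_iff disc_iff c_def fun_eq_iff abs_if split: if_splits)
  have d: "c s \<in> disc (Suc m)" if "s \<in> {-1..1}" for s
    using that by (auto simp: True disc_iff c_def)
  have zs: "v (c 1) \<in> topspace Z" "v (c (-1)) \<in> topspace Z"
    using v s01 by (auto simp: continuous_map_def)
  have "continuous_map (top_of_set {0..1}) X (\<lambda>t. u (c (2 * t - 1)))"
    using d by (intro continuous_map_top_of_set_compose [OF u] cont_c continuous_on_rules) auto
  then have "path_component_of X (f (v (c (-1)))) (f (v (c 1)))"
    unfolding path_component_of_def pathin_def using uv s01 by (intro exI [of _ "\<lambda>t. u (c (2 * t - 1))"]) auto
  then have "path_component_of Z (v (c (-1))) (v (c 1))"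
    by (rule weq_path_inj [OF weq zs(2,1)])
  then obtain g where g: "continuous_map (top_of_set {0..1::real}) Z g" "g 0 = v (c (-1))" "g 1 = v (c 1)"
    by (auto simp: path_component_of_def pathin_def)
  show thesis
  proof
    show "continuous_map (top_of_set (disc (Suc m))) Z (\<lambda>x. g ((1 + x 0) / 2))"
    proof (rule continuous_map_top_of_set_compose [OF g(1)])
      show "continuous_on (disc (Suc m)) (\<lambda>x. (1 + x 0) / 2)"
        by (intro continuous_on_divide continuous_on_add continuous_on_const continuous_on_coord [OF continuous_on_id]) simp
      show "(\<lambda>x. (1 + x 0) / 2) \<in> disc (Suc m) \<rightarrow> {0..1}"
        by (auto simp: True disc_iff abs_le_iff)
    qed
    show "g ((1 + x 0) / 2) = v x" if "x \<in> max_sphere (Suc m)" for x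
      using that g unfolding s01 by (auto simp: c_def)
  qed
next
  case False
  then have m: "0 < m"
    by simp
  let ?D = "disc m" and ?b = "\<lambda>i. if i = m then -1 else 0 :: real"
  have b: "?b \<in> max_sphere (Suc m)"
    by (auto simp: max_sphere_iff disc_iff)
  then have z: "v ?b \<in> topspace Z"
    using v by (auto simp: continuous_map_def)
  have sd: "max_sphere (Suc m) \<subseteq> disc (Suc m)"
    by (rule max_sphere_subset_disc)
  have vw: "continuous_map (top_of_set ?D) Z (\<lambda>x. v (wrap m x))"
    by (rule continuous_map_top_of_set_compose [OF v continuous_on_wrap wrap_in_max_sphere])
  \<comment> \<open>The disc is contracted along straight lines to the centre \<open>?b\<close> of
    the bottom face. The contraction fixes \<open>?b\<close>, the image of the whole boundary under
    \<open>wrap m\<close>, so the homotopy is relative.\<close>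
  have "homotopic_rel (max_sphere m) (\<lambda>_. f (v ?b)) ?D X (f \<circ> (\<lambda>x. v (wrap m x))) (\<lambda>_. f (v ?b))"
    unfolding homotopic_rel_iff [OF max_sphere_subset_disc]
  proof (intro exI conjI ballI)
    let ?h = "\<lambda>z. u (\<lambda>i. (1 - fst z) * wrap m (snd z) i + fst z * ?b i)"
    show "continuous_map (top_of_set ({0..1::real} \<times> ?D)) X ?h"
    proof (rule continuous_map_top_of_set_compose [OF u])
      show "continuous_on ({0..1} \<times> ?D) (\<lambda>z i. (1 - fst z) * wrap m (snd z) i + fst z * ?b i)"
      proof (rule continuous_on_funI)
        fix i
        have "continuous_on ({0..1} \<times> ?D) (\<lambda>z. wrap m (snd z))"
          by (rule continuous_on_compose2 [OF continuous_on_wrap [of UNIV]])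
            (intro continuous_on_rules subset_UNIV)+
        from continuous_on_coord [OF this, of i]
        show "continuous_on ({0..1} \<times> ?D) (\<lambda>z. (1 - fst z) * wrap m (snd z) i + fst z * ?b i)"
          by (intro continuous_on_rules)
      qed
      show "(\<lambda>z i. (1 - fst z) * wrap m (snd z) i + fst z * ?b i) \<in> {0..1} \<times> ?D \<rightarrow> disc (Suc m)"
        using b sd wrap_in_max_sphere [of m] by (auto intro!: max_ball_convex)
    qed
    show "?h (0, x) = (f \<circ> (\<lambda>x. v (wrap m x))) x" if "x \<in> ?D" for x
      using that uv wrap_in_max_sphere [of m] by auto
    show "?h (1, x) = f (v ?b)" for x
      using uv [OF b] by simp
    show "?h (t, x) = f (v ?b)" if "x \<in> max_sphere m" for t x
      using uv [OF b] by (simp add: wrap_base [OF that] algebra_simps)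
  qed
  then have "homotopic_rel (max_sphere m) (\<lambda>_. v ?b) ?D Z (\<lambda>x. v (wrap m x)) (\<lambda>_. v ?b)"
    by (intro weq_disc_inj [OF weq m z vw]) (simp_all add: wrap_base)
  then obtain h where h: "continuous_map (top_of_set ({0..1::real} \<times> ?D)) Z h"
    and h0: "\<And>x. x \<in> ?D \<Longrightarrow> h (0, x) = v (wrap m x)" and h1: "\<And>x. x \<in> ?D \<Longrightarrow> h (1, x) = v ?b"
    and hs: "\<And>t x. \<lbrakk>t \<in> {0..1}; x \<in> max_sphere m\<rbrakk> \<Longrightarrow> h (t, x) = v ?b"
    unfolding homotopic_rel_iff [OF max_sphere_subset_disc] by blast
  \<comment> \<open>Cone coordinates: time \<open>t\<close> corresponds to norm
    \<open>1 - t\<close>, and time 1 is the cone point. A continuous surjection from a compact space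
    onto a Hausdorff space is a quotient map.\<close>
  define q where "q = (\<lambda>z :: real \<times> (nat \<Rightarrow> real). scl (1 - fst z) (wrap m (snd z)))"
  have wn: "max_norm (Suc m) (wrap m x) = 1" "wrap m x \<in> disc (Suc m)" if "x \<in> ?D" for x
    using that wrap_in_max_sphere [of m] by (auto simp: max_sphere_def)
  have q: "quotient_map (top_of_set ({0..1} \<times> ?D)) (top_of_set (disc (Suc m))) q"
  proof (rule T1_Spaces.continuous_imp_quotient_map)
    have "continuous_on ({0..1} \<times> ?D) q"
      unfolding q_def
      by (rule continuous_on_scl; (rule continuous_on_compose2 [OF continuous_on_wrap [of UNIV]])?;
          intro continuous_on_rules subset_UNIV)
    moreover have "q \<in> {0..1} \<times> ?D \<rightarrow> disc (Suc m)"
      using wn by (auto simp: q_def intro!: scl_in_max_ball)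
    ultimately show "continuous_map (top_of_set ({0..1} \<times> ?D)) (top_of_set (disc (Suc m))) q"
      by simp
    show "compact_space (top_of_set ({0..1::real} \<times> ?D))"
      by (rule compact_space_subtopology) (simp add: compact_Times compact_max_ball)
    show "Hausdorff_space (top_of_set (disc (Suc m)))"
      by (simp add: Hausdorff_space_subtopology)
    have "y \<in> q ` ({0..1} \<times> ?D)" if y: "y \<in> disc (Suc m)" for y
    proof (cases "max_norm (Suc m) y = 0")
      case True
      then have "q (1, \<lambda>_. 0) = y"
        using max_ball_max_norm_0 [OF y] by (simp add: q_def)
      then show ?thesis
        by (intro image_eqI [of _ _ "(1, \<lambda>_. 0)"]) auto
    next
      case False
      let ?N = "max_norm (Suc m) y"
      have N: "0 < ?N" "?N \<le> 1"
        using False y max_norm_nonneg [of "Suc m" y] by (auto simp: max_ball_def simp del: max_norm.simps max_norm_nonneg)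
      have "scl (1 / ?N) y \<in> max_sphere (Suc m)"
        using N y scl_in_max_ball [OF y, of "1 / ?N" 1] by (auto simp: max_sphere_def simp del: max_norm.simps)
      then obtain x where "x \<in> ?D" "wrap m x = scl (1 / ?N) y"
        using wrap_surj [OF _ m] by blast
      with N have "q (1 - ?N, x) = y"
        by (simp add: q_def del: max_norm.simps)
      with \<open>x \<in> ?D\<close> N show ?thesis
        by (intro image_eqI [of _ _ "(1 - ?N, x)"]) (auto simp del: max_norm.simps)
    qed
    then show "q ` topspace (top_of_set ({0..1} \<times> ?D)) = topspace (top_of_set (disc (Suc m)))"
      using \<open>q \<in> {0..1} \<times> ?D \<rightarrow> disc (Suc m)\<close> by auto
  qed
  \<comment> \<open>The norm recovers the time. What \<open>q\<close> identifies is the whole slice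
    at time 1 and, at each earlier time, the boundary sphere; on each of these sets \<open>h\<close>
    takes only the value \<open>v ?b\<close>.\<close>
  have fib: "h z = h z'" if z: "z \<in> {0..1} \<times> ?D" "z' \<in> {0..1} \<times> ?D" and eq: "q z = q z'" for z z'
  proof -
    obtain t x t' x' where zz: "z = (t, x)" "z' = (t', x')"
      by (cases z, cases z')
    with z have tx: "t \<in> {0..1}" "x \<in> ?D" "t' \<in> {0..1}" "x' \<in> ?D"
      by auto
    have "max_norm (Suc m) (q z) = 1 - t" "max_norm (Suc m) (q z') = 1 - t'"
      using tx wn by (auto simp: zz q_def simp del: max_norm.simps)
    with eq have t: "t = t'"
      by simp
    show ?thesis
    proof (cases "t = 1")
      case True
      with t tx h1 show ?thesis
        by (simp add: zz)
    next
      case False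
      with eq t have "wrap m x = wrap m x'"
        by (auto simp: zz q_def scl_def fun_eq_iff)
      then show ?thesis
        using wrap_inj [OF tx(2,4)] t tx hs by (auto simp: zz)
    qed
  qed
  have fib': "h z = h z'" if "z \<in> topspace (top_of_set ({0..1} \<times> ?D))" "z' \<in> topspace (top_of_set ({0..1} \<times> ?D))"
    "q z = q z'" for z z'
    by (rule fib) (use that in simp_all)
  obtain w where w: "continuous_map (top_of_set (disc (Suc m))) Z w"
    and "w ` topspace (top_of_set (disc (Suc m))) = h ` topspace (top_of_set ({0..1} \<times> ?D))"
    and wq: "\<And>z. z \<in> topspace (top_of_set ({0..1} \<times> ?D)) \<Longrightarrow> w (q z) = h z"
    by (rule quotient_map_lift_exists [OF q h], erule (2) fib', rule that, assumption+)
  show thesis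
  proof
    show "w x = v x" if x: "x \<in> max_sphere (Suc m)" for x
    proof -
      obtain y where y: "y \<in> ?D" "wrap m y = x"
        using wrap_surj [OF x m] by blast
      then show ?thesis
        using wq [of "(0, y)"] h0 [of y] by (simp add: q_def)
    qed
  qed (fact w)
qed

section \<open>Homotopy extension and lifting\<close>

text \<open>The radial stretching of the annulus between norms 1/2 and 1 onto the whole disc. The
  maximum in the denominator changes nothing on the annulus and keeps the quotient continuous near
  the centre.\<close>

lemma collar_scale: "1 / 2 \<le> r \<Longrightarrow> \<bar>(2 * r - 1) / max r (1 / 2)\<bar> * r = 2 * r - 1" for r :: real
  by (simp add: max_absorb1 abs_divide)

text \<open>The centre of the disc carrying \<open>h\<close> is blown up to a disc of radius 1/2 on
  which a copy of \<open>g\<close> is placed. This is how an element of a homotopy group modifies a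
  map of the disc without changing it on the boundary.\<close>

lemma disc_inner_outer_continuous_map:
  assumes g: "continuous_map (top_of_set (disc n)) Y g" and h: "continuous_map (top_of_set (disc n)) Y h"
    and gh: "\<And>x. x \<in> max_sphere n \<Longrightarrow> g x = h (\<lambda>_. 0)"
  shows "continuous_map (top_of_set (disc n)) Y
     (\<lambda>x. if max_norm n x \<le> 1 / 2 then g (scl 2 x)
          else h (scl ((2 * max_norm n x - 1) / max (max_norm n x) (1 / 2)) x))"
proof (rule continuous_map_top_of_set_cases)
  show "continuous_on (disc n) (max_norm n)"
    by (rule continuous_on_max_norm [OF continuous_on_id])
  show "continuous_map (top_of_set {z \<in> disc n. max_norm n z \<le> 1 / 2}) Y (\<lambda>x. g (scl 2 x))"
    by (rule continuous_map_top_of_set_compose [OF g])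
      (intro continuous_on_rules, auto intro!: scl_in_max_ball)
  have "scl ((2 * max_norm n x - 1) / max (max_norm n x) (1 / 2)) x \<in> disc n"
    if "x \<in> disc n" "1 / 2 \<le> max_norm n x" for x
    using that by (intro scl_in_max_ball) (auto simp: collar_scale max_ball_def)
  then show "continuous_map (top_of_set {z \<in> disc n. 1 / 2 \<le> max_norm n z}) Y
      (\<lambda>x. h (scl ((2 * max_norm n x - 1) / max (max_norm n x) (1 / 2)) x))"
    by (intro continuous_map_top_of_set_compose [OF h] continuous_on_rules) (auto simp: max_def)
  show "g (scl 2 z) = h (scl ((2 * max_norm n z - 1) / max (max_norm n z) (1 / 2)) z)"
    if "z \<in> disc n" "max_norm n z = 1 / 2" for z
  proof -
    have "scl 2 z \<in> max_sphere n"
      using that by (auto simp: max_sphere_def intro: scl_in_max_ball)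
    moreover have "(2 * max_norm n z - 1) / max (max_norm n z) (1 / 2) = 0"
      using that by simp
    ultimately show ?thesis
      by (simp only: gh scl_0)
  qed
qed

text \<open>Some extension \<open>w\<close> of \<open>v\<close> exists, but \<open>u\<close> and
  \<open>f \<circ> w\<close>, which agree on the boundary, may differ by an element of the homotopy
  group of \<open>X\<close>. Surjectivity realizes this element by a map \<delta> into
  \<open>Z\<close>, and inserting \<delta> at the centre of \<open>w\<close> removes the
  difference.\<close>

lemma homotopy_lifting_disc_rel:
  fixes Z :: "'z topology" and X :: "'x topology"
  assumes weq: "weak_homotopy_equivalence Z X f"
    and v: "continuous_map (top_of_set (max_sphere n)) Z v"
    and u: "continuous_map (top_of_set (disc n)) X u"
    and uv: "\<And>x. x \<in> max_sphere n \<Longrightarrow> u x = f (v x)"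
  obtains w where "continuous_map (top_of_set (disc n)) Z w" "\<And>x. x \<in> max_sphere n \<Longrightarrow> w x = v x"
    "homotopic_rel (max_sphere n) u (disc n) X u (f \<circ> w)"
proof (cases n)
  case 0
  \<comment> \<open>The disc is a point and its sphere is empty, so the claim is surjectivity on
    path components.\<close>
  let ?o = "\<lambda>_::nat. 0::real"
  have "u ?o \<in> topspace X"
    using u by (simp add: 0 disc_0 continuous_map_def)
  then obtain z where z: "z \<in> topspace Z" "path_component_of X (u ?o) (f z)"
    using weq_path_surj [OF weq] by blast
  then obtain g where g: "continuous_map (top_of_set {0..1::real}) X g" "g 0 = u ?o" "g 1 = f z"
    by (auto simp: path_component_of_def pathin_def)
  have h: "continuous_map (top_of_set ({0..1::real} \<times> disc n)) X (\<lambda>x. g (fst x))"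
    by (rule continuous_map_top_of_set_compose [OF g(1)]) (intro continuous_on_rules, auto)
  have "homotopic_rel (max_sphere n) u (disc n) X u (f \<circ> (\<lambda>_. z))"
    unfolding homotopic_rel_iff [OF max_sphere_subset_disc]
    by (rule exI [of _ "\<lambda>x. g (fst x)"]) (use h g in \<open>auto simp: 0 disc_0 max_sphere_0\<close>)
  with z show thesis
    by (intro that [of "\<lambda>_. z"]) (auto simp: 0 max_sphere_0)
next
  case (Suc m)
  have n: "0 < n"
    by (simp add: Suc)
  let ?N = "max_norm n"
  have fc: "continuous_map Z X f"
    by (rule weq_continuous [OF weq])
  obtain w where w: "continuous_map (top_of_set (disc n)) Z w" and wv: "\<And>x. x \<in> max_sphere n \<Longrightarrow> w x = v x"
    using extend_from_max_sphere [OF weq v [unfolded Suc] u [unfolded Suc]] uv unfolding Suc by blast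
  have fw: "continuous_map (top_of_set (disc n)) X (\<lambda>x. f (w x))"
    using continuous_map_compose [OF w fc] by (simp add: o_def)
  define z where "z = w (\<lambda>_. 0)"
  have z: "z \<in> topspace Z"
    using w by (auto simp: z_def continuous_map_def)
  txt \<open>\<open>R\<close> is defined on a ball of radius \<open>2\<close>, the union of a disc carrying \<open>u\<close> and a collar that
    carries \<open>f \<circ> w\<close> from the boundary of the disc back to its centre.\<close>
  define R where "R = (\<lambda>x. if ?N x \<le> 1 then u x else f (w (scl ((2 - ?N x) / max (?N x) 1) x)))"
  have R: "continuous_map (top_of_set (max_ball n 2)) X R"
    unfolding R_def
  proof (rule continuous_map_top_of_set_cases)
    show "continuous_on (max_ball n 2) ?N"
      by (rule continuous_on_max_norm [OF continuous_on_id])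
    have "{z \<in> max_ball n 2. ?N z \<le> 1} = disc n"
      by (auto simp: max_ball_def)
    then show "continuous_map (top_of_set {z \<in> max_ball n 2. ?N z \<le> 1}) X u"
      using u by simp
    have "scl ((2 - ?N x) / max (?N x) 1) x \<in> disc n" if "x \<in> max_ball n 2" "1 \<le> ?N x" for x
      using that by (intro scl_in_max_ball) (auto simp: max_ball_def max_def)
    then show "continuous_map (top_of_set {z \<in> max_ball n 2. 1 \<le> ?N z}) X
        (\<lambda>x. f (w (scl ((2 - ?N x) / max (?N x) 1) x)))"
      by (intro continuous_map_top_of_set_compose [OF fw] continuous_on_rules) (auto simp: max_def)
    show "u x = f (w (scl ((2 - ?N x) / max (?N x) 1) x))" if "x \<in> max_ball n 2" "?N x = 1" for x
    proof -
      have "x \<in> max_sphere n"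
        using that by (auto simp: max_sphere_def max_ball_def)
      then show ?thesis
        using that uv wv by simp
    qed
  qed
  have R2: "R x = f z" if "x \<in> max_ball n 2" "?N x = 2" for x
    using that by (simp add: R_def z_def)
  have disc_norm: "?N x \<le> 1" if "x \<in> disc n" for x
    using that by (simp add: max_ball_def)
  have dbl: "scl 2 x \<in> disc n" if "x \<in> disc n" "?N x \<le> 1 / 2" for x
    using that by (intro scl_in_max_ball) auto
  \<comment> \<open>The element measuring the difference of \<open>u\<close> and
    \<open>f \<circ> w\<close>, based at the image of the centre of \<open>w\<close>.\<close>
  define \<gamma> where "\<gamma> = (\<lambda>x. R (scl 2 x))"
  have "continuous_map (top_of_set (disc n)) X \<gamma>"
    unfolding \<gamma>_def
    by (rule continuous_map_top_of_set_compose [OF R])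
      (intro continuous_on_rules, auto intro: scl_in_max_ball simp: disc_norm)
  moreover have "\<gamma> x = f z" if "x \<in> max_sphere n" for x
    unfolding \<gamma>_def using that by (intro R2) (auto simp: max_sphere_def intro: scl_in_max_ball)
  ultimately obtain \<delta> where \<delta>: "continuous_map (top_of_set (disc n)) Z \<delta>"
    and \<delta>s: "\<And>x. x \<in> max_sphere n \<Longrightarrow> \<delta> x = z"
    and hom: "homotopic_rel (max_sphere n) (\<lambda>_. f z) (disc n) X (f \<circ> \<delta>) \<gamma>"
    by (rule weq_disc_surj [OF weq n z]) blast+
  then obtain G where G: "continuous_map (top_of_set ({0..1::real} \<times> disc n)) X G"
    and G0: "\<And>x. x \<in> disc n \<Longrightarrow> G (0, x) = f (\<delta> x)" and G1: "\<And>x. x \<in> disc n \<Longrightarrow> G (1, x) = \<gamma> x"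
    and Gs: "\<And>t x. \<lbrakk>t \<in> {0..1}; x \<in> max_sphere n\<rbrakk> \<Longrightarrow> G (t, x) = f z"
    unfolding homotopic_rel_iff [OF max_sphere_subset_disc] by auto
  define out where "out = (\<lambda>x. scl ((2 * ?N x - 1) / max (?N x) (1 / 2)) x)"
  have out: "continuous_on S out" for S
    unfolding out_def by (intro continuous_on_rules) (auto simp: max_def)
  have out_in: "out x \<in> disc n" if "x \<in> disc n" "1 / 2 \<le> ?N x" for x
    unfolding out_def using that by (intro scl_in_max_ball) (auto simp: collar_scale max_ball_def)
  \<comment> \<open>Along each ray, \<delta> comes first and then \<open>w\<close> from its centre
    to the boundary; the boundary values remain those of \<open>v\<close>.\<close>
  define w' where "w' = (\<lambda>x. if ?N x \<le> 1 / 2 then \<delta> (scl 2 x) else w (out x))"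
  have w': "continuous_map (top_of_set (disc n)) Z w'"
    unfolding w'_def out_def by (rule disc_inner_outer_continuous_map [OF \<delta> w]) (simp add: \<delta>s z_def)
  have w's: "w' x = v x" if "x \<in> max_sphere n" for x
    using that wv by (auto simp: w'_def out_def max_sphere_def)
  \<comment> \<open>The radius \<open>a r * r\<close> grows from 0 to 2 up to \<open>r = 1/2\<close>
    and then returns to 1. Thus \<open>R\<close> is followed through \<open>u\<close> and the collar
    to its outer rim and back, which is \<open>f \<circ> w'\<close> after replacing
    \<open>f \<circ> \<delta>\<close> by \<gamma>.\<close>
  define a where "a = (\<lambda>r. (3 - 2 * max r (1 / 2)) / max r (1 / 2) :: real)"
  have ar: "0 \<le> a r" "a r * r \<le> 2" if "0 \<le> r" "r \<le> 1" for r
    using that by (auto simp: a_def max_def)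
  have "homotopic_rel (max_sphere n) u (disc n) X (f \<circ> w') (\<lambda>x. R (scl (a (?N x)) x))"
    unfolding homotopic_rel_iff [OF max_sphere_subset_disc]
  proof (intro exI conjI ballI)
    let ?Q = "\<lambda>y. if ?N (snd y) \<le> 1 / 2 then G (fst y, scl 2 (snd y)) else f (w (out (snd y)))"
    show "continuous_map (top_of_set ({0..1::real} \<times> disc n)) X ?Q"
    proof (rule continuous_map_top_of_set_cases)
      show "continuous_on ({0..1} \<times> disc n) (\<lambda>y. ?N (snd y))"
        by (intro continuous_on_rules)
      show "continuous_map (top_of_set {y \<in> {0..1} \<times> disc n. ?N (snd y) \<le> 1 / 2}) X (\<lambda>y. G (fst y, scl 2 (snd y)))"
        by (rule continuous_map_top_of_set_compose [OF G])
          (intro continuous_on_rules, auto intro!: scl_in_max_ball)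
      show "continuous_map (top_of_set {y \<in> {0..1} \<times> disc n. 1 / 2 \<le> ?N (snd y)}) X (\<lambda>y. f (w (out (snd y))))"
        by (rule continuous_map_top_of_set_compose [OF fw])
          (intro continuous_on_compose2 [OF out [of UNIV]] continuous_on_rules subset_UNIV, auto intro: out_in)
      show "G (fst y, scl 2 (snd y)) = f (w (out (snd y)))" if "y \<in> {0..1} \<times> disc n" "?N (snd y) = 1 / 2" for y
      proof -
        have "scl 2 (snd y) \<in> max_sphere n"
          using that by (auto simp: max_sphere_def intro: scl_in_max_ball)
        moreover have "out (snd y) = (\<lambda>_. 0)"
          by (simp only: out_def that(2)) simp
        ultimately show ?thesis
          using that Gs by (auto simp: z_def)
      qed
    qed
    show "?Q (0, x) = (f \<circ> w') x" if "x \<in> disc n" for x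
      using dbl [OF that] G0 that by (simp add: w'_def)
    show "?Q (1, x) = R (scl (a (?N x)) x)" if x: "x \<in> disc n" for x
    proof (cases "?N x \<le> 1 / 2")
      case True
      then have "?Q (1, x) = R (scl 4 x)"
        using dbl [OF x True] by (simp add: G1 \<gamma>_def)
      moreover have "a (?N x) = 4"
        using True by (simp add: a_def)
      ultimately show ?thesis
        by simp
    next
      case False
      let ?r = "?N x"
      have r: "1 / 2 < ?r" "?r \<le> 1"
        using False x by (auto simp: max_ball_def)
      then have ax: "a ?r = (3 - 2 * ?r) / ?r" "?N (scl (a ?r) x) = 3 - 2 * ?r"
        by (auto simp: a_def)
      show ?thesis
      proof (cases "?r = 1")
        case True
        then have "x \<in> max_sphere n"
          using x by (simp add: max_sphere_def)
        moreover have "a ?r = 1" "out x = x"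
          using True by (simp_all add: a_def out_def)
        ultimately show ?thesis
          using True uv wv by (simp add: R_def)
      next
        case neq: False
        with r have "R (scl (a ?r) x) = f (w (scl ((2 * ?r - 1) / (3 - 2 * ?r)) (scl (a ?r) x)))"
          unfolding R_def ax(2) by (simp add: max_def)
        also have "scl ((2 * ?r - 1) / (3 - 2 * ?r)) (scl (a ?r) x) = out x"
          using r neq by (simp add: ax out_def)
        finally show ?thesis
          using False by simp
      qed
    qed
    show "?Q (t, x) = u x" if "x \<in> max_sphere n" for t x
      using that uv wv by (auto simp: max_sphere_def out_def)
  qed
  \<comment> \<open>The excursion into the collar is undone by interpolating the factor
    \<open>a\<close> to 1. At norm 1 the factor is already 1, so the boundary does not move.\<close>
  moreover have "homotopic_rel (max_sphere n) u (disc n) X (\<lambda>x. R (scl (a (?N x)) x)) u"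
    unfolding homotopic_rel_iff [OF max_sphere_subset_disc]
  proof (intro exI conjI ballI)
    let ?k = "\<lambda>y. (1 - fst y) * a (?N (snd y)) + fst y"
    let ?Q = "\<lambda>y. R (scl (?k y) (snd y))"
    show "continuous_map (top_of_set ({0..1::real} \<times> disc n)) X ?Q"
    proof (rule continuous_map_top_of_set_compose [OF R])
      show "continuous_on ({0..1} \<times> disc n) (\<lambda>y. scl (?k y) (snd y))"
        unfolding a_def by (intro continuous_on_rules) (auto simp: max_def)
      have "scl (?k (t, x)) x \<in> max_ball n 2" if t: "t \<in> {0..1}" and x: "x \<in> disc n" for t x
      proof (rule scl_in_max_ball [OF x])
        have r: "0 \<le> ?N x" "?N x \<le> 1"
          using x by (auto simp: max_ball_def)
        have "0 \<le> ?k (t, x)"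
          using t ar [OF r] by simp
        then have "\<bar>?k (t, x)\<bar> * ?N x = ?k (t, x) * ?N x"
          by simp
        also have "\<dots> = (1 - t) * (a (?N x) * ?N x) + t * ?N x"
          by (simp add: algebra_simps)
        also have "\<dots> \<le> (1 - t) * 2 + t * 2"
          using t ar [OF r] r by (intro add_mono mult_left_mono) auto
        finally show "\<bar>?k (t, x)\<bar> * ?N x \<le> 2"
          by simp
      qed
      then show "(\<lambda>y. scl (?k y) (snd y)) \<in> {0..1} \<times> disc n \<rightarrow> max_ball n 2"
        by auto
    qed
    show "?Q (0, x) = R (scl (a (?N x)) x)" for x
      by simp
    show "?Q (1, x) = u x" if "x \<in> disc n" for x
      using that by (simp add: R_def max_ball_def)
    show "?Q (t, x) = u x" if "x \<in> max_sphere n" for t x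
      using that by (simp add: R_def max_sphere_def a_def)
  qed
  ultimately have "homotopic_rel (max_sphere n) u (disc n) X u (f \<circ> w')"
    using homotopic_with_trans homotopic_with_symD by blast
  with w' w's show thesis
    by (rule that)
qed

text \<open>The relative version is applied after the prescribed boundary homotopy has become part
  of the map; a reparametrization of its result then lets that homotopy reappear on the
  boundary.\<close>

lemma homotopy_lifting_disc:
  fixes Z :: "'z topology" and X :: "'x topology"
  assumes weq: "weak_homotopy_equivalence Z X f"
    and v: "continuous_map (top_of_set (max_sphere n)) Z v"
    and u: "continuous_map (top_of_set (disc n)) X u"
    and h: "continuous_map (top_of_set ({0..1::real} \<times> max_sphere n)) X h"
    and h0: "\<And>x. x \<in> max_sphere n \<Longrightarrow> h (0, x) = u x"
    and h1: "\<And>x. x \<in> max_sphere n \<Longrightarrow> h (1, x) = f (v x)"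
  obtains w H where "continuous_map (top_of_set (disc n)) Z w" "\<And>x. x \<in> max_sphere n \<Longrightarrow> w x = v x"
    "continuous_map (top_of_set ({0..1::real} \<times> disc n)) X H"
    "\<And>x. x \<in> disc n \<Longrightarrow> H (0, x) = u x" "\<And>x. x \<in> disc n \<Longrightarrow> H (1, x) = f (w x)"
    "\<And>t x. \<lbrakk>t \<in> {0..1}; x \<in> max_sphere n\<rbrakk> \<Longrightarrow> H (t, x) = h (t, x)"
proof -
  let ?N = "max_norm n"
  \<comment> \<open>Doubles the inner half of the disc and projects the outer annulus radially to
    the sphere.\<close>
  define e where "e = (\<lambda>x. scl (1 / max (1 / 2) (?N x)) x)"
  have e: "continuous_on S e" for S
    unfolding e_def by (intro continuous_on_rules) (auto simp: max_def)
  have e_in: "e x \<in> disc n" if "x \<in> disc n" for x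
    unfolding e_def using that by (intro scl_in_max_ball) (auto simp: max_def max_ball_def)
  have e_sphere: "e x \<in> max_sphere n" if "x \<in> disc n" "1 / 2 \<le> ?N x" for x
  proof -
    have "max (1 / 2) (?N x) = ?N x"
      using that by (intro max_absorb2)
    then have "?N (e x) = 1"
      using that by (simp add: e_def)
    then show ?thesis
      using e_in [OF that(1)] by (simp add: max_sphere_def)
  qed
  txt \<open>Absorb the boundary homotopy into a collar of the disc.\<close>
  define U where "U = (\<lambda>x. if ?N x \<le> 1 / 2 then u (scl 2 x) else h (2 * ?N x - 1, e x))"
  have U: "continuous_map (top_of_set (disc n)) X U"
    unfolding U_def
  proof (rule continuous_map_top_of_set_cases)
    show "continuous_on (disc n) ?N"
      by (rule continuous_on_max_norm [OF continuous_on_id])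
    show "continuous_map (top_of_set {x \<in> disc n. ?N x \<le> 1 / 2}) X (\<lambda>x. u (scl 2 x))"
      by (rule continuous_map_top_of_set_compose [OF u])
        (intro continuous_on_rules, auto intro!: scl_in_max_ball)
    show "continuous_map (top_of_set {x \<in> disc n. 1 / 2 \<le> ?N x}) X (\<lambda>x. h (2 * ?N x - 1, e x))"
      by (rule continuous_map_top_of_set_compose [OF h])
        (intro continuous_on_rules e, auto intro!: e_sphere simp: max_ball_def)
    show "u (scl 2 x) = h (2 * ?N x - 1, e x)" if "x \<in> disc n" "?N x = 1 / 2" for x
    proof -
      have "2 * ?N x - 1 = 0" "e x = scl 2 x"
        by (simp_all only: e_def that(2)) simp_all
      then show ?thesis
        using h0 [of "e x"] e_sphere [of x] that by (simp only: order_refl)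
    qed
  qed
  have US: "U x = f (v x)" if "x \<in> max_sphere n" for x
    using that h1 by (simp add: U_def max_sphere_def e_def)
  obtain w where w: "continuous_map (top_of_set (disc n)) Z w" and ws: "\<And>x. x \<in> max_sphere n \<Longrightarrow> w x = v x"
    and hom: "homotopic_rel (max_sphere n) U (disc n) X U (f \<circ> w)"
    using homotopy_lifting_disc_rel [OF weq v U US] by blast
  then obtain K where K: "continuous_map (top_of_set ({0..1::real} \<times> disc n)) X K"
    and K0: "\<And>x. x \<in> disc n \<Longrightarrow> K (0, x) = U x" and K1: "\<And>x. x \<in> disc n \<Longrightarrow> K (1, x) = f (w x)"
    and Ks: "\<And>t x. \<lbrakk>t \<in> {0..1}; x \<in> max_sphere n\<rbrakk> \<Longrightarrow> K (t, x) = U x"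
    unfolding homotopic_rel_iff [OF max_sphere_subset_disc] by auto
  \<comment> \<open>The factor moves from 1/2, which sees only the copy of \<open>u\<close> inside
    \<open>U\<close>, to the factor of \<open>e\<close>. On the boundary it equals
    \<open>(1 + t) / 2\<close>, which runs through the collar carrying \<open>h\<close>.\<close>
  define k where "k = (\<lambda>t x. (1 - t) / 2 + t / max (1 / 2) (?N x))"
  have k: "0 \<le> k t x" "k t x * ?N x \<le> 1" if "t \<in> {0..1}" "x \<in> disc n" for t x
  proof -
    show "0 \<le> k t x"
      using that by (auto simp: k_def max_def)
    have "?N x \<le> 1"
      using that by (simp add: max_ball_def)
    have "k t x * ?N x = (1 - t) * (?N x / 2) + t * (?N x / max (1 / 2) (?N x))"
      by (simp add: k_def algebra_simps)
    also have "\<dots> \<le> (1 - t) * 1 + t * 1"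
      using that \<open>?N x \<le> 1\<close> max_norm_nonneg [of n x]
      by (intro add_mono mult_left_mono) (auto simp: max_def simp del: max_norm_nonneg)
    finally show "k t x * ?N x \<le> 1"
      by simp
  qed
  \<comment> \<open>The time of \<open>K\<close> is damped to 0 towards the boundary, where
    \<open>H\<close> must follow \<open>U\<close> alone. At the end the damping is harmless: where
    it acts, \<open>e\<close> lands in the sphere, on which \<open>K\<close> is stationary.\<close>
  define H where "H = (\<lambda>y. K (fst y * min 1 (2 - 2 * ?N (snd y)), scl (k (fst y) (snd y)) (snd y)))"
  show thesis
  proof
    show "continuous_map (top_of_set (disc n)) Z (\<lambda>x. w (e x))"
      by (rule continuous_map_top_of_set_compose [OF w e]) (auto intro: e_in)
    show "w (e x) = v x" if "x \<in> max_sphere n" for x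
      using that ws by (simp add: e_def max_sphere_def)
    show "continuous_map (top_of_set ({0..1::real} \<times> disc n)) X H"
      unfolding H_def
    proof (rule continuous_map_top_of_set_compose [OF K])
      show "continuous_on ({0..1} \<times> disc n)
         (\<lambda>y. (fst y * min 1 (2 - 2 * ?N (snd y)), scl (k (fst y) (snd y)) (snd y)))"
        unfolding k_def by (intro continuous_on_rules) (auto simp: max_def)
      show "(\<lambda>y. (fst y * min 1 (2 - 2 * ?N (snd y)), scl (k (fst y) (snd y)) (snd y))) \<in> {0..1} \<times> disc n \<rightarrow> {0..1} \<times> disc n"
      proof
        fix y :: "real \<times> (nat \<Rightarrow> real)"
        assume "y \<in> {0..1} \<times> disc n"
        then obtain t x where y: "y = (t, x)" and t: "t \<in> {0..1}" and x: "x \<in> disc n"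
          by auto
        then have "?N x \<le> 1"
          by (simp add: max_ball_def)
        then show "(fst y * min 1 (2 - 2 * ?N (snd y)), scl (k (fst y) (snd y)) (snd y)) \<in> {0..1} \<times> disc n"
          using t scl_in_max_ball [OF x, of "k t x" 1] k [OF t x] by (simp add: y mult_le_one)
      qed
    qed
    show "H (0, x) = u x" if "x \<in> disc n" for x
    proof -
      have "?N x \<le> 1"
        using that by (simp add: max_ball_def)
      moreover from this have "scl (1 / 2) x \<in> disc n"
        using that by (intro scl_in_max_ball) auto
      ultimately show ?thesis
        by (simp add: H_def k_def K0 U_def)
    qed
    show "H (1, x) = f (w (e x))" if x: "x \<in> disc n" for x
    proof (cases "?N x \<le> 1 / 2")
      case True
      then have "H (1, x) = K (1, e x)"
        by (simp add: H_def k_def e_def)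
      then show ?thesis
        using x by (simp add: K1 e_in)
    next
      case False
      then have s: "e x \<in> max_sphere n"
        using x e_sphere by simp
      have "H (1, x) = K (2 - 2 * ?N x, e x)"
        using False by (simp add: H_def k_def e_def)
      then show ?thesis
        using s x False Ks US ws by (simp add: max_ball_def)
    qed
    show "H (t, x) = h (t, x)" if t: "t \<in> {0..1}" and x: "x \<in> max_sphere n" for t x
    proof -
      have N: "?N x = 1" and xd: "x \<in> disc n"
        using x by (auto simp: max_sphere_def)
      have kt: "k t x = (1 + t) / 2"
        by (simp add: k_def N field_simps)
      have d: "scl (k t x) x \<in> disc n"
        using k [OF t xd] xd by (intro scl_in_max_ball) auto
      have "H (t, x) = U (scl (k t x) x)"
        by (simp add: H_def N K0 d)
      also have "\<dots> = h (t, x)"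
      proof (cases "t = 0")
        case True
        then show ?thesis
          unfolding kt by (simp add: U_def N h0 [OF x])
      next
        case False
        with t have "\<not> ?N (scl (k t x) x) \<le> 1 / 2"
          unfolding kt by (simp add: N)
        moreover have "2 * ?N (scl (k t x) x) - 1 = t"
          using t unfolding kt by (simp add: N add_divide_distrib)
        moreover have "e (scl (k t x) x) = x"
        proof -
          have "0 < k t x"
            using t by (simp add: kt)
          moreover have "max (1 / 2) (?N (scl (k t x) x)) = k t x"
            using t unfolding kt by (simp add: N max_def)
          ultimately show ?thesis
            by (simp only: e_def scl_scl) simp
        qed
        ultimately show ?thesis
          by (simp only: U_def if_False)
      qed
      finally show ?thesis .
    qed
  qed
qed

section \<open>Cubes and simplices\<close>

text \<open>A radial map that exchanges the maximum norm for the sum norm: the coordinates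
  \<open>1, \<dots>, n\<close> of the image add up to \<open>max_norm n y\<close>, and coordinate 0
  is the rest. At the origin the quotient is 0 by the convention on division, and the image is
  vertex 0.\<close>

definition cube_to_simplex :: "nat \<Rightarrow> (nat \<Rightarrow> real) \<Rightarrow> nat \<Rightarrow> real" where
  "cube_to_simplex n y = (\<lambda>j. if j = 0 then 1 - max_norm n y
     else if j \<le> n then y (j - 1) * (max_norm n y / (\<Sum>i<n. y i)) else 0)"

lemma cubeD:
  assumes "y \<in> cube n"
  shows "0 \<le> y i" "y i \<le> 1" "i < n \<Longrightarrow> y i \<le> max_norm n y" "max_norm n y \<le> 1"
    "i < n \<Longrightarrow> y i \<le> (\<Sum>i<n. y i)" "0 \<le> (\<Sum>i<n. y i)"
    "max_norm n y = 0 \<longleftrightarrow> y = (\<lambda>_. 0)" "(\<Sum>i<n. y i) = 0 \<longleftrightarrow> y = (\<lambda>_. 0)"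
proof -
  show nn: "0 \<le> y i" "y i \<le> 1" for i
    using assms by (cases "i < n"; force simp: cube_def)+
  show le: "i < n \<Longrightarrow> y i \<le> max_norm n y" for i
    using abs_le_max_norm [of i n y] by simp
  show "max_norm n y \<le> 1"
    using nn by (simp add: max_norm_le_iff)
  show les: "i < n \<Longrightarrow> y i \<le> (\<Sum>i<n. y i)" for i
    using nn by (intro member_le_sum) auto
  show "0 \<le> (\<Sum>i<n. y i)"
    using nn by (intro sum_nonneg) auto
  have zero: "y = (\<lambda>_. 0)" if "\<And>i. i < n \<Longrightarrow> y i \<le> 0"
  proof
    fix i
    show "y i = 0"
      using assms that [of i] nn(1) [of i] by (cases "i < n") (auto simp: cube_def)
  qed
  show "max_norm n y = 0 \<longleftrightarrow> y = (\<lambda>_. 0)"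
    using le zero by auto
  show "(\<Sum>i<n. y i) = 0 \<longleftrightarrow> y = (\<lambda>_. 0)"
    using les zero by auto
qed

lemma sum_cube_to_simplex:
  assumes "y \<in> cube n"
  shows "(\<Sum>j\<le>n. cube_to_simplex n y j) = 1"
proof -
  have "(\<Sum>j\<le>n. cube_to_simplex n y j) = cube_to_simplex n y 0 + (\<Sum>j<n. cube_to_simplex n y (Suc j))"
    by (simp add: lessThan_Suc_atMost [symmetric] sum.lessThan_Suc_shift del: sum.lessThan_Suc)
  also have "\<dots> = 1 - max_norm n y + (\<Sum>j<n. y j) * (max_norm n y / (\<Sum>i<n. y i))"
    by (simp add: cube_to_simplex_def sum_distrib_right sum_divide_distrib)
  also have "(\<Sum>j<n. y j) * (max_norm n y / (\<Sum>i<n. y i)) = max_norm n y"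
    using cubeD(7,8) [OF assms] by (cases "(\<Sum>j<n. y j) = 0") auto
  finally show ?thesis
    by simp
qed

lemma cube_to_simplex_in:
  assumes "y \<in> cube n"
  shows "cube_to_simplex n y \<in> standard_simplex n"
proof -
  have nn: "0 \<le> cube_to_simplex n y j" for j
    using cubeD [OF assms] by (auto simp: cube_to_simplex_def)
  moreover have z: "cube_to_simplex n y j = 0" if "n < j" for j
    using that by (simp add: cube_to_simplex_def)
  moreover have "cube_to_simplex n y j \<le> 1" for j
    using member_le_sum [of j "{..n}" "cube_to_simplex n y"] nn z sum_cube_to_simplex [OF assms]
    by (cases "j \<le> n") auto
  ultimately show ?thesis
    using sum_cube_to_simplex [OF assms] by (simp add: standard_simplex_def)
qed

lemma continuous_on_cube_to_simplex: "continuous_on (cube n) (cube_to_simplex n)"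
proof (rule continuous_on_funI)
  fix j
  have N: "continuous_on (cube n) (max_norm n)"
    by (rule continuous_on_max_norm [OF continuous_on_id])
  have c: "continuous_on (cube n) (\<lambda>y. y i)" for i
    by (rule continuous_on_coord [OF continuous_on_id])
  have S: "continuous_on (cube n) (\<lambda>y. \<Sum>i<n. y i)"
    by (intro continuous_on_sum c)
  have "continuous_on (cube n) (\<lambda>y. y i * (max_norm n y / (\<Sum>i<n. y i)))" if i: "i < n" for i
    unfolding continuous_on_def
  proof
    fix y
    assume y: "y \<in> cube n"
    let ?F = "at y within cube n"
    have lim: "(max_norm n \<longlongrightarrow> max_norm n y) ?F" "((\<lambda>y. y i) \<longlongrightarrow> y i) ?F"
      "((\<lambda>y. \<Sum>i<n. y i) \<longlongrightarrow> (\<Sum>i<n. y i)) ?F"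
      using N c S y unfolding continuous_on_def by blast+
    show "((\<lambda>y. y i * (max_norm n y / (\<Sum>i<n. y i))) \<longlongrightarrow> y i * (max_norm n y / (\<Sum>i<n. y i))) ?F"
    proof (cases "(\<Sum>i<n. y i) = 0")
      case False
      with lim show ?thesis
        by (intro tendsto_mult tendsto_divide)
    next
      case True
      then have 0: "max_norm n y = 0"
        using cubeD(7,8) [OF y] by simp
      \<comment> \<open>Only the origin is critical. There \<open>x i\<close> is at most the sum of
        the coordinates, so the entry is bounded by the maximum norm, which tends to 0.\<close>
      have le: "norm (x i * (max_norm n x / (\<Sum>i<n. x i))) \<le> max_norm n x" if x: "x \<in> cube n" for x
      proof (cases "(\<Sum>i<n. x i) = 0")
        case False
        have "x i * (max_norm n x / (\<Sum>i<n. x i)) = max_norm n x * (x i / (\<Sum>i<n. x i))"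
          by simp
        also have "\<dots> \<le> max_norm n x * 1"
          using cubeD(5,6) [OF x] i False by (intro mult_left_mono) (auto simp: divide_le_eq_1)
        finally show ?thesis
          using cubeD(1,6) [OF x] by simp
      qed simp
      have "\<forall>\<^sub>F x in ?F. norm (x i * (max_norm n x / (\<Sum>i<n. x i))) \<le> max_norm n x"
        unfolding eventually_at_filter by (rule always_eventually) (use le in blast)
      from Lim_null_comparison [OF this] lim(1) show ?thesis
        unfolding True 0 by simp
    qed
  qed
  then have "continuous_on (cube n) (\<lambda>y. y (j - 1) * (max_norm n y / (\<Sum>i<n. y i)))" if "j \<noteq> 0" "j \<le> n"
    using that by simp
  moreover have "continuous_on (cube n) (\<lambda>y. 1 - max_norm n y)"
    by (intro continuous_on_rules)
  ultimately show "continuous_on (cube n) (\<lambda>y. cube_to_simplex n y j)"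
    by (cases "j = 0"; cases "j \<le> n") (simp_all add: cube_to_simplex_def)
qed

lemma cube_to_simplex_surj:
  assumes x: "x \<in> standard_simplex n"
  shows "\<exists>y\<in>cube n. cube_to_simplex n y = x"
proof -
  define z where "z = (\<lambda>i. x (Suc i))"
  let ?S = "\<Sum>i<n. z i" and ?M = "max_norm n z"
  have "(\<Sum>j\<le>n. x j) = x 0 + ?S"
    by (simp add: z_def lessThan_Suc_atMost [symmetric] sum.lessThan_Suc_shift del: sum.lessThan_Suc)
  then have S: "?S = 1 - x 0"
    using x by (simp add: standard_simplex_def)
  have z: "z \<in> cube n"
    using x by (auto simp: z_def cube_def standard_simplex_def)
  show ?thesis
  proof (cases "?M = 0")
    case True
    then have z0: "z = (\<lambda>_. 0)"
      using cubeD(7) [OF z] by simp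
    have "cube_to_simplex n z j = x j" for j
    proof (cases j)
      case 0
      then show ?thesis
        using S by (simp add: cube_to_simplex_def z0)
    next
      case (Suc i)
      have "x (Suc i) = 0"
        using fun_cong [OF z0 [unfolded z_def], of i] by simp
      then show ?thesis
        by (simp add: Suc cube_to_simplex_def z0)
    qed
    with z show ?thesis
      by blast
  next
    case False
    then have "?S \<noteq> 0"
      using cubeD(7,8) [OF z] by simp
    with False have M: "0 < ?M" and S0: "0 < ?S"
      using cubeD(6) [OF z] by (simp_all add: less_le)
    \<comment> \<open>The inverse map: scaling by sum over maximum gives a point of maximum norm
      \<open>?S\<close>.\<close>
    let ?y = "scl (?S / ?M) z"
    have N: "max_norm n ?y = ?S"
      using M S0 by simp
    have sum: "(\<Sum>i<n. ?y i) = ?S * (?S / ?M)"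
      unfolding scl_def sum_distrib_left [symmetric] by (rule mult.commute)
    have "0 \<le> ?y i \<and> ?y i \<le> 1" if "i < n" for i
    proof -
      have e: "?y i = ?S * (z i / ?M)"
        by (simp add: scl_def)
      have "z i / ?M \<le> 1" "0 \<le> z i / ?M"
        using cubeD(1,3) [OF z] that M by auto
      moreover have "?S \<le> 1"
        using S x by (simp add: standard_simplex_def)
      ultimately show ?thesis
        unfolding e using S0 by (intro conjI mult_nonneg_nonneg mult_le_one) simp_all
    qed
    moreover have "?y i = 0" if "n \<le> i" for i
      using z that by (simp add: scl_def cube_def)
    ultimately have "?y \<in> cube n"
      by (simp add: cube_def)
    moreover have "cube_to_simplex n ?y j = x j" for j
    proof (cases j)
      case 0
      then show ?thesis
        unfolding cube_to_simplex_def N using S by simp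
    next
      case (Suc i)
      have "?y i * (?S / (?S * (?S / ?M))) = z i"
        using M S0 by (simp add: scl_def)
      then show ?thesis
        unfolding cube_to_simplex_def N sum using Suc x by (simp add: z_def standard_simplex_def)
    qed
    ultimately show ?thesis
      by blast
  qed
qed

lemma cube_to_simplex_inj: "inj_on (cube_to_simplex n) (cube n)"
proof (rule inj_onI)
  fix y y'
  assume y: "y \<in> cube n" "y' \<in> cube n" and eq: "cube_to_simplex n y = cube_to_simplex n y'"
  let ?M = "max_norm n y" and ?S = "\<lambda>y. \<Sum>i<n. y i"
  have M: "max_norm n y' = ?M"
    using fun_cong [OF eq, of 0] by (simp add: cube_to_simplex_def)
  show "y = y'"
  proof (cases "?M = 0")
    case True
    with M y show ?thesis
      using cubeD(7) by metis
  next
    case False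
    then have "?S y \<noteq> 0" "?S y' \<noteq> 0"
      using cubeD(7,8) [OF y(1)] cubeD(7,8) [OF y(2)] M by simp_all
    then have S: "0 < ?S y" "0 < ?S y'"
      using cubeD(6) [OF y(1)] cubeD(6) [OF y(2)] by (simp_all add: less_le)
    have e: "y i * (?M / ?S y) = y' i * (?M / ?S y')" if "i < n" for i
      using fun_cong [OF eq, of "Suc i"] that M by (simp add: cube_to_simplex_def)
    have "scl (?M / ?S y) y i = scl (?M / ?S y') y' i" if "i < n" for i
      using e [OF that] by (simp only: scl_def mult.commute)
    \<comment> \<open>The rescaled points agree coordinatewise; comparing their maximum norms shows
      that the coordinate sums of \<open>y\<close> and \<open>y'\<close> agree.\<close>
    then have "max_norm n (scl (?M / ?S y) y) = max_norm n (scl (?M / ?S y') y')"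
      by (intro max_norm_cong) simp
    then have "?M / ?S y * ?M = ?M / ?S y' * ?M"
      using S M by simp
    with False S have SS: "?S y = ?S y'"
      by (simp add: frac_eq_eq)
    have "?M / ?S y \<noteq> 0"
      using False S by simp
    then have "y i = y' i" if "i < n" for i
      using e [OF that] unfolding SS by (metis mult_right_cancel)
    moreover have "y i = y' i" if "\<not> i < n" for i
      using that y by (simp add: cube_def)
    ultimately show ?thesis
      by blast
  qed
qed

definition simplex_boundary :: "nat \<Rightarrow> (nat \<Rightarrow> real) set" where
  "simplex_boundary n = {x \<in> standard_simplex n. \<exists>i\<le>n. x i = 0}"

text \<open>Facet 0 of the simplex consists of the images of points of maximum norm 1, that is, with
  some coordinate equal to 1. Coordinate \<open>i + 1\<close> of an image vanishes when
  \<open>y i = 0\<close> or \<open>y\<close> is the origin.\<close>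

lemma cube_to_simplex_boundary:
  assumes y: "y \<in> cube n"
  shows "cube_to_simplex n y \<in> simplex_boundary n \<longleftrightarrow> y \<in> cube_boundary n"
proof -
  note D = cubeD [OF y]
  have "(\<exists>j\<le>n. cube_to_simplex n y j = 0) \<longleftrightarrow> (\<exists>i<n. y i = 0 \<or> y i = 1)"
  proof
    assume "\<exists>j\<le>n. cube_to_simplex n y j = 0"
    then obtain j where j: "j \<le> n" "cube_to_simplex n y j = 0"
      by blast
    show "\<exists>i<n. y i = 0 \<or> y i = 1"
    proof (cases j)
      case 0
      with j have "max_norm n y = 1"
        by (simp add: cube_to_simplex_def)
      moreover from this have "0 < n"
        by (cases n) auto
      ultimately obtain i where "i < n" "\<bar>y i\<bar> = 1"
        using max_norm_attained by metis
      then show ?thesis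
        using D(1) [of i] by auto
    next
      case (Suc i)
      with j have "y i = 0 \<or> y = (\<lambda>_. 0)"
        using D(7,8) by (auto simp: cube_to_simplex_def)
      with Suc j show ?thesis
        by (intro exI [of _ i]) auto
    qed
  next
    assume "\<exists>i<n. y i = 0 \<or> y i = 1"
    then obtain i where i: "i < n" "y i = 0 \<or> y i = 1"
      by blast
    from i(2) show "\<exists>j\<le>n. cube_to_simplex n y j = 0"
    proof
      assume "y i = 0"
      with i show ?thesis
        by (intro exI [of _ "Suc i"]) (simp add: cube_to_simplex_def)
    next
      assume "y i = 1"
      then have "max_norm n y = 1"
        using D(3) [OF i(1)] D(4) by simp
      then show ?thesis
        by (intro exI [of _ 0]) (simp add: cube_to_simplex_def)
    qed
  qed
  with y show ?thesis
    by (simp add: simplex_boundary_def cube_boundary_def cube_to_simplex_in)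
qed

text \<open>The composite of the affine map from disc to cube with \<open>cube_to_simplex\<close> is
  a continuous bijection from a compact space to a Hausdorff space, hence a homeomorphism.\<close>

lemma homeomorphism_disc_simplex:
  obtains g h where "homeomorphism (disc n) (standard_simplex n) g h" "g ` max_sphere n = simplex_boundary n"
proof -
  let ?g = "\<lambda>x. cube_to_simplex n (to_cube n x)"
  have tc: "to_cube n ` disc n = cube n"
  proof
    show "to_cube n ` disc n \<subseteq> cube n"
      using to_cube_in(1) by blast
    show "cube n \<subseteq> to_cube n ` disc n"
    proof
      fix y
      assume y: "y \<in> cube n"
      then have "of_cube n y \<in> disc n"
        using of_cube_in(1) by blast
      with to_cube_of_cube [OF y] show "y \<in> to_cube n ` disc n"
        by (metis imageI)
    qed
  qed
  have tb: "to_cube n ` max_sphere n = cube_boundary n"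
  proof
    show "to_cube n ` max_sphere n \<subseteq> cube_boundary n"
      using to_cube_in(2) by blast
    show "cube_boundary n \<subseteq> to_cube n ` max_sphere n"
    proof
      fix y
      assume y: "y \<in> cube_boundary n"
      then have "of_cube n y \<in> max_sphere n" "to_cube n (of_cube n y) = y"
        using of_cube_in(2) to_cube_of_cube by (auto simp: cube_boundary_def)
      then show "y \<in> to_cube n ` max_sphere n"
        by (metis imageI)
    qed
  qed
  have cs: "cube_to_simplex n ` cube n = standard_simplex n"
    using cube_to_simplex_in cube_to_simplex_surj by blast
  have "?g ` disc n = standard_simplex n"
    unfolding cs [symmetric] tc [symmetric] by (simp only: image_image)
  moreover have "continuous_on (disc n) ?g"
    using continuous_on_compose2 [OF continuous_on_cube_to_simplex continuous_on_to_cube] tc by blast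
  moreover have "inj_on ?g (disc n)"
  proof (rule inj_onI)
    fix x x'
    assume x: "x \<in> disc n" "x' \<in> disc n" and eq: "?g x = ?g x'"
    then have "to_cube n x = to_cube n x'"
      using inj_onD [OF cube_to_simplex_inj [of n], of "to_cube n x" "to_cube n x'"] tc by blast
    with x show "x = x'"
      using of_cube_to_cube by metis
  qed
  ultimately obtain h where "homeomorphism (disc n) (standard_simplex n) ?g h"
    using homeomorphism_compact [OF compact_max_ball] by blast
  moreover have "cube_to_simplex n ` cube_boundary n = simplex_boundary n"
  proof
    show "cube_to_simplex n ` cube_boundary n \<subseteq> simplex_boundary n"
      using cube_to_simplex_boundary by (auto simp: cube_boundary_def)
    show "simplex_boundary n \<subseteq> cube_to_simplex n ` cube_boundary n"
    proof
      fix x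
      assume x: "x \<in> simplex_boundary n"
      then obtain y where "y \<in> cube n" "cube_to_simplex n y = x"
        using cube_to_simplex_surj [of x n] by (auto simp: simplex_boundary_def)
      with x show "x \<in> cube_to_simplex n ` cube_boundary n"
        using cube_to_simplex_boundary by blast
    qed
  qed
  then have "?g ` max_sphere n = simplex_boundary n"
    unfolding tb [symmetric] by (simp only: image_image)
  ultimately show thesis
    by (rule that)
qed

lemma homotopy_lifting_simplex:
  fixes Z :: "'z topology" and X :: "'x topology"
  assumes weq: "weak_homotopy_equivalence Z X f"
    and v: "continuous_map (top_of_set (simplex_boundary n)) Z v"
    and u: "continuous_map (top_of_set (standard_simplex n)) X u"
    and h: "continuous_map (top_of_set ({0..1::real} \<times> simplex_boundary n)) X h"
    and h0: "\<And>x. x \<in> simplex_boundary n \<Longrightarrow> h (0, x) = u x"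
    and h1: "\<And>x. x \<in> simplex_boundary n \<Longrightarrow> h (1, x) = f (v x)"
  obtains w H where "continuous_map (top_of_set (standard_simplex n)) Z w"
    "\<And>x. x \<in> simplex_boundary n \<Longrightarrow> w x = v x"
    "continuous_map (top_of_set ({0..1::real} \<times> standard_simplex n)) X H"
    "\<And>x. x \<in> standard_simplex n \<Longrightarrow> H (0, x) = u x"
    "\<And>x. x \<in> standard_simplex n \<Longrightarrow> H (1, x) = f (w x)"
    "\<And>t x. \<lbrakk>t \<in> {0..1}; x \<in> simplex_boundary n\<rbrakk> \<Longrightarrow> H (t, x) = h (t, x)"
proof -
  obtain g k where gk: "homeomorphism (disc n) (standard_simplex n) g k"
    and gs: "g ` max_sphere n = simplex_boundary n"
    by (rule homeomorphism_disc_simplex)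
  have g: "continuous_on (disc n) g" "g ` disc n = standard_simplex n" "\<And>x. x \<in> disc n \<Longrightarrow> k (g x) = x"
    and k: "continuous_on (standard_simplex n) k" "k ` standard_simplex n = disc n"
      "\<And>y. y \<in> standard_simplex n \<Longrightarrow> g (k y) = y"
    using gk by (auto simp: homeomorphism_def)
  have gS: "g x \<in> simplex_boundary n" if "x \<in> max_sphere n" for x
    using that gs by blast
  have kS: "k y \<in> max_sphere n" if "y \<in> simplex_boundary n" for y
  proof -
    obtain x where x: "x \<in> max_sphere n" "y = g x"
      using \<open>y \<in> simplex_boundary n\<close> gs by blast
    then have "k y = x"
      using g(3) max_sphere_subset_disc by blast
    with x show ?thesis
      by simp
  qed
  have kd: "k y \<in> disc n" if "y \<in> standard_simplex n" for y
    using that k(2) by blast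
  have bd: "simplex_boundary n \<subseteq> standard_simplex n"
    by (auto simp: simplex_boundary_def)
  have gc: "continuous_on (max_sphere n) g"
    using g(1) max_sphere_subset_disc continuous_on_subset by blast
  have "continuous_map (top_of_set (max_sphere n)) Z (\<lambda>x. v (g x))"
    using gS by (intro continuous_map_top_of_set_compose [OF v gc]) auto
  moreover have "continuous_map (top_of_set (disc n)) X (\<lambda>x. u (g x))"
    using g by (intro continuous_map_top_of_set_compose [OF u g(1)]) auto
  moreover have "continuous_map (top_of_set ({0..1::real} \<times> max_sphere n)) X (\<lambda>y. h (fst y, g (snd y)))"
    using gS
    by (intro continuous_map_top_of_set_compose [OF h] continuous_on_Pair continuous_on_fst continuous_on_id
        continuous_on_compose2 [OF gc] continuous_on_snd) auto
  ultimately obtain w H where w: "continuous_map (top_of_set (disc n)) Z w"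
      "\<And>x. x \<in> max_sphere n \<Longrightarrow> w x = v (g x)"
    and H: "continuous_map (top_of_set ({0..1::real} \<times> disc n)) X H"
      "\<And>x. x \<in> disc n \<Longrightarrow> H (0, x) = u (g x)" "\<And>x. x \<in> disc n \<Longrightarrow> H (1, x) = f (w x)"
      "\<And>t x. \<lbrakk>t \<in> {0..1}; x \<in> max_sphere n\<rbrakk> \<Longrightarrow> H (t, x) = h (t, g x)"
    by (rule homotopy_lifting_disc [OF weq]) (use gS h0 h1 in auto)
  show thesis
  proof
    show "continuous_map (top_of_set (standard_simplex n)) Z (\<lambda>x. w (k x))"
      using k by (intro continuous_map_top_of_set_compose [OF w(1) k(1)]) auto
    show "w (k x) = v x" if "x \<in> simplex_boundary n" for x
      using kS [OF that] that bd k(3) by (simp add: w subset_iff)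
    show "continuous_map (top_of_set ({0..1::real} \<times> standard_simplex n)) X (\<lambda>y. H (fst y, k (snd y)))"
      using k(2)
      by (intro continuous_map_top_of_set_compose [OF H(1)] continuous_on_Pair continuous_on_fst continuous_on_id
          continuous_on_compose2 [OF k(1)] continuous_on_snd) auto
    show "H (fst (0, x), k (snd (0, x))) = u x" if "x \<in> standard_simplex n" for x
      using k kd that by (simp add: H)
    show "H (fst (1, x), k (snd (1, x))) = f (w (k x))" if "x \<in> standard_simplex n" for x
      using k kd that by (simp add: H)
    show "H (fst (t, x), k (snd (t, x))) = h (t, x)" if "t \<in> {0..1}" "x \<in> simplex_boundary n" for t x
      using kS [OF that(2)] that bd k(3) by (simp add: H subset_iff)
  qed
qed

section \<open>Weak homotopy equivalences induce isomorphisms in cohomology\<close>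

lemma simplex_top_eq: "simplex_top n = top_of_set (standard_simplex n)"
  by (simp add: euclidean_product_topology)

section \<open>Facets of the standard simplex\<close>

definition delete_coord :: "nat \<Rightarrow> (nat \<Rightarrow> real) \<Rightarrow> nat \<Rightarrow> real" where
  "delete_coord i x = (\<lambda>j. if j < i then x j else x (Suc j))"

lemma simplical_face_delete_coord: "x i = 0 \<Longrightarrow> simplical_face i (delete_coord i x) = x"
  by (auto simp: simplical_face_def delete_coord_def fun_eq_iff)

lemma delete_coord_simplical_face: "delete_coord i (simplical_face i x) = x"
  by (auto simp: simplical_face_def delete_coord_def fun_eq_iff)

lemma delete_coord_in:
  assumes x: "x \<in> standard_simplex (Suc n)" and i: "i \<le> Suc n" "x i = 0"
  shows "delete_coord i x \<in> standard_simplex n"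
proof -
  let ?y = "delete_coord i x"
  have "(\<Sum>j\<le>Suc n. simplical_face i ?y j) = (\<Sum>j\<le>n. ?y j)"
  proof (cases "i = Suc n")
    case True
    then show ?thesis
      using simplical_face_sums(3) [of "Suc n" ?y] by (simp add: lessThan_Suc_atMost del: sum.atMost_Suc)
  next
    case False
    then show ?thesis
      using simplical_face_sums(1) [of i "Suc n" ?y] i by (simp del: sum.atMost_Suc)
  qed
  then have "(\<Sum>j\<le>n. ?y j) = 1"
    using x simplical_face_delete_coord [of x i, OF i(2)] by (simp add: standard_simplex_def del: sum.atMost_Suc)
  then show ?thesis
    using x i by (auto simp: standard_simplex_def delete_coord_def)
qed

lemma continuous_on_delete_coord: "continuous_on S (delete_coord i)"
proof (rule continuous_on_funI)
  fix j
  show "continuous_on S (\<lambda>x. delete_coord i x j)"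
    by (cases "j < i") (simp_all add: delete_coord_def continuous_on_coord [OF continuous_on_id])
qed

lemma delete_coord_delete_coord:
  "i < j \<Longrightarrow> delete_coord (j - 1) (delete_coord i x) = delete_coord i (delete_coord j x)"
  by (auto simp: delete_coord_def fun_eq_iff)

definition simplex_facet :: "nat \<Rightarrow> nat \<Rightarrow> (nat \<Rightarrow> real) set" where
  "simplex_facet n i = {x \<in> standard_simplex n. x i = 0}"

lemma simplex_boundary_eq: "simplex_boundary n = (\<Union>i\<le>n. simplex_facet n i)"
  by (auto simp: simplex_boundary_def simplex_facet_def)

lemma simplical_face_in_facet:
  "\<lbrakk>x \<in> standard_simplex n; i \<le> Suc n\<rbrakk> \<Longrightarrow> simplical_face i x \<in> simplex_facet (Suc n) i"
  by (simp add: simplex_facet_def simplical_face_in_standard_simplex) (simp add: simplical_face_def)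

text \<open>
  A singular simplex of \<open>weq_cylinder\<close> is a singular simplex of \<open>X\<close> together with an arbitrary
  function to \<open>Z\<close>.  This makes \<open>weq_inclusion\<close> injective without changing the homotopy type of \<open>X\<close>.
\<close>

definition indiscrete_topology :: "'a set \<Rightarrow> 'a topology" where
  "indiscrete_topology S = pullback_topology S (\<lambda>_. ()) (discrete_topology UNIV)"

lemma topspace_indiscrete_topology [simp]: "topspace (indiscrete_topology S) = S"
  by (simp add: indiscrete_topology_def topspace_pullback_topology)

lemma continuous_map_indiscrete_topology:
  "g \<in> topspace T \<rightarrow> S \<Longrightarrow> continuous_map T (indiscrete_topology S) g"
  unfolding indiscrete_topology_def
  by (rule continuous_map_pullback') (auto simp: o_def)

definition weq_cylinder :: "'z topology \<Rightarrow> 'x topology \<Rightarrow> ('x \<times> 'z) topology" where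
  "weq_cylinder Z X = prod_topology X (indiscrete_topology (topspace Z))"

definition weq_inclusion :: "('z \<Rightarrow> 'x) \<Rightarrow> 'z \<Rightarrow> 'x \<times> 'z" where
  "weq_inclusion f z = (f z, z)"

lemma continuous_map_weq_inclusion:
  assumes "continuous_map Z X f"
  shows "continuous_map Z (weq_cylinder Z X) (weq_inclusion f)"
proof -
  have "continuous_map Z (indiscrete_topology (topspace Z)) (\<lambda>z. z)"
    by (rule continuous_map_indiscrete_topology) simp
  with assms show ?thesis
    unfolding weq_cylinder_def weq_inclusion_def by (simp add: continuous_map_paired)
qed

text \<open>
  On simplices coming from \<open>Z\<close> nothing may move: then restricting a transferred cochain to \<open>Z\<close>
  gives it back exactly, not just up to cohomology.
\<close>

definition lifts_simplex ::
    "'z topology \<Rightarrow> 'x topology \<Rightarrow> ('z \<Rightarrow> 'x) \<Rightarrow> nat \<Rightarrow> ((nat \<Rightarrow> real) \<Rightarrow> 'x \<times> 'z) \<Rightarrow>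
       ((nat \<Rightarrow> real) \<Rightarrow> 'z) \<Rightarrow> (real \<times> (nat \<Rightarrow> real) \<Rightarrow> 'x) \<Rightarrow> bool" where
  "lifts_simplex Z X f n \<sigma> \<tau> h \<longleftrightarrow>
     singular_simplex n Z \<tau> \<and>
     continuous_map (top_of_set ({0..1} \<times> standard_simplex n)) X h \<and>
     (\<forall>x\<in>standard_simplex n. h (0, x) = fst (\<sigma> x) \<and> h (1, x) = f (\<tau> x)) \<and>
     (\<forall>\<tau>'. singular_simplex n Z \<tau>' \<and> \<sigma> = simplex_map n (weq_inclusion f) \<tau>' \<longrightarrow>
        \<tau> = \<tau>' \<and> (\<forall>t\<in>{0..1}. \<forall>x\<in>standard_simplex n. h (t, x) = f (\<tau>' x)))"

definition lifts_compatible ::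
    "'z topology \<Rightarrow> 'x topology \<Rightarrow> nat \<Rightarrow>
      (((nat \<Rightarrow> real) \<Rightarrow> 'x \<times> 'z) \<Rightarrow> ((nat \<Rightarrow> real) \<Rightarrow> 'z) \<times> (real \<times> (nat \<Rightarrow> real) \<Rightarrow> 'x)) \<Rightarrow>
      ((nat \<Rightarrow> real) \<Rightarrow> 'x \<times> 'z) \<Rightarrow> ((nat \<Rightarrow> real) \<Rightarrow> 'z) \<Rightarrow> (real \<times> (nat \<Rightarrow> real) \<Rightarrow> 'x) \<Rightarrow> bool" where
  "lifts_compatible Z X n L \<sigma> \<tau> h \<longleftrightarrow>
     (\<forall>i\<le>Suc n. \<forall>x\<in>standard_simplex n.
        \<tau> (simplical_face i x) = fst (L (singular_face (Suc n) i \<sigma>)) x \<and>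
        (\<forall>t\<in>{0..1}. h (t, simplical_face i x) = snd (L (singular_face (Suc n) i \<sigma>)) (t, x)))"

text \<open>The lift along a face depends only on that face as a singular simplex, whichever larger
  simplex it is seen in. Stating this without the lifts of the lower dimension gives an invariant of
  one dimension at a time, as recursive choice requires. In dimension 0 it is vacuous.\<close>

definition lifts_consistent ::
    "'z topology \<Rightarrow> 'x topology \<Rightarrow> nat \<Rightarrow>
      (((nat \<Rightarrow> real) \<Rightarrow> 'x \<times> 'z) \<Rightarrow> ((nat \<Rightarrow> real) \<Rightarrow> 'z) \<times> (real \<times> (nat \<Rightarrow> real) \<Rightarrow> 'x)) \<Rightarrow> bool" where
  "lifts_consistent Z X n L \<longleftrightarrow>
     (\<forall>m \<sigma> \<sigma>' k l. n = Suc m \<longrightarrow> singular_simplex n (weq_cylinder Z X) \<sigma> \<longrightarrow>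
        singular_simplex n (weq_cylinder Z X) \<sigma>' \<longrightarrow> k \<le> n \<longrightarrow> l \<le> n \<longrightarrow>
        singular_face n k \<sigma> = singular_face n l \<sigma>' \<longrightarrow>
        (\<forall>x\<in>standard_simplex m. fst (L \<sigma>) (simplical_face k x) = fst (L \<sigma>') (simplical_face l x) \<and>
          (\<forall>t\<in>{0..1}. snd (L \<sigma>) (t, simplical_face k x) = snd (L \<sigma>') (t, simplical_face l x))))"

lemma lifts_consistentD:
  assumes "lifts_consistent Z X (Suc m) L" "singular_simplex (Suc m) (weq_cylinder Z X) \<sigma>"
    "singular_simplex (Suc m) (weq_cylinder Z X) \<sigma>'" "k \<le> Suc m" "l \<le> Suc m"
    "singular_face (Suc m) k \<sigma> = singular_face (Suc m) l \<sigma>'" "x \<in> standard_simplex m"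
  shows "fst (L \<sigma>) (simplical_face k x) = fst (L \<sigma>') (simplical_face l x) \<and>
    (\<forall>t\<in>{0..1}. snd (L \<sigma>) (t, simplical_face k x) = snd (L \<sigma>') (t, simplical_face l x))"
  using assms unfolding lifts_consistent_def by blast

lemma simplex_map_weq_inclusion_inj:
  assumes "singular_simplex n Z \<tau>" "singular_simplex n Z \<tau>'"
    and "simplex_map n (weq_inclusion f) \<tau> = simplex_map n (weq_inclusion f) \<tau>'"
  shows "\<tau> = \<tau>'"
proof (rule extensionalityI)
  show "\<tau> \<in> extensional (standard_simplex n)" "\<tau>' \<in> extensional (standard_simplex n)"
    using assms by (auto simp: singular_simplex_def)
  show "\<tau> x = \<tau>' x" if "x \<in> standard_simplex n" for x
    using fun_cong [OF assms(3), of x] that by (simp add: simplex_map_def weq_inclusion_def)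
qed

lemma lifts_simplex_weq_inclusion:
  assumes f: "continuous_map Z X f" and \<tau>: "singular_simplex n Z \<tau>"
  shows "lifts_simplex Z X f n (simplex_map n (weq_inclusion f) \<tau>) \<tau> (\<lambda>z. f (\<tau> (snd z)))"
proof -
  have "continuous_map (top_of_set (standard_simplex n)) X (\<lambda>x. f (\<tau> x))"
    using continuous_map_compose [OF _ f, of _ \<tau>] \<tau> by (simp add: singular_simplex_def simplex_top_eq o_def)
  then have "continuous_map (top_of_set ({0..1::real} \<times> standard_simplex n)) X (\<lambda>z. f (\<tau> (snd z)))"
    by (rule continuous_map_top_of_set_compose) (auto intro: continuous_on_snd continuous_on_id)
  then show ?thesis
    unfolding lifts_simplex_def
    using \<tau> simplex_map_weq_inclusion_inj [OF \<tau>]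
    by auto (auto simp: simplex_map_def weq_inclusion_def)
qed

lemma face_weq_inclusion:
  assumes "i \<le> Suc n"
  shows "singular_face (Suc n) i (simplex_map (Suc n) (weq_inclusion f) \<tau>) =
         simplex_map n (weq_inclusion f) (singular_face (Suc n) i \<tau>)"
  using assms by (auto simp: singular_face_def simplex_map_def fun_eq_iff simplical_face_in_standard_simplex)

text \<open>For a simplex coming from \<open>Z\<close> the constant homotopy is forced, and it fits
  because the faces come from \<open>Z\<close> too. Otherwise the lifts of the faces are pasted to a
  map and a homotopy on the boundary, over which the lifting property of the simplex
  applies.\<close>

lemma lifts_simplex_exists:
  fixes Z :: "'z topology" and X :: "'x topology"
  assumes weq: "weak_homotopy_equivalence Z X f"
    and \<sigma>: "singular_simplex (Suc n) (weq_cylinder Z X) \<sigma>"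
    and L: "\<And>\<phi>. singular_simplex n (weq_cylinder Z X) \<phi> \<Longrightarrow> lifts_simplex Z X f n \<phi> (fst (L \<phi>)) (snd (L \<phi>))"
    and cons: "lifts_consistent Z X n L"
  shows "\<exists>\<tau> h. lifts_simplex Z X f (Suc n) \<sigma> \<tau> h \<and> lifts_compatible Z X n L \<sigma> \<tau> h"
proof -
  let ?\<phi> = "\<lambda>i. singular_face (Suc n) i \<sigma>"
  have \<phi>: "singular_simplex n (weq_cylinder Z X) (?\<phi> i)" if "i \<le> Suc n" for i
    using singular_simplex_singular_face [OF \<sigma>, of i] that by simp
  have fc: "continuous_map Z X f"
    by (rule weq_continuous [OF weq])
  show ?thesis
  proof (cases "\<exists>\<tau>. singular_simplex (Suc n) Z \<tau> \<and> \<sigma> = simplex_map (Suc n) (weq_inclusion f) \<tau>")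
    case True
    then obtain \<tau> where \<tau>: "singular_simplex (Suc n) Z \<tau>" and \<sigma>\<tau>: "\<sigma> = simplex_map (Suc n) (weq_inclusion f) \<tau>"
      by blast
    have "lifts_simplex Z X f (Suc n) \<sigma> \<tau> (\<lambda>z. f (\<tau> (snd z)))"
      unfolding \<sigma>\<tau> by (rule lifts_simplex_weq_inclusion [OF fc \<tau>])
    moreover have "lifts_compatible Z X n L \<sigma> \<tau> (\<lambda>z. f (\<tau> (snd z)))"
      unfolding lifts_compatible_def
    proof (intro allI impI ballI)
      fix i x
      assume i: "i \<le> Suc n" and x: "x \<in> standard_simplex n"
      have "singular_simplex n Z (singular_face (Suc n) i \<tau>)"
        using singular_simplex_singular_face [OF \<tau>, of i] i by simp
      moreover have "?\<phi> i = simplex_map n (weq_inclusion f) (singular_face (Suc n) i \<tau>)"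
        unfolding \<sigma>\<tau> by (rule face_weq_inclusion [OF i])
      ultimately have "fst (L (?\<phi> i)) = singular_face (Suc n) i \<tau>"
        "\<forall>t\<in>{0..1}. \<forall>x\<in>standard_simplex n. snd (L (?\<phi> i)) (t, x) = f (singular_face (Suc n) i \<tau> x)"
        using L [OF \<phi> [OF i]] unfolding lifts_simplex_def by blast+
      then show "\<tau> (simplical_face i x) = fst (L (?\<phi> i)) x \<and>
          (\<forall>t\<in>{0..1}. f (\<tau> (snd (t, simplical_face i x))) = snd (L (?\<phi> i)) (t, x))"
        using x by (simp add: singular_face_def)
    qed
    ultimately show ?thesis
      by blast
  next
    case False
    let ?F = "simplex_facet (Suc n)"
    let ?B = "simplex_boundary (Suc n)"
    have del: "delete_coord i x \<in> standard_simplex n" if "x \<in> ?F i" "i \<le> Suc n" for i x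
      using that delete_coord_in by (auto simp: simplex_facet_def)
    have overlap_less: "fst (L (?\<phi> i)) (delete_coord i x) = fst (L (?\<phi> j)) (delete_coord j x) \<and>
        (\<forall>t\<in>{0..1}. snd (L (?\<phi> i)) (t, delete_coord i x) = snd (L (?\<phi> j)) (t, delete_coord j x))"
      if ij: "i < j" "j \<le> Suc n" and x: "x \<in> ?F i" "x \<in> ?F j" for i j x
    proof -
      \<comment> \<open>Two distinct facets of an edge are disjoint, so an overlap forces dimension
        at least 2.\<close>
      have "n \<noteq> 0"
      proof
        assume "n = 0"
        with ij have "i = 0" "j = Suc 0"
          by auto
        with x \<open>n = 0\<close> show False
          by (simp add: simplex_facet_def standard_simplex_def)
      qed
      then obtain m where m: "n = Suc m"
        using not0_implies_Suc by blast
      \<comment> \<open>The point seen in the common face of codimension 2; the simplicial identity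
        presents this face as a face of both facets, and consistency compares the two lifts
        there.\<close>
      define y where "y = delete_coord i (delete_coord j x)"
      have xj: "delete_coord j x \<in> standard_simplex n" "delete_coord j x i = 0" "i \<le> n"
        using del [OF x(2)] x ij by (auto simp: delete_coord_def simplex_facet_def)
      have y: "y \<in> standard_simplex m"
        unfolding y_def by (rule delete_coord_in) (use xj m in auto)
      have fj: "simplical_face i y = delete_coord j x"
        unfolding y_def by (rule simplical_face_delete_coord) (rule xj)
      have "y = delete_coord (j - 1) (delete_coord i x)"
        unfolding y_def using delete_coord_delete_coord [OF ij(1)] by simp
      moreover have "delete_coord i x (j - 1) = 0"
        using x ij by (auto simp: delete_coord_def simplex_facet_def)
      ultimately have fi: "simplical_face (j - 1) y = delete_coord i x"
        using simplical_face_delete_coord by metis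
      have "singular_face (Suc m) (j - 1) (?\<phi> i) = singular_face (Suc m) i (?\<phi> j)"
        using singular_face_singular_face [of i "j - 1" m \<sigma>] ij by (simp add: m)
      moreover have "i \<le> Suc n" "j - 1 \<le> Suc m" "i \<le> Suc m"
        using ij m by auto
      ultimately have "fst (L (?\<phi> i)) (simplical_face (j - 1) y) = fst (L (?\<phi> j)) (simplical_face i y) \<and>
        (\<forall>t\<in>{0..1}. snd (L (?\<phi> i)) (t, simplical_face (j - 1) y) = snd (L (?\<phi> j)) (t, simplical_face i y))"
        using cons \<phi> [of i] \<phi> [OF ij(2)] y unfolding m by (intro lifts_consistentD)
      then show ?thesis
        unfolding fi fj .
    qed
    have overlap: "fst (L (?\<phi> i)) (delete_coord i x) = fst (L (?\<phi> j)) (delete_coord j x) \<and>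
        (\<forall>t\<in>{0..1}. snd (L (?\<phi> i)) (t, delete_coord i x) = snd (L (?\<phi> j)) (t, delete_coord j x))"
      if ij: "i \<le> Suc n" "j \<le> Suc n" and x: "x \<in> ?F i" "x \<in> ?F j" for i j x
    proof (cases i j rule: linorder_cases)
      case less
      then show ?thesis
        using overlap_less ij x by blast
    next
      case greater
      then show ?thesis
        using overlap_less [of j i x] ij x by simp
    qed simp
    have FB: "?B \<inter> ?F i = ?F i" if "i \<le> Suc n" for i
      using that by (auto simp: simplex_boundary_eq)
    have Lc: "continuous_map (top_of_set (standard_simplex n)) Z (fst (L (?\<phi> i)))"
      "continuous_map (top_of_set ({0..1} \<times> standard_simplex n)) X (snd (L (?\<phi> i)))" if "i \<le> Suc n" for i
      using L [OF \<phi> [OF that]] by (auto simp: lifts_simplex_def singular_simplex_def simplex_top_eq)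
    have Le: "snd (L (?\<phi> i)) (0, y) = fst (\<sigma> (simplical_face i y))"
      "snd (L (?\<phi> i)) (1, y) = f (fst (L (?\<phi> i)) y)"
      if "i \<le> Suc n" "y \<in> standard_simplex n" for i y
      using L [OF \<phi> [OF that(1)]] that by (auto simp: lifts_simplex_def singular_face_def)
    have clo: "closedin (top_of_set ?B) (?F i)" if "i \<le> Suc n" for i
    proof -
      have "?F i = ?B \<inter> {x. x i = 0}"
        using that by (auto simp: simplex_boundary_def simplex_facet_def)
      moreover have "closed {x :: nat \<Rightarrow> real. x i = 0}"
        by (intro closed_Collect_eq) simp_all
      ultimately show ?thesis
        by (simp add: closedin_closed_Int)
    qed
    have cover: "topspace (top_of_set ?B) \<subseteq> \<Union> (?F ` {..Suc n})"
      by (simp add: simplex_boundary_eq)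
    have vc: "continuous_map (subtopology (top_of_set ?B) (?F i)) Z (\<lambda>x. fst (L (?\<phi> i)) (delete_coord i x))"
      if "i \<in> {..Suc n}" for i
    proof -
      have i: "i \<le> Suc n"
        using that by simp
      have "continuous_map (top_of_set (?F i)) Z (\<lambda>x. fst (L (?\<phi> i)) (delete_coord i x))"
        by (rule continuous_map_top_of_set_compose [OF Lc(1) [OF i] continuous_on_delete_coord]) (use del i in blast)
      then show ?thesis
        unfolding subtopology_subtopology FB [OF i] .
    qed
    have vo: "fst (L (?\<phi> i)) (delete_coord i x) = fst (L (?\<phi> j)) (delete_coord j x)"
      if "i \<in> {..Suc n}" "j \<in> {..Suc n}" "x \<in> topspace (top_of_set ?B) \<inter> ?F i \<inter> ?F j" for i j x
      using overlap [of i j x] that by simp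
    \<comment> \<open>The boundary is a finite union of closed facets, so maps that agree on
      overlaps paste to a continuous map.\<close>
    obtain v where v: "continuous_map (top_of_set ?B) Z v"
      and vF: "\<And>x i. \<lbrakk>i \<in> {..Suc n}; x \<in> topspace (top_of_set ?B) \<inter> ?F i\<rbrakk> \<Longrightarrow> v x = fst (L (?\<phi> i)) (delete_coord i x)"
      by (rule pasting_lemma_exists_closed [OF finite_atMost cover _ vc vo]) (use clo in simp, assumption+, rule that)
    let ?IB = "{0..1::real} \<times> ?B" and ?IF = "\<lambda>i. {0..1::real} \<times> ?F i"
    have gcover: "topspace (top_of_set ?IB) \<subseteq> \<Union> (?IF ` {..Suc n})"
      by (auto simp: simplex_boundary_eq)
    have gclo: "closedin (top_of_set ?IB) (?IF i)" if "i \<in> {..Suc n}" for i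
      using clo [of i] that closedin_Times [of "{0..1::real}" "{0..1}" ?B "?F i"] by simp
    have gc: "continuous_map (subtopology (top_of_set ?IB) (?IF i)) X (\<lambda>z. snd (L (?\<phi> i)) (fst z, delete_coord i (snd z)))"
      if "i \<in> {..Suc n}" for i
    proof -
      have i: "i \<le> Suc n"
        using that by simp
      have IF: "?IB \<inter> ?IF i = ?IF i"
        using FB [OF i] by blast
      have "continuous_map (top_of_set (?IF i)) X (\<lambda>z. snd (L (?\<phi> i)) (fst z, delete_coord i (snd z)))"
      proof (rule continuous_map_top_of_set_compose [OF Lc(2) [OF i]])
        show "continuous_on (?IF i) (\<lambda>z. (fst z, delete_coord i (snd z)))"
          by (intro continuous_on_Pair continuous_on_fst continuous_on_id
              continuous_on_compose2 [OF continuous_on_delete_coord [of UNIV]] continuous_on_snd subset_UNIV)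
        show "(\<lambda>z. (fst z, delete_coord i (snd z))) \<in> ?IF i \<rightarrow> {0..1} \<times> standard_simplex n"
          using del [OF _ i] by auto
      qed
      then show ?thesis
        unfolding subtopology_subtopology IF .
    qed
    have go: "snd (L (?\<phi> i)) (fst z, delete_coord i (snd z)) = snd (L (?\<phi> j)) (fst z, delete_coord j (snd z))"
      if "i \<in> {..Suc n}" "j \<in> {..Suc n}" "z \<in> topspace (top_of_set ?IB) \<inter> ?IF i \<inter> ?IF j" for i j z
      using overlap [of i j "snd z"] that by auto
    obtain g where g: "continuous_map (top_of_set ?IB) X g"
      and gF: "\<And>z i. \<lbrakk>i \<in> {..Suc n}; z \<in> topspace (top_of_set ?IB) \<inter> ?IF i\<rbrakk>
        \<Longrightarrow> g z = snd (L (?\<phi> i)) (fst z, delete_coord i (snd z))"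
      by (rule pasting_lemma_exists_closed [OF finite_atMost gcover gclo gc go]) (assumption+, rule that)
    have g0: "g (0, x) = fst (\<sigma> x)" and g1: "g (1, x) = f (v x)" if xB: "x \<in> ?B" for x
    proof -
      obtain i where i: "i \<le> Suc n" "x \<in> ?F i"
        using xB by (auto simp: simplex_boundary_eq)
      have "simplical_face i (delete_coord i x) = x"
        using i by (simp add: simplical_face_delete_coord simplex_facet_def)
      moreover have "g (s, x) = snd (L (?\<phi> i)) (s, delete_coord i x)" if "s \<in> {0..1}" for s
        using gF [of i "(s, x)"] i xB that by simp
      moreover have "v x = fst (L (?\<phi> i)) (delete_coord i x)"
        using vF [of i x] i xB by simp
      ultimately show "g (0, x) = fst (\<sigma> x)" "g (1, x) = f (v x)"
        using Le [OF i(1) del [OF i(2,1)]] by simp_all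
    qed
    have u: "continuous_map (top_of_set (standard_simplex (Suc n))) X (\<lambda>x. fst (\<sigma> x))"
      using \<sigma> continuous_map_fst_of [of _ X "indiscrete_topology (topspace Z)" \<sigma>]
      by (simp add: singular_simplex_def simplex_top_eq weq_cylinder_def o_def)
    obtain w H where w: "continuous_map (top_of_set (standard_simplex (Suc n))) Z w"
        "\<And>x. x \<in> ?B \<Longrightarrow> w x = v x"
      and H: "continuous_map (top_of_set ({0..1::real} \<times> standard_simplex (Suc n))) X H"
        "\<And>x. x \<in> standard_simplex (Suc n) \<Longrightarrow> H (0, x) = fst (\<sigma> x)"
        "\<And>x. x \<in> standard_simplex (Suc n) \<Longrightarrow> H (1, x) = f (w x)"
        "\<And>t x. \<lbrakk>t \<in> {0..1}; x \<in> ?B\<rbrakk> \<Longrightarrow> H (t, x) = g (t, x)"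
      by (rule homotopy_lifting_simplex [OF weq v u g g0 g1]) blast+
    let ?\<tau> = "restrict w (standard_simplex (Suc n))"
    \<comment> \<open>The clause about simplices coming from \<open>Z\<close> is vacuous in this
      case.\<close>
    have "lifts_simplex Z X f (Suc n) \<sigma> ?\<tau> H"
      unfolding lifts_simplex_def
    proof (intro conjI)
      show "singular_simplex (Suc n) Z ?\<tau>"
        unfolding singular_simplex_def simplex_top_eq using continuous_map_eq [OF w(1)] by auto
    qed (use H False in auto)
    moreover have "lifts_compatible Z X n L \<sigma> ?\<tau> H"
      unfolding lifts_compatible_def
    proof (intro allI impI ballI)
      fix i x
      assume i: "i \<le> Suc n" and x: "x \<in> standard_simplex n"
      let ?x = "simplical_face i x"
      have xF: "?x \<in> ?F i"
        using x i by (rule simplical_face_in_facet)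
      then have xB: "?x \<in> ?B" "?x \<in> standard_simplex (Suc n)"
        using i by (auto simp: simplex_boundary_eq simplex_facet_def)
      have "?\<tau> ?x = fst (L (?\<phi> i)) x"
        using vF [of i ?x] i xF xB by (simp add: w delete_coord_simplical_face)
      moreover have "H (t, ?x) = snd (L (?\<phi> i)) (t, x)" if "t \<in> {0..1}" for t
        using gF [of i "(t, ?x)"] i xF xB that by (simp add: H delete_coord_simplical_face)
      ultimately show "?\<tau> ?x = fst (L (?\<phi> i)) x \<and> (\<forall>t\<in>{0..1}. H (t, ?x) = snd (L (?\<phi> i)) (t, x))"
        by blast
    qed
    ultimately show ?thesis
      by blast
  qed
qed

lemma lifts_simplex_exists_0:
  fixes Z :: "'z topology" and X :: "'x topology"
  assumes weq: "weak_homotopy_equivalence Z X f"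
    and \<sigma>: "singular_simplex 0 (weq_cylinder Z X) \<sigma>"
  shows "\<exists>\<tau> h. lifts_simplex Z X f 0 \<sigma> \<tau> h"
proof (cases "\<exists>\<tau>. singular_simplex 0 Z \<tau> \<and> \<sigma> = simplex_map 0 (weq_inclusion f) \<tau>")
  case True
  then show ?thesis
    using lifts_simplex_weq_inclusion [OF weq_continuous [OF weq]] by blast
next
  case False
  have B: "simplex_boundary 0 = {}"
    by (auto simp: simplex_boundary_def standard_simplex_0)
  have u: "continuous_map (top_of_set (standard_simplex 0)) X (\<lambda>x. fst (\<sigma> x))"
    using \<sigma> continuous_map_fst_of [of _ X "indiscrete_topology (topspace Z)" \<sigma>]
    by (simp add: singular_simplex_def simplex_top_eq weq_cylinder_def o_def)
  \<comment> \<open>The boundary of a point is empty, so arbitrary functions serve as boundary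
    data.\<close>
  obtain w H where w: "continuous_map (top_of_set (standard_simplex 0)) Z w"
    and H: "continuous_map (top_of_set ({0..1::real} \<times> standard_simplex 0)) X H"
      "\<And>x. x \<in> standard_simplex 0 \<Longrightarrow> H (0, x) = fst (\<sigma> x)"
      "\<And>x. x \<in> standard_simplex 0 \<Longrightarrow> H (1, x) = f (w x)"
    by (rule homotopy_lifting_simplex [OF weq _ u, of undefined undefined]) (auto simp: B)
  have "lifts_simplex Z X f 0 \<sigma> (restrict w (standard_simplex 0)) H"
    unfolding lifts_simplex_def
  proof (intro conjI)
    show "singular_simplex 0 Z (restrict w (standard_simplex 0))"
      unfolding singular_simplex_def simplex_top_eq using continuous_map_eq [OF w] by auto
  qed (use H False in auto)
  then show ?thesis
    by blast
qed

text \<open>Lifts are chosen dimension by dimension. \<open>P\<close> carries the consistency needed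
  for the next choice, while \<open>Q\<close> records that consecutive choices fit along
  faces.\<close>

lemma lifts_family_exists:
  fixes Z :: "'z topology" and X :: "'x topology"
  assumes weq: "weak_homotopy_equivalence Z X f"
  obtains L where
    "\<And>n \<sigma>. singular_simplex n (weq_cylinder Z X) \<sigma> \<Longrightarrow> lifts_simplex Z X f n \<sigma> (fst (L n \<sigma>)) (snd (L n \<sigma>))"
    "\<And>n \<sigma>. singular_simplex (Suc n) (weq_cylinder Z X) \<sigma> \<Longrightarrow>
       lifts_compatible Z X n (L n) \<sigma> (fst (L (Suc n) \<sigma>)) (snd (L (Suc n) \<sigma>))"
proof -
  let ?ss = "\<lambda>n. singular_simplex n (weq_cylinder Z X)"
  define P where "P = (\<lambda>n L. (\<forall>\<sigma>. ?ss n \<sigma> \<longrightarrow> lifts_simplex Z X f n \<sigma> (fst (L \<sigma>)) (snd (L \<sigma>))) \<and>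
     lifts_consistent Z X n L)"
  define Q where "Q = (\<lambda>n L L'. \<forall>\<sigma>. ?ss (Suc n) \<sigma> \<longrightarrow> lifts_compatible Z X n L \<sigma> (fst (L' \<sigma>)) (snd (L' \<sigma>)))"
  have "\<exists>L. \<forall>n. P n (L n) \<and> Q n (L n) (L (Suc n))"
  proof (rule dependent_nat_choice)
    have "\<forall>\<sigma>. \<exists>p. ?ss 0 \<sigma> \<longrightarrow> lifts_simplex Z X f 0 \<sigma> (fst p) (snd p)"
      using lifts_simplex_exists_0 [OF weq] by (metis fst_conv snd_conv)
    then obtain L where "\<forall>\<sigma>. ?ss 0 \<sigma> \<longrightarrow> lifts_simplex Z X f 0 \<sigma> (fst (L \<sigma>)) (snd (L \<sigma>))"
      by metis
    then have "P 0 L"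
      by (simp add: P_def lifts_consistent_def)
    then show "\<exists>L. P 0 L"
      by blast
  next
    fix L n
    assume L: "P n L"
    have "\<forall>\<sigma>. \<exists>p. ?ss (Suc n) \<sigma> \<longrightarrow> lifts_simplex Z X f (Suc n) \<sigma> (fst p) (snd p) \<and>
        lifts_compatible Z X n L \<sigma> (fst p) (snd p)"
      using lifts_simplex_exists [OF weq, of n _ L] L unfolding P_def by (metis fst_conv snd_conv)
    then obtain L' where L': "\<And>\<sigma>. ?ss (Suc n) \<sigma> \<Longrightarrow> lifts_simplex Z X f (Suc n) \<sigma> (fst (L' \<sigma>)) (snd (L' \<sigma>))"
      "\<And>\<sigma>. ?ss (Suc n) \<sigma> \<Longrightarrow> lifts_compatible Z X n L \<sigma> (fst (L' \<sigma>)) (snd (L' \<sigma>))"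
      by metis
    \<comment> \<open>Both sides are equal to the lift already chosen for the common face.\<close>
    have "lifts_consistent Z X (Suc n) L'"
      unfolding lifts_consistent_def
    proof (intro allI impI ballI)
      fix m \<sigma> \<sigma>' k l x
      assume "Suc n = Suc m" and ss: "?ss (Suc n) \<sigma>" "?ss (Suc n) \<sigma>'" and kl: "k \<le> Suc n" "l \<le> Suc n"
        and eq: "singular_face (Suc n) k \<sigma> = singular_face (Suc n) l \<sigma>'" and "x \<in> standard_simplex m"
      then have x: "x \<in> standard_simplex n"
        by simp
      show "fst (L' \<sigma>) (simplical_face k x) = fst (L' \<sigma>') (simplical_face l x) \<and>
          (\<forall>t\<in>{0..1}. snd (L' \<sigma>) (t, simplical_face k x) = snd (L' \<sigma>') (t, simplical_face l x))"
        using L'(2) [OF ss(1)] L'(2) [OF ss(2)] kl x eq unfolding lifts_compatible_def by simp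
    qed
    with L' have "P (Suc n) L' \<and> Q n L L'"
      by (simp add: P_def Q_def)
    then show "\<exists>L'. P (Suc n) L' \<and> Q n L L'"
      by blast
  qed
  then obtain L where "\<And>n. P n (L n)" "\<And>n. Q n (L n) (L (Suc n))"
    by blast
  then show thesis
    by (intro that [of L]) (simp_all add: P_def Q_def)
qed

text \<open>\<open>r\<close> is pullback along the map \<open>T\<close> from singular simplices of
  the cylinder to those of \<open>Z\<close>. \<open>T\<close> need not come from a continuous map,
  but it commutes with faces, so \<open>r\<close> commutes with coboundaries. It is a strict section
  of restriction to \<open>Z\<close> since simplices of \<open>Z\<close> stay fixed, and it keeps
  degrees. The natural homotopy leads from the projection to \<open>X\<close> at time 0 to
  \<open>f \<circ> T \<sigma>\<close> at time 1.\<close>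

lemma weq_cochain_transfer:
  fixes Z :: "'z topology" and X :: "'x topology"
  assumes weq: "weak_homotopy_equivalence Z X f"
  obtains r :: "('z, 'k::field) cochain \<Rightarrow> ('x \<times> 'z, 'k) cochain" where
    "\<And>c. c \<in> cochains Z \<Longrightarrow> r c \<in> cochains (weq_cylinder Z X)"
    "\<And>c. coboundary (weq_cylinder Z X) (r c) = r (coboundary Z c)"
    "\<And>c. c \<in> cochains Z \<Longrightarrow> cochain_map Z (weq_inclusion f) (r c) = c"
    "\<And>c p \<sigma>. \<forall>\<tau>. c p \<tau> = 0 \<Longrightarrow> r c p \<sigma> = 0"
    "\<And>c. c \<in> cocycles X \<Longrightarrow>
       cohomologous (weq_cylinder Z X) (r (cochain_map Z f c)) (cochain_map (weq_cylinder Z X) fst c)"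
proof -
  let ?W = "weq_cylinder Z X"
  obtain L where L: "\<And>n \<sigma>. singular_simplex n ?W \<sigma> \<Longrightarrow> lifts_simplex Z X f n \<sigma> (fst (L n \<sigma>)) (snd (L n \<sigma>))"
    and C: "\<And>n \<sigma>. singular_simplex (Suc n) ?W \<sigma> \<Longrightarrow>
       lifts_compatible Z X n (L n) \<sigma> (fst (L (Suc n) \<sigma>)) (snd (L (Suc n) \<sigma>))"
    by (rule lifts_family_exists [OF weq]) blast
  define T where "T = (\<lambda>n \<sigma>. fst (L n \<sigma>))"
  define H where "H = (\<lambda>n \<sigma>. snd (L n \<sigma>))"
  have T: "singular_simplex n Z (T n \<sigma>)" if "singular_simplex n ?W \<sigma>" for n \<sigma>
    using L [OF that] by (simp add: lifts_simplex_def T_def)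
  have face_T: "singular_face (Suc n) i (T (Suc n) \<sigma>) = T n (singular_face (Suc n) i \<sigma>)"
    if \<sigma>: "singular_simplex (Suc n) ?W \<sigma>" and i: "i \<le> Suc n" for n i \<sigma>
  proof (rule extensionalityI)
    show "singular_face (Suc n) i (T (Suc n) \<sigma>) \<in> extensional (standard_simplex n)"
      by (simp add: singular_face_def)
    have "singular_simplex n ?W (singular_face (Suc n) i \<sigma>)"
      using singular_simplex_singular_face [OF \<sigma>, of i] i by simp
    then show "T n (singular_face (Suc n) i \<sigma>) \<in> extensional (standard_simplex n)"
      using T singular_simplex_def by blast
    show "singular_face (Suc n) i (T (Suc n) \<sigma>) x = T n (singular_face (Suc n) i \<sigma>) x"
      if "x \<in> standard_simplex n" for x
      using C [OF \<sigma>] that i by (simp add: singular_face_def T_def lifts_compatible_def)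
  qed
  define r :: "('z, 'k) cochain \<Rightarrow> ('x \<times> 'z, 'k) cochain"
    where "r = (\<lambda>c n \<sigma>. if singular_simplex n ?W \<sigma> then c n (T n \<sigma>) else 0)"
  have nat: "natural_homotopy ?W X H"
    unfolding natural_homotopy_def
  proof (intro conjI allI impI)
    fix n \<sigma>
    assume "singular_simplex n ?W \<sigma>"
    then show "continuous_map (prod_topology unit_interval (simplex_top n)) X (H n \<sigma>)"
      using L [of n \<sigma>] by (simp add: lifts_simplex_def H_def simplex_top_eq)
  next
    fix n \<sigma> i and t :: real and x
    assume "singular_simplex (Suc n) ?W \<sigma>" "i \<le> Suc n" "t \<in> {0..1}" "x \<in> standard_simplex n"
    then show "H (Suc n) \<sigma> (t, simplical_face i x) = H n (singular_face (Suc n) i \<sigma>) (t, x)"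
      using C [of n \<sigma>] by (simp add: lifts_compatible_def H_def)
  qed
  show thesis
  proof
    show "r c \<in> cochains ?W" if "c \<in> cochains Z" for c
    proof -
      have "{p. \<exists>\<sigma>. r c p \<sigma> \<noteq> 0} \<subseteq> {p. \<exists>\<sigma>. c p \<sigma> \<noteq> 0}"
        by (auto simp: r_def split: if_splits)
      moreover have "finite {p. \<exists>\<sigma>. c p \<sigma> \<noteq> 0}"
        using that by (simp add: cochains_def)
      ultimately have "finite {p. \<exists>\<sigma>. r c p \<sigma> \<noteq> 0}"
        using finite_subset by blast
      then show ?thesis
        by (simp add: cochains_def) (simp add: r_def)
    qed
    show "coboundary ?W (r c) = r (coboundary Z c)" for c
    proof (intro ext)
      fix n \<sigma>
      show "coboundary ?W (r c) n \<sigma> = r (coboundary Z c) n \<sigma>"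
      proof (cases "0 < n \<and> singular_simplex n ?W \<sigma>")
        case True
        then obtain m where m: "n = Suc m"
          using gr0_implies_Suc by blast
        have "coboundary ?W (r c) n \<sigma> = (\<Sum>i\<le>n. (-1) ^ i * r c m (singular_face n i \<sigma>))"
          using True by (simp add: coboundary_def m del: sum.atMost_Suc)
        also have "\<dots> = (\<Sum>i\<le>n. (-1) ^ i * c m (singular_face n i (T n \<sigma>)))"
        proof (rule sum.cong [OF refl])
          fix i
          assume "i \<in> {..n}"
          then have "singular_simplex m ?W (singular_face n i \<sigma>)"
            using True singular_simplex_singular_face [of n ?W \<sigma> i] by (simp add: m)
          with \<open>i \<in> {..n}\<close> True show "(-1) ^ i * r c m (singular_face n i \<sigma>) = (-1) ^ i * c m (singular_face n i (T n \<sigma>))"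
            using face_T [of m \<sigma> i] by (simp add: r_def m)
        qed
        also have "\<dots> = r (coboundary Z c) n \<sigma>"
          using True T [of n \<sigma>] by (simp add: r_def coboundary_def m del: sum.atMost_Suc)
        finally show ?thesis .
      next
        case False
        then show ?thesis
          by (auto simp: coboundary_def r_def)
      qed
    qed
    show "cochain_map Z (weq_inclusion f) (r c) = c" if c: "c \<in> cochains Z" for c
    proof (intro ext)
      fix n \<tau>
      show "cochain_map Z (weq_inclusion f) (r c) n \<tau> = c n \<tau>"
      proof (cases "singular_simplex n Z \<tau>")
        case True
        let ?\<sigma> = "simplex_map n (weq_inclusion f) \<tau>"
        have \<sigma>: "singular_simplex n ?W ?\<sigma>"
          using True continuous_map_weq_inclusion [OF weq_continuous [OF weq]] by (rule singular_simplex_simplex_map)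
        then have "T n ?\<sigma> = \<tau>"
          using L [OF \<sigma>] True by (simp add: lifts_simplex_def T_def)
        with \<sigma> True show ?thesis
          by (simp add: cochain_map_def r_def)
      next
        case False
        with c show ?thesis
          by (simp add: cochain_map_def cochains_def)
      qed
    qed
    show "r c p \<sigma> = 0" if "\<forall>\<tau>. c p \<tau> = 0" for c p \<sigma>
      using that by (simp add: r_def)
    show "cohomologous ?W (r (cochain_map Z f c)) (cochain_map ?W fst c)" if c: "c \<in> cocycles X" for c
    proof -
      have "homotopy_end ?W H 0 c = cochain_map ?W fst c"
      proof (intro ext)
        fix n \<sigma>
        show "homotopy_end ?W H 0 c n \<sigma> = cochain_map ?W fst c n \<sigma>"
        proof (cases "singular_simplex n ?W \<sigma>")
          case True
          then have "restrict (\<lambda>x. H n \<sigma> (0, x)) (standard_simplex n) = simplex_map n fst \<sigma>"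
            using L [OF True] unfolding simplex_map_def by (intro restrict_ext) (simp add: lifts_simplex_def H_def)
          then show ?thesis
            by (simp add: homotopy_end_def cochain_map_def)
        qed (simp add: homotopy_end_def cochain_map_def)
      qed
      moreover have "homotopy_end ?W H 1 c = r (cochain_map Z f c)"
      proof (intro ext)
        fix n \<sigma>
        show "homotopy_end ?W H 1 c n \<sigma> = r (cochain_map Z f c) n \<sigma>"
        proof (cases "singular_simplex n ?W \<sigma>")
          case True
          then have "restrict (\<lambda>x. H n \<sigma> (1, x)) (standard_simplex n) = simplex_map n f (T n \<sigma>)"
            using L [OF True] unfolding simplex_map_def by (intro restrict_ext) (simp add: lifts_simplex_def H_def T_def)
          with True T [OF True] show ?thesis
            by (simp add: homotopy_end_def cochain_map_def r_def)
        qed (simp add: homotopy_end_def r_def)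
      qed
      ultimately show ?thesis
        using homotopy_ends_cohomologous [OF nat c] by simp
    qed
  qed
qed

lemma weq_topspace_empty:
  assumes "weak_homotopy_equivalence Z X f" "topspace Z = {}"
  shows "topspace X = {}"
  using weq_path_surj [OF assms(1)] unfolding assms(2) by blast

lemma cochains_empty:
  assumes "topspace X = {}" "c \<in> cochains X"
  shows "c = (\<lambda>_ _. 0)"
  using assms singular_simplex_empty [OF assms(1)] by (intro ext) (simp add: cochains_def)

lemma continuous_map_section:
  assumes "z0 \<in> topspace Z"
  shows "continuous_map X (weq_cylinder Z X) (\<lambda>x. (x, z0))"
proof -
  have "continuous_map X (indiscrete_topology (topspace Z)) (\<lambda>_. z0)"
    using assms by simp
  then show ?thesis
    unfolding weq_cylinder_def by (simp add: continuous_map_paired)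
qed

lemma cochain_map_ident:
  assumes "c \<in> cochains X" "\<And>x. x \<in> topspace X \<Longrightarrow> g x = x"
  shows "cochain_map X g c = c"
proof (intro ext)
  fix n \<sigma>
  show "cochain_map X g c n \<sigma> = c n \<sigma>"
    using assms simplex_map_id_gen [of n X \<sigma> g] by (simp add: cochain_map_def cochains_def)
qed

text \<open>A primitive on \<open>Z\<close> is transferred to the cylinder, where it bounds a
  cochain cohomologous to the pullback of \<open>c\<close> along the projection. Restricting along a
  section of the projection returns \<open>c\<close>. A section needs a point of \<open>Z\<close>;
  if there is none, \<open>X\<close> is empty too.\<close>

lemma weq_cohomology_inj:
  fixes Z :: "'z topology" and X :: "'x topology" and c :: "('x, 'k::field) cochain"
  assumes weq: "weak_homotopy_equivalence Z X f" and c: "c \<in> cocycles X"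
    and b: "cochain_map Z f c \<in> coboundaries Z"
  shows "c \<in> coboundaries X"
proof (cases "topspace Z = {}")
  case True
  then have "c = (\<lambda>_ _. 0)"
    using cochains_empty weq_topspace_empty [OF weq] c by (auto simp: cocycles_def)
  then show ?thesis
    by (simp add: coboundaries_eq cohomologous_refl)
next
  case False
  then obtain z0 where z0: "z0 \<in> topspace Z"
    by blast
  let ?W = "weq_cylinder Z X" and ?s = "\<lambda>x. (x, z0)"
  obtain r :: "('z, 'k) cochain \<Rightarrow> ('x \<times> 'z, 'k) cochain" where rc: "\<And>c. c \<in> cochains Z \<Longrightarrow> r c \<in> cochains ?W"
    and rd: "\<And>c. coboundary ?W (r c) = r (coboundary Z c)"
    and rh: "cohomologous ?W (r (cochain_map Z f c)) (cochain_map ?W fst c)"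
    by (rule weq_cochain_transfer [OF weq]) (use c in blast)
  obtain b' where b': "b' \<in> cochains Z" "cochain_map Z f c = coboundary Z b'"
    using b by (auto simp: coboundaries_def)
  have "cohomologous ?W (r (cochain_map Z f c)) (\<lambda>_ _. 0)"
    unfolding b'(2) rd [symmetric] cohomologous_def using rc [OF b'(1)] by (intro bexI [of _ "r b'"]) simp_all
  then have "cohomologous ?W (cochain_map ?W fst c) (\<lambda>_ _. 0)"
    using cohomologous_trans [OF cohomologous_sym [OF rh]] by blast
  from cochain_map_cohomologous [OF continuous_map_section [OF z0] this]
  have "cohomologous X (cochain_map X (fst \<circ> ?s) c) (\<lambda>_ _. 0)"
    by (simp add: cochain_map_compose [OF continuous_map_section [OF z0]] cochain_map_zero)
  moreover have "cochain_map X (fst \<circ> ?s) c = c"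
    using c by (intro cochain_map_ident) (simp_all add: cocycles_def)
  ultimately show ?thesis
    by (simp add: coboundaries_eq)
qed

text \<open>The transferred cocycle restricts to \<open>c\<close> on \<open>Z\<close>, and its
  restriction along a section is the cocycle sought on \<open>X\<close>: the section after
  \<open>f\<close> is homotopic to \<open>weq_inclusion f\<close>.\<close>

lemma weq_cohomology_surj:
  fixes Z :: "'z topology" and X :: "'x topology" and c :: "('z, 'k::field) cochain"
  assumes weq: "weak_homotopy_equivalence Z X f" and c: "c \<in> homogeneous_cocycles Z q"
  shows "\<exists>c'\<in>homogeneous_cocycles X q. cohomologous Z c (cochain_map Z f c')"
proof (cases "topspace Z = {}")
  case True
  then have "c = (\<lambda>_ _. 0)"
    using cochains_empty c by (auto simp: homogeneous_cocycles_def cocycles_def)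
  moreover have "(\<lambda>_ _. 0) \<in> homogeneous_cocycles X q"
    by (simp add: homogeneous_cocycles_def cocycles_def cochains_zero coboundary_zero)
  ultimately show ?thesis
    by (intro bexI [of _ "\<lambda>_ _. 0"]) (simp_all add: cochain_map_zero cohomologous_refl)
next
  case False
  then obtain z0 where z0: "z0 \<in> topspace Z"
    by blast
  let ?W = "weq_cylinder Z X" and ?s = "\<lambda>x. (x, z0)"
  have s: "continuous_map X ?W ?s"
    by (rule continuous_map_section [OF z0])
  have f: "continuous_map Z X f"
    by (rule weq_continuous [OF weq])
  have cc: "c \<in> cochains Z" "coboundary Z c = (\<lambda>_ _. 0)" and hom: "\<And>p \<sigma>. p \<noteq> q \<Longrightarrow> c p \<sigma> = 0"
    using c by (auto simp: homogeneous_cocycles_def cocycles_def)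
  obtain r :: "('z, 'k) cochain \<Rightarrow> ('x \<times> 'z, 'k) cochain" where rc: "\<And>c. c \<in> cochains Z \<Longrightarrow> r c \<in> cochains ?W"
    and rd: "\<And>c. coboundary ?W (r c) = r (coboundary Z c)"
    and ri: "\<And>c. c \<in> cochains Z \<Longrightarrow> cochain_map Z (weq_inclusion f) (r c) = c"
    and r0: "\<And>c p \<sigma>. \<forall>\<tau>. c p \<tau> = 0 \<Longrightarrow> r c p \<sigma> = 0"
    by (rule weq_cochain_transfer [OF weq]) blast
  have "coboundary ?W (r c) = (\<lambda>_ _. 0)"
    unfolding rd cc(2) by (intro ext r0) simp
  then have rcoc: "r c \<in> homogeneous_cocycles ?W q"
    using rc [OF cc(1)] r0 hom by (simp add: homogeneous_cocycles_def cocycles_def)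
  have "homotopic_with (\<lambda>_. True) Z ?W (weq_inclusion f) (?s \<circ> f)"
    unfolding homotopic_with_def
  proof (intro exI conjI)
    \<comment> \<open>The second coordinate may jump at time 0, because every function into an
      indiscrete space is continuous.\<close>
    let ?h = "\<lambda>y :: real \<times> _. (f (snd y), if fst y = 0 then snd y else z0)"
    have "continuous_map (prod_topology unit_interval Z) X (\<lambda>y. f (snd y))"
      using continuous_map_compose [OF continuous_map_snd f] by (simp add: o_def)
    moreover have "continuous_map (prod_topology unit_interval Z) (indiscrete_topology (topspace Z))
        (\<lambda>y. if fst y = 0 then snd y else z0)"
      using z0 by (intro continuous_map_indiscrete_topology) auto
    ultimately show "continuous_map (prod_topology unit_interval Z) ?W ?h"
      unfolding weq_cylinder_def by (simp add: continuous_map_paired)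
  qed (auto simp: weq_inclusion_def)
  moreover have "r c \<in> cocycles ?W"
    using rcoc by (simp add: homogeneous_cocycles_def)
  ultimately have "cohomologous Z (cochain_map Z (weq_inclusion f) (r c)) (cochain_map Z (?s \<circ> f) (r c))"
    by (rule homotopic_imp_cohomologous)
  then have "cohomologous Z c (cochain_map Z f (cochain_map X ?s (r c)))"
    by (simp add: ri [OF cc(1)] cochain_map_compose [OF f])
  then show ?thesis
    using cochain_map_homogeneous_cocycles [OF s rcoc] by blast
qed

section \<open>Stability of the persistent cup-length\<close>

text \<open>By homotopy invariance, pulling a class back along \<open>T\<close> is the same as
  pulling it back along \<open>q\<close>, \<open>T'\<close> and \<open>p\<close> in turn.\<close>

lemma map_cup_length_le_factor:
  assumes T: "continuous_map A B T" and T': "continuous_map A' B' T'"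
    and p: "continuous_map A A' p" and q: "continuous_map B' B q"
    and hom: "homotopic_with (\<lambda>_. True) A B T (q \<circ> T' \<circ> p)"
  shows "map_cup_length TYPE('k::field) A B T \<le> map_cup_length TYPE('k) A' B' T'"
proof (rule map_cup_length_le [OF T T' p])
  fix n and c :: "(_, 'k) cochain"
  assume c: "c \<in> homogeneous_cocycles B n"
  have "cochain_map A p (cochain_map A' T' (cochain_map B' q c)) = cochain_map A (q \<circ> T' \<circ> p) c"
    by (simp add: cochain_map_compose [OF T'] cochain_map_compose [OF p] o_assoc)
  moreover have "cohomologous A (cochain_map A T c) (cochain_map A (q \<circ> T' \<circ> p) c)"
  proof (rule homotopic_imp_cohomologous [OF hom])
    show "c \<in> cocycles B"
      using c by (simp add: homogeneous_cocycles_def)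
  qed
  ultimately show "\<exists>c'\<in>homogeneous_cocycles B' n.
      cohomologous A (cochain_map A T c) (cochain_map A p (cochain_map A' T' c'))"
    using cochain_map_homogeneous_cocycles [OF q c] by (intro bexI [of _ "cochain_map B' q c"]) simp_all
qed

text \<open>The two inequalities use different halves of the isomorphism: surjectivity at
  \<open>b\<close> replaces cocycles on \<open>Z\<close> by cocycles on \<open>X\<close>, and
  injectivity at \<open>a\<close> detects that a product on \<open>X\<close> survives on
  \<open>Z\<close>.\<close>

lemma persistent_cup_length_weq:
  fixes Z :: "'a pspace" and X :: "'b pspace"
  assumes Z: "persistent_space Z" and X: "persistent_space X" and \<alpha>: "natural_transformation Z X \<alpha>"
    and weq: "\<And>t. weak_homotopy_equivalence (Sp Z t) (Sp X t) (\<alpha> t)" and ab: "a \<le> b"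
  shows "persistent_cup_length TYPE('k::field) Z a b = persistent_cup_length TYPE('k) X a b"
proof -
  have TZ: "continuous_map (Sp Z a) (Sp Z b) (Tr Z a b)" and TX: "continuous_map (Sp X a) (Sp X b) (Tr X a b)"
    using Z X ab by (simp_all add: persistent_space_def)
  have \<alpha>c: "continuous_map (Sp Z t) (Sp X t) (\<alpha> t)" for t
    by (rule weq_continuous [OF weq])
  have comm: "\<alpha> b (Tr Z a b x) = Tr X a b (\<alpha> a x)" if "x \<in> topspace (Sp Z a)" for x
    using \<alpha> ab that by (simp add: natural_transformation_def shift_map_def)
  have "map_cup_length TYPE('k) (Sp Z a) (Sp Z b) (Tr Z a b) \<le> map_cup_length TYPE('k) (Sp X a) (Sp X b) (Tr X a b)"
  proof (rule map_cup_length_le [OF TZ TX \<alpha>c])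
    fix q and c :: "(_, 'k) cochain"
    assume "c \<in> homogeneous_cocycles (Sp Z b) q"
    then obtain c' where c': "c' \<in> homogeneous_cocycles (Sp X b) q"
      and "cohomologous (Sp Z b) c (cochain_map (Sp Z b) (\<alpha> b) c')"
      using weq_cohomology_surj [OF weq] by blast
    then have "cohomologous (Sp Z a) (cochain_map (Sp Z a) (Tr Z a b) c)
        (cochain_map (Sp Z a) (Tr Z a b) (cochain_map (Sp Z b) (\<alpha> b) c'))"
      by (intro cochain_map_cohomologous [OF TZ])
    also have "cochain_map (Sp Z a) (Tr Z a b) (cochain_map (Sp Z b) (\<alpha> b) c') =
        cochain_map (Sp Z a) (\<alpha> a) (cochain_map (Sp X a) (Tr X a b) c')"
      unfolding cochain_map_compose [OF TZ] cochain_map_compose [OF \<alpha>c]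
      by (rule cochain_map_cong) (simp add: comm)
    finally show "\<exists>c'\<in>homogeneous_cocycles (Sp X b) q. cohomologous (Sp Z a) (cochain_map (Sp Z a) (Tr Z a b) c)
        (cochain_map (Sp Z a) (\<alpha> a) (cochain_map (Sp X a) (Tr X a b) c'))"
      using c' by blast
  qed
  moreover have "map_cup_length TYPE('k) (Sp X a) (Sp X b) (Tr X a b) \<le> map_cup_length TYPE('k) (Sp Z a) (Sp Z b) (Tr Z a b)"
    by (rule map_cup_length_le_inj [OF TX TZ \<alpha>c \<alpha>c]) (use comm weq_cohomology_inj [OF weq] in auto)
  ultimately show ?thesis
    by (simp add: persistent_cup_length_eq [OF TZ] persistent_cup_length_eq [OF TX])
qed

lemma persistent_cup_length_weakly_equivalent:
  fixes U :: "'u itself" and X :: "'a pspace" and Y :: "'b pspace"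
  assumes "persistent_space X" "persistent_space Y" "weakly_equivalent U X Y" "a \<le> b"
  shows "persistent_cup_length TYPE('k::field) X a b = persistent_cup_length TYPE('k) Y a b"
proof -
  obtain Z :: "'u pspace" and \<alpha> \<beta> where "persistent_space Z" "natural_transformation Z X \<alpha>" "natural_transformation Z Y \<beta>"
    "\<And>t. weak_homotopy_equivalence (Sp Z t) (Sp X t) (\<alpha> t)"
    "\<And>t. weak_homotopy_equivalence (Sp Z t) (Sp Y t) (\<beta> t)"
    using assms(3) unfolding weakly_equivalent_def by blast
  then show ?thesis
    using assms persistent_cup_length_weq by metis
qed

text \<open>The criterion is used with \<open>s = a - \<epsilon>\<close> and \<open>t = b\<close>:
  the transition map over the enlarged interval factors, up to homotopy, through the transition map
  of \<open>X\<close> from \<open>a\<close> to \<open>b\<close>.\<close>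

lemma persistent_cup_length_shift:
  fixes X :: "'a pspace" and Y :: "'b pspace"
  assumes X: "\<And>s t. s \<le> t \<Longrightarrow> continuous_map (Sp X s) (Sp X t) (Tr X s t)"
    and Y: "\<And>s t. s \<le> t \<Longrightarrow> continuous_map (Sp Y s) (Sp Y t) (Tr Y s t)"
    and \<phi>: "\<And>t. continuous_map (Sp X t) (Sp Y (t + \<epsilon>)) (\<phi> t)"
    and \<psi>: "\<And>t. continuous_map (Sp Y t) (Sp X (t + \<epsilon>)) (\<psi> t)"
    and hom: "\<And>s t. s + \<epsilon> \<le> t \<Longrightarrow> homotopic_with (\<lambda>_. True) (Sp Y s) (Sp Y (t + \<epsilon>)) (Tr Y s (t + \<epsilon>))
       (\<phi> t \<circ> Tr X (s + \<epsilon>) t \<circ> \<psi> s)"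
    and \<epsilon>: "0 \<le> \<epsilon>" and ab: "a \<le> b"
  shows "persistent_cup_length TYPE('k::field) Y (a - \<epsilon>) (b + \<epsilon>) \<le> persistent_cup_length TYPE('k) X a b"
proof -
  have TX: "continuous_map (Sp X a) (Sp X b) (Tr X a b)"
    and TY: "continuous_map (Sp Y (a - \<epsilon>)) (Sp Y (b + \<epsilon>)) (Tr Y (a - \<epsilon>) (b + \<epsilon>))"
    using X Y ab \<epsilon> by simp_all
  have "continuous_map (Sp Y (a - \<epsilon>)) (Sp X a) (\<psi> (a - \<epsilon>))"
    using \<psi> [of "a - \<epsilon>"] by simp
  moreover have "homotopic_with (\<lambda>_. True) (Sp Y (a - \<epsilon>)) (Sp Y (b + \<epsilon>)) (Tr Y (a - \<epsilon>) (b + \<epsilon>))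
      (\<phi> b \<circ> Tr X a b \<circ> \<psi> (a - \<epsilon>))"
    using hom [of "a - \<epsilon>" b] ab by simp
  ultimately show ?thesis
    unfolding persistent_cup_length_eq [OF TX] persistent_cup_length_eq [OF TY]
    using map_cup_length_le_factor [OF TY TX _ \<phi>] by blast
qed

text \<open>By naturality of \<phi>, the composite through \<open>X\<close> is the transition map of
  \<open>Y\<close> after \<open>\<phi> \<circ> \<psi>\<close>, which is itself the transition by
  twice \<epsilon>.\<close>

lemma persistent_cup_length_interleaved:
  fixes X :: "'a pspace" and Y :: "'b pspace"
  assumes X: "persistent_space X" and Y: "persistent_space Y"
    and \<phi>: "shift_map \<epsilon> X Y \<phi>" and \<psi>: "shift_map \<epsilon> Y X \<psi>"
    and \<phi>\<psi>: "\<And>t y. y \<in> topspace (Sp Y t) \<Longrightarrow> \<phi> (t + \<epsilon>) (\<psi> t y) = Tr Y t (t + 2 * \<epsilon>) y"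
    and \<epsilon>: "0 \<le> \<epsilon>" and ab: "a \<le> b"
  shows "persistent_cup_length TYPE('k::field) Y (a - \<epsilon>) (b + \<epsilon>) \<le> persistent_cup_length TYPE('k) X a b"
proof (rule persistent_cup_length_shift [where \<phi> = \<phi> and \<psi> = \<psi>])
  fix s t :: real
  assume st: "s + \<epsilon> \<le> t"
  have "Tr Y s (t + \<epsilon>) y = (\<phi> t \<circ> Tr X (s + \<epsilon>) t \<circ> \<psi> s) y" if y: "y \<in> topspace (Sp Y s)" for y
  proof -
    have "\<psi> s y \<in> topspace (Sp X (s + \<epsilon>))"
      using \<psi> y by (auto simp: shift_map_def continuous_map_def)
    then have "\<phi> t (Tr X (s + \<epsilon>) t (\<psi> s y)) = Tr Y (s + \<epsilon> + \<epsilon>) (t + \<epsilon>) (\<phi> (s + \<epsilon>) (\<psi> s y))"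
      using \<phi> st by (simp add: shift_map_def)
    also have "\<dots> = Tr Y (s + 2 * \<epsilon>) (t + \<epsilon>) (Tr Y s (s + 2 * \<epsilon>) y)"
      using \<phi>\<psi> [OF y] by (simp add: add.assoc)
    also have "\<dots> = Tr Y s (t + \<epsilon>) y"
      using Y y \<epsilon> st by (simp add: persistent_space_def)
    finally show ?thesis
      by simp
  qed
  moreover have "continuous_map (Sp Y s) (Sp Y (t + \<epsilon>)) (Tr Y s (t + \<epsilon>))"
    using Y st \<epsilon> by (simp add: persistent_space_def)
  ultimately show "homotopic_with (\<lambda>_. True) (Sp Y s) (Sp Y (t + \<epsilon>)) (Tr Y s (t + \<epsilon>)) (\<phi> t \<circ> Tr X (s + \<epsilon>) t \<circ> \<psi> s)"
    by (intro homotopic_with_equal) auto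
qed (use assms in \<open>auto simp: shift_map_def persistent_space_def\<close>)

lemma eroded_interleaved:
  assumes X: "persistent_space X" and Y: "persistent_space Y" and "interleaved \<epsilon> X Y" "0 \<le> \<epsilon>"
  shows "eroded \<epsilon> (persistent_cup_length TYPE('k::field) X) (persistent_cup_length TYPE('k) Y)"
proof -
  obtain \<phi> \<psi> where "shift_map \<epsilon> X Y \<phi>" "shift_map \<epsilon> Y X \<psi>"
    and "\<And>t x. x \<in> topspace (Sp X t) \<Longrightarrow> \<psi> (t + \<epsilon>) (\<phi> t x) = Tr X t (t + 2 * \<epsilon>) x"
    and "\<And>t y. y \<in> topspace (Sp Y t) \<Longrightarrow> \<phi> (t + \<epsilon>) (\<psi> t y) = Tr Y t (t + 2 * \<epsilon>) y"
    using assms(3) unfolding interleaved_def by blast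
  then show ?thesis
    unfolding eroded_def
    using persistent_cup_length_interleaved [OF X Y _ _ _ assms(4), of \<phi> \<psi>]
      persistent_cup_length_interleaved [OF Y X _ _ _ assms(4), of \<psi> \<phi>] by blast
qed

lemma erosion_distance_le: "\<lbrakk>0 \<le> \<epsilon>; eroded \<epsilon> J1 J2\<rbrakk> \<Longrightarrow> erosion_distance J1 J2 \<le> ereal \<epsilon>"
  unfolding erosion_distance_def by (rule Inf_lower) auto

lemma erosion_distance_le_homotopy_interleaving_distance:
  fixes X :: "'a pspace" and Y :: "'b pspace"
  assumes X: "persistent_space X" and Y: "persistent_space Y"
  shows "erosion_distance (persistent_cup_length TYPE('k::field) X) (persistent_cup_length TYPE('k) Y)
           \<le> homotopy_interleaving_distance TYPE('u) X Y"
  unfolding homotopy_interleaving_distance_def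
proof (rule Inf_greatest, clarify)
  fix X' Y' :: "'u pspace"
  assume X': "persistent_space X'" and Y': "persistent_space Y'"
    and XX': "weakly_equivalent TYPE('u) X' X" and YY': "weakly_equivalent TYPE('u) Y' Y"
  show "erosion_distance (persistent_cup_length TYPE('k) X) (persistent_cup_length TYPE('k) Y)
      \<le> interleaving_distance X' Y'"
    unfolding interleaving_distance_def
  proof (rule Inf_greatest, clarify)
    fix \<epsilon> :: real
    assume \<epsilon>: "0 \<le> \<epsilon>" and il: "interleaved \<epsilon> X' Y'"
    have "eroded \<epsilon> (persistent_cup_length TYPE('k) X) (persistent_cup_length TYPE('k) Y)"
      unfolding eroded_def
    proof (intro allI impI)
      fix a b :: real
      assume ab: "a \<le> b"
      \<comment> \<open>Invariance under weak equivalence is stated for ordered end points, and it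
        is applied to the enlarged interval as well.\<close>
      with \<epsilon> have "a - \<epsilon> \<le> b + \<epsilon>"
        by linarith
      with ab show "persistent_cup_length TYPE('k) Y (a - \<epsilon>) (b + \<epsilon>) \<le> persistent_cup_length TYPE('k) X a b \<and>
          persistent_cup_length TYPE('k) X (a - \<epsilon>) (b + \<epsilon>) \<le> persistent_cup_length TYPE('k) Y a b"
        using eroded_interleaved [OF X' Y' il \<epsilon>, where 'k = 'k]
        by (simp add: eroded_def
            persistent_cup_length_weakly_equivalent [OF X' X XX', where 'k = 'k, symmetric]
            persistent_cup_length_weakly_equivalent [OF Y' Y YY', where 'k = 'k, symmetric])
    qed
    then show "erosion_distance (persistent_cup_length TYPE('k) X) (persistent_cup_length TYPE('k) Y) \<le> ereal \<epsilon>"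
      by (rule erosion_distance_le [OF \<epsilon>])
  qed
qed

section \<open>Geometric realizations\<close>

abbreviation simplex_space :: "'a set \<Rightarrow> ('a \<Rightarrow> real) topology" where
  "simplex_space S \<equiv> subtopology (powertop_real UNIV) (closed_simplex S)"

lemma topspace_geometric_realization: "topspace (geometric_realization \<K>) = (\<Union>S\<in>\<K>. closed_simplex S)"
proof -
  have "openin (simplex_space S) ((\<Union>S\<in>\<K>. closed_simplex S) \<inter> closed_simplex S)" if "S \<in> \<K>" for S
  proof -
    have "(\<Union>S\<in>\<K>. closed_simplex S) \<inter> closed_simplex S = topspace (simplex_space S)"
      using that by auto
    then show ?thesis
      by (metis openin_topspace)
  qed
  then have "openin (geometric_realization \<K>) (\<Union>S\<in>\<K>. closed_simplex S)"
    by (simp add: openin_geometric_realization realization_open_def)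
  moreover have "U \<subseteq> (\<Union>S\<in>\<K>. closed_simplex S)" if "openin (geometric_realization \<K>) U" for U
    using that by (simp add: openin_geometric_realization realization_open_def)
  ultimately show ?thesis
    unfolding topspace_def by blast
qed

lemma continuous_map_closed_simplex_inclusion:
  assumes "S \<in> \<K>"
  shows "continuous_map (simplex_space S) (geometric_realization \<K>) (\<lambda>\<alpha>. \<alpha>)"
  unfolding continuous_map_def
proof (intro conjI allI impI)
  show "(\<lambda>\<alpha>. \<alpha>) \<in> topspace (simplex_space S) \<rightarrow> topspace (geometric_realization \<K>)"
    using assms by (auto simp: topspace_geometric_realization)
  fix U
  assume "openin (geometric_realization \<K>) U"
  then have "openin (simplex_space S) (U \<inter> closed_simplex S)"
    using assms by (simp add: openin_geometric_realization realization_open_def)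
  moreover have "U \<inter> closed_simplex S = {\<alpha> \<in> topspace (simplex_space S). \<alpha> \<in> U}"
    by auto
  ultimately show "openin (simplex_space S) {\<alpha> \<in> topspace (simplex_space S). \<alpha> \<in> U}"
    by simp
qed

text \<open>The weak topology is the quotient topology from the disjoint union of the closed
  simplices. In this form it can be multiplied by the unit interval.\<close>

lemma quotient_map_geometric_realization:
  "quotient_map (sum_topology simplex_space \<K>) (geometric_realization \<K>) snd"
  unfolding quotient_map_def
proof (intro conjI allI impI)
  show "snd ` topspace (sum_topology simplex_space \<K>) = topspace (geometric_realization \<K>)"
    by (force simp: topspace_geometric_realization)
  fix U
  assume U: "U \<subseteq> topspace (geometric_realization \<K>)"
  have "{\<alpha>. (S, \<alpha>) \<in> {x \<in> topspace (sum_topology simplex_space \<K>). snd x \<in> U}} = U \<inter> closed_simplex S"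
    if "S \<in> \<K>" for S
    using that by auto
  then show "openin (sum_topology simplex_space \<K>) {x \<in> topspace (sum_topology simplex_space \<K>). snd x \<in> U} \<longleftrightarrow>
      openin (geometric_realization \<K>) U"
    using U unfolding openin_sum_topology openin_geometric_realization realization_open_def
      topspace_geometric_realization
    by auto
qed

lemma continuous_map_snd_sum_topology:
  assumes "S \<in> \<K>"
  shows "continuous_map (subtopology (sum_topology simplex_space \<K>) ({S} \<times> closed_simplex S)) (simplex_space S) snd"
  unfolding continuous_map_def
proof (intro conjI allI impI)
  show "snd \<in> topspace (subtopology (sum_topology simplex_space \<K>) ({S} \<times> closed_simplex S)) \<rightarrow> topspace (simplex_space S)"
    by auto
  fix U
  assume U: "openin (simplex_space S) U"
  then have Us: "U \<subseteq> closed_simplex S"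
    using openin_subset by fastforce
  have "{\<alpha>. (T, \<alpha>) \<in> {S} \<times> U} = (if T = S then U else {})" for T
    by auto
  then have "openin (sum_topology simplex_space \<K>) ({S} \<times> U)"
    using U Us assms by (auto simp: openin_sum_topology)
  moreover have "{x \<in> topspace (subtopology (sum_topology simplex_space \<K>) ({S} \<times> closed_simplex S)). snd x \<in> U} =
      ({S} \<times> U) \<inter> ({S} \<times> closed_simplex S)"
    using Us assms by auto
  ultimately show "openin (subtopology (sum_topology simplex_space \<K>) ({S} \<times> closed_simplex S))
      {x \<in> topspace (subtopology (sum_topology simplex_space \<K>) ({S} \<times> closed_simplex S)). snd x \<in> U}"
    by (simp only: openin_subtopology_Int)
qed

lemma openin_simplex_slice:
  assumes S: "S \<in> \<K>"
  shows "openin (sum_topology simplex_space \<K>) ({S} \<times> closed_simplex S)"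
proof -
  have "{\<alpha>. (T, \<alpha>) \<in> {S} \<times> closed_simplex S} = (if T = S then topspace (simplex_space S) else {})" for T
    by auto
  then have "openin (simplex_space T) {\<alpha>. (T, \<alpha>) \<in> {S} \<times> closed_simplex S}" for T
    using openin_topspace openin_empty by metis
  then show ?thesis
    using S by (auto simp: openin_sum_topology)
qed

text \<open>A homotopy may be checked on one closed simplex at a time: multiplying a quotient map by
  the locally compact Hausdorff unit interval gives a quotient map, and in the disjoint union the
  simplices are open.\<close>

lemma continuous_map_prod_geometric_realization:
  assumes h: "\<And>S. S \<in> \<K> \<Longrightarrow> continuous_map (prod_topology unit_interval (simplex_space S)) Y h"
  shows "continuous_map (prod_topology unit_interval (geometric_realization \<K>)) Y h"
proof -
  let ?Q = "sum_topology simplex_space \<K>"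
  let ?T = "\<lambda>S. {0..1::real} \<times> ({S} \<times> closed_simplex S)"
  have "locally_compact_space unit_interval"
    by (intro compact_imp_locally_compact_space) (simp add: compact_space_subtopology)
  moreover have "Hausdorff_space unit_interval"
    by (simp add: Hausdorff_space_subtopology)
  ultimately have q: "quotient_map (prod_topology unit_interval ?Q) (prod_topology unit_interval (geometric_realization \<K>))
      (\<lambda>(t, z). (t, snd z))"
    by (intro quotient_map_prod_right quotient_map_geometric_realization disjI1)
  have "continuous_map (prod_topology unit_interval ?Q) Y (h \<circ> (\<lambda>(t, z). (t, snd z)))"
  proof (rule pasting_lemma [of \<K> _ ?T _ "\<lambda>_. h \<circ> (\<lambda>(t, z). (t, snd z))"])
    fix S
    assume S: "S \<in> \<K>"
    have "openin ?Q ({S} \<times> closed_simplex S)"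
      by (rule openin_simplex_slice [OF S])
    moreover have "openin unit_interval {0..1}"
      using openin_topspace [of unit_interval] by simp
    ultimately show "openin (prod_topology unit_interval ?Q) (?T S)"
      by (simp add: openin_prod_Times_iff)
    have "subtopology (prod_topology unit_interval ?Q) (?T S) =
        prod_topology unit_interval (subtopology ?Q ({S} \<times> closed_simplex S))"
      by (simp add: subtopology_Times subtopology_subtopology)
    moreover have "continuous_map (prod_topology unit_interval (subtopology ?Q ({S} \<times> closed_simplex S)))
        (prod_topology unit_interval (simplex_space S)) (\<lambda>(t, z). (t, snd z))"
      using continuous_map_prod_top [of unit_interval "subtopology ?Q ({S} \<times> closed_simplex S)" unit_interval
          "simplex_space S" id snd] continuous_map_snd_sum_topology [OF S] by simp
    ultimately show "continuous_map (subtopology (prod_topology unit_interval ?Q) (?T S)) Y (h \<circ> (\<lambda>(t, z). (t, snd z)))"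
      using continuous_map_compose [OF _ h [OF S]] by metis
  next
    fix x
    assume "x \<in> topspace (prod_topology unit_interval ?Q)"
    then show "\<exists>S. S \<in> \<K> \<and> x \<in> ?T S \<and> (h \<circ> (\<lambda>(t, z). (t, snd z))) x = (h \<circ> (\<lambda>(t, z). (t, snd z))) x"
      by auto
  qed simp
  then show ?thesis
    by (rule continuous_compose_quotient_map [OF q])
qed

lemma continuous_map_from_geometric_realization:
  assumes "\<And>S. S \<in> \<K> \<Longrightarrow> continuous_map (simplex_space S) Y g"
  shows "continuous_map (geometric_realization \<K>) Y g"
proof (rule continuous_compose_quotient_map [OF quotient_map_geometric_realization])
  let ?Q = "sum_topology simplex_space \<K>"
  show "continuous_map ?Q Y (g \<circ> snd)"
  proof (rule pasting_lemma [of \<K> _ "\<lambda>S. {S} \<times> closed_simplex S" _ "\<lambda>_. g \<circ> snd"])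
    fix S
    assume S: "S \<in> \<K>"
    show "openin ?Q ({S} \<times> closed_simplex S)"
      by (rule openin_simplex_slice [OF S])
    show "continuous_map (subtopology ?Q ({S} \<times> closed_simplex S)) Y (g \<circ> snd)"
      using continuous_map_compose [OF continuous_map_snd_sum_topology [OF S] assms [OF S]] .
  qed auto
qed

lemma closed_simplex_mono:
  assumes "\<alpha> \<in> closed_simplex S" "S \<subseteq> T" "finite T"
  shows "\<alpha> \<in> closed_simplex T"
proof -
  have "sum \<alpha> T = sum \<alpha> S"
    using assms by (intro sum.mono_neutral_right) (auto simp: closed_simplex_def)
  moreover have "0 \<le> \<alpha> x" for x
    using assms by (cases "x \<in> S") (auto simp: closed_simplex_def)
  ultimately show ?thesis
    using assms by (auto simp: closed_simplex_def)
qed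

lemma closed_simplex_convex:
  assumes "\<alpha> \<in> closed_simplex S" "\<beta> \<in> closed_simplex S" "t \<in> {0..1}"
  shows "(\<lambda>x. (1 - t) * \<alpha> x + t * \<beta> x) \<in> closed_simplex S"
proof -
  have "(\<Sum>x\<in>S. (1 - t) * \<alpha> x + t * \<beta> x) = (1 - t) * sum \<alpha> S + t * sum \<beta> S"
    by (simp add: sum.distrib sum_distrib_left)
  then show ?thesis
    using assms by (auto simp: closed_simplex_def)
qed

text \<open>This is contiguity: a point and its image lie in the common closed simplex on
  \<open>S \<union> S'\<close>, which contains the segment between them.\<close>

lemma straight_line_homotopy:
  assumes g: "\<And>S. S \<in> \<K> \<Longrightarrow> \<exists>S'. S \<union> S' \<in> \<L> \<and> finite (S \<union> S') \<and> continuous_map (simplex_space S) (simplex_space S') g"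
  shows "homotopic_with (\<lambda>_. True) (geometric_realization \<K>) (geometric_realization \<L>) (\<lambda>\<alpha>. \<alpha>) g"
  unfolding homotopic_with_def
proof (intro exI conjI)
  let ?h = "\<lambda>z. (\<lambda>x. (1 - fst z) * snd z x + fst z * g (snd z) x)"
  show "continuous_map (prod_topology unit_interval (geometric_realization \<K>)) (geometric_realization \<L>) ?h"
  proof (rule continuous_map_prod_geometric_realization)
    fix S
    assume "S \<in> \<K>"
    then obtain S' where S': "S \<union> S' \<in> \<L>" "finite (S \<union> S')"
      and gc: "continuous_map (simplex_space S) (simplex_space S') g"
      using g by blast
    let ?P = "prod_topology unit_interval (simplex_space S)"
    have gS: "g \<alpha> \<in> closed_simplex S'" if "\<alpha> \<in> closed_simplex S" for \<alpha>
      using gc that by (auto simp: continuous_map_def)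
    have fst: "continuous_map ?P euclideanreal fst"
      using continuous_map_fst [of unit_interval "simplex_space S"] continuous_map_in_subtopology by blast
    have "continuous_map ?P (powertop_real UNIV) snd"
      using continuous_map_snd [of unit_interval "simplex_space S"] continuous_map_in_subtopology by blast
    then have snd: "continuous_map ?P euclideanreal (\<lambda>z. snd z x)" for x
      by (simp add: continuous_map_componentwise_UNIV)
    have "continuous_map ?P (simplex_space S') (g \<circ> snd)"
      using continuous_map_compose [OF continuous_map_snd gc] .
    then have "continuous_map ?P (powertop_real UNIV) (\<lambda>z. g (snd z))"
      by (simp add: continuous_map_in_subtopology o_def)
    then have gsnd: "continuous_map ?P euclideanreal (\<lambda>z. g (snd z) x)" for x
      by (simp add: continuous_map_componentwise_UNIV)
    have "continuous_map ?P (powertop_real UNIV) ?h"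
      unfolding continuous_map_componentwise_UNIV
      by (intro allI continuous_map_add continuous_map_real_mult continuous_map_diff fst snd gsnd) simp
    moreover have "?h z \<in> closed_simplex (S \<union> S')" if "z \<in> topspace ?P" for z
    proof (rule closed_simplex_convex)
      show "snd z \<in> closed_simplex (S \<union> S')"
        by (rule closed_simplex_mono [of _ S]) (use that S' in auto)
      show "g (snd z) \<in> closed_simplex (S \<union> S')"
        by (rule closed_simplex_mono [of _ S']) (use that S' gS in auto)
    qed (use that in auto)
    ultimately have "continuous_map ?P (simplex_space (S \<union> S')) ?h"
      by (auto simp: continuous_map_in_subtopology)
    from continuous_map_compose [OF this continuous_map_closed_simplex_inclusion [OF S'(1)]]
    show "continuous_map ?P (geometric_realization \<L>) ?h"
      by (simp add: o_def)
  qed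
qed auto

text \<open>The realization of the simplicial map given by \<phi> on vertices. Summing over the
  support of \<alpha> makes the value independent of the simplex in which \<alpha> is
  viewed.\<close>

definition push_coords :: "('a \<Rightarrow> 'b) \<Rightarrow> ('a \<Rightarrow> real) \<Rightarrow> 'b \<Rightarrow> real" where
  "push_coords \<phi> \<alpha> y = (\<Sum>x | \<alpha> x \<noteq> 0 \<and> \<phi> x = y. \<alpha> x)"

lemma push_coords_eq:
  assumes "finite S" "\<alpha> \<in> closed_simplex S"
  shows "push_coords \<phi> \<alpha> y = (\<Sum>x | x \<in> S \<and> \<phi> x = y. \<alpha> x)"
  unfolding push_coords_def
  by (rule sum.mono_neutral_left) (use assms in \<open>auto simp: closed_simplex_def\<close>)

lemma push_coords_in:
  assumes S: "finite S" and \<alpha>: "\<alpha> \<in> closed_simplex S"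
  shows "push_coords \<phi> \<alpha> \<in> closed_simplex (\<phi> ` S)"
proof -
  have "(\<Sum>y\<in>\<phi> ` S. push_coords \<phi> \<alpha> y) = sum \<alpha> S"
    unfolding push_coords_eq [OF S \<alpha>] using sum.image_gen [OF S, of \<alpha> \<phi>] by simp
  moreover have "0 \<le> push_coords \<phi> \<alpha> y" for y
    unfolding push_coords_eq [OF S \<alpha>] using \<alpha> by (intro sum_nonneg) (auto simp: closed_simplex_def)
  moreover have "push_coords \<phi> \<alpha> y = 0" if "y \<notin> \<phi> ` S" for y
  proof -
    have "{x. x \<in> S \<and> \<phi> x = y} = {}"
      using that by auto
    then show ?thesis
      unfolding push_coords_eq [OF S \<alpha>] by (simp only: sum.empty)
  qed
  ultimately show ?thesis
    using \<alpha> by (simp add: closed_simplex_def)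
qed

lemma continuous_map_push_coords:
  assumes S: "finite S"
  shows "continuous_map (simplex_space S) (simplex_space (\<phi> ` S)) (push_coords \<phi>)"
proof -
  have "continuous_map (simplex_space S) euclideanreal (\<lambda>\<alpha>. push_coords \<phi> \<alpha> y)" for y
  proof (rule continuous_map_eq)
    show "continuous_map (simplex_space S) euclideanreal (\<lambda>\<alpha>. \<Sum>x | x \<in> S \<and> \<phi> x = y. \<alpha> x)"
      using S
      by (intro continuous_map_sum continuous_map_from_subtopology continuous_map_product_projection) auto
  qed (simp add: push_coords_eq [OF S])
  then show ?thesis
    using push_coords_in [OF S]
    by (auto simp: continuous_map_in_subtopology continuous_map_componentwise_UNIV)
qed

lemma continuous_map_push_realization:
  assumes "\<And>S. S \<in> \<K> \<Longrightarrow> finite S \<and> \<phi> ` S \<in> \<L>"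
  shows "continuous_map (geometric_realization \<K>) (geometric_realization \<L>) (push_coords \<phi>)"
proof (rule continuous_map_from_geometric_realization)
  fix S
  assume "S \<in> \<K>"
  with assms have S: "finite S" "\<phi> ` S \<in> \<L>"
    by auto
  from continuous_map_compose [OF continuous_map_push_coords [OF S(1)] continuous_map_closed_simplex_inclusion [OF S(2)]]
  show "continuous_map (simplex_space S) (geometric_realization \<L>) (push_coords \<phi>)"
    by (simp add: o_def)
qed

section \<open>Vietoris--Rips filtrations\<close>

lemma continuous_map_vietoris_rips:
  assumes "s \<le> t"
  shows "continuous_map (Sp (vietoris_rips M d) s) (Sp (vietoris_rips M d) t) (Tr (vietoris_rips M d) s t)"
  unfolding vietoris_rips_def
proof (simp, rule continuous_map_from_geometric_realization)
  fix S
  assume "S \<in> vr_complex M d s"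
  then have "S \<in> vr_complex M d t"
    using assms by (force simp: vr_complex_def)
  then show "continuous_map (simplex_space S) (geometric_realization (vr_complex M d t)) (\<lambda>\<alpha>. \<alpha>)"
    by (rule continuous_map_closed_simplex_inclusion)
qed

lemma image_in_vr_complex:
  assumes "S \<in> vr_complex M d t" "\<phi> \<in> M \<rightarrow> N"
    and "\<And>x x'. \<lbrakk>x \<in> M; x' \<in> M\<rbrakk> \<Longrightarrow> e (\<phi> x) (\<phi> x') \<le> d x x' + \<epsilon>"
  shows "\<phi> ` S \<in> vr_complex N e (t + \<epsilon>)"
proof -
  have "e (\<phi> x) (\<phi> x') \<le> t + \<epsilon>" if "x \<in> S" "x' \<in> S" for x x'
  proof -
    have "x \<in> M" "x' \<in> M" "d x x' \<le> t"
      using assms(1) that by (auto simp: vr_complex_def)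
    with assms(3) [of x x'] show ?thesis
      by simp
  qed
  then show ?thesis
    using assms(1,2) by (auto simp: vr_complex_def)
qed

lemma persistent_cup_length_vietoris_rips:
  assumes \<phi>: "\<phi> \<in> M \<rightarrow> N" "\<And>x x'. \<lbrakk>x \<in> M; x' \<in> M\<rbrakk> \<Longrightarrow> e (\<phi> x) (\<phi> x') \<le> d x x' + \<epsilon>"
    and \<psi>: "\<psi> \<in> N \<rightarrow> M" "\<And>y y'. \<lbrakk>y \<in> N; y' \<in> N\<rbrakk> \<Longrightarrow> d (\<psi> y) (\<psi> y') \<le> e y y' + \<epsilon>"
    and \<phi>\<psi>: "\<And>y y'. \<lbrakk>y \<in> N; y' \<in> N\<rbrakk> \<Longrightarrow> e y (\<phi> (\<psi> y')) \<le> e y y' + \<epsilon>"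
    and sym: "\<And>y y'. e y y' = e y' y"
    and \<epsilon>: "0 \<le> \<epsilon>" and ab: "a \<le> b"
  shows "persistent_cup_length TYPE('k::field) (vietoris_rips N e) (a - \<epsilon>) (b + \<epsilon>)
           \<le> persistent_cup_length TYPE('k) (vietoris_rips M d) a b"
proof (rule persistent_cup_length_shift [where \<phi> = "\<lambda>_. push_coords \<phi>" and \<psi> = "\<lambda>_. push_coords \<psi>"])
  show "continuous_map (Sp (vietoris_rips M d) t) (Sp (vietoris_rips N e) (t + \<epsilon>)) (push_coords \<phi>)" for t
    unfolding vietoris_rips_def pspace.simps
  proof (rule continuous_map_push_realization, rule conjI)
    fix S
    assume S: "S \<in> vr_complex M d t"
    then show "finite S"
      by (simp add: vr_complex_def)
    from S \<phi> show "\<phi> ` S \<in> vr_complex N e (t + \<epsilon>)"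
      by (rule image_in_vr_complex)
  qed
  show "continuous_map (Sp (vietoris_rips N e) t) (Sp (vietoris_rips M d) (t + \<epsilon>)) (push_coords \<psi>)" for t
    unfolding vietoris_rips_def pspace.simps
  proof (rule continuous_map_push_realization, rule conjI)
    fix S
    assume S: "S \<in> vr_complex N e t"
    then show "finite S"
      by (simp add: vr_complex_def)
    from S \<psi> show "\<psi> ` S \<in> vr_complex M d (t + \<epsilon>)"
      by (rule image_in_vr_complex)
  qed
  fix s t :: real
  assume st: "s + \<epsilon> \<le> t"
  have "homotopic_with (\<lambda>_. True) (geometric_realization (vr_complex N e s)) (geometric_realization (vr_complex N e (t + \<epsilon>)))
      (\<lambda>\<alpha>. \<alpha>) (push_coords \<phi> \<circ> push_coords \<psi>)"
  proof (rule straight_line_homotopy)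
    fix S
    assume S: "S \<in> vr_complex N e s"
    then have finS: "finite S" and SN: "S \<subseteq> N" and diam: "\<And>y y'. \<lbrakk>y \<in> S; y' \<in> S\<rbrakk> \<Longrightarrow> e y y' \<le> s"
      by (auto simp: vr_complex_def)
    let ?S' = "\<phi> ` \<psi> ` S"
    have mix: "e y (\<phi> (\<psi> y')) \<le> t + \<epsilon>" "e (\<phi> (\<psi> y')) y \<le> t + \<epsilon>" if "y \<in> S" "y' \<in> S" for y y'
    proof -
      have "e y (\<phi> (\<psi> y')) \<le> e y y' + \<epsilon>" "e y y' \<le> s"
        using \<phi>\<psi> [of y y'] diam that SN by auto
      then show "e y (\<phi> (\<psi> y')) \<le> t + \<epsilon>"
        using st \<epsilon> by linarith
      then show "e (\<phi> (\<psi> y')) y \<le> t + \<epsilon>"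
        by (simp add: sym)
    qed
    \<comment> \<open>Each vertex map may add \<epsilon> to the diameter, so the image of
      \<open>S\<close> has diameter at most \<open>s + 2 * \<epsilon>\<close>. This is within
      \<open>t + \<epsilon>\<close> because \<open>s + \<epsilon> \<le> t\<close>.\<close>
    from S \<psi> have "\<psi> ` S \<in> vr_complex M d (s + \<epsilon>)"
      by (rule image_in_vr_complex)
    from this \<phi> have "?S' \<in> vr_complex N e (s + \<epsilon> + \<epsilon>)"
      by (rule image_in_vr_complex)
    then have S': "?S' \<subseteq> N" "\<And>y y'. \<lbrakk>y \<in> ?S'; y' \<in> ?S'\<rbrakk> \<Longrightarrow> e y y' \<le> t + \<epsilon>"
      using st by (force simp: vr_complex_def)+
    have "e y y' \<le> t + \<epsilon>" if "y \<in> S" "y' \<in> S" for y y'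
      using diam [OF that] st \<epsilon> by linarith
    then have "S \<union> ?S' \<in> vr_complex N e (t + \<epsilon>)"
      using S SN S' mix finS by (simp add: vr_complex_def ball_Un)
    moreover have "continuous_map (simplex_space S) (simplex_space ?S') (push_coords \<phi> \<circ> push_coords \<psi>)"
      using finS by (intro continuous_map_compose [OF continuous_map_push_coords continuous_map_push_coords]) auto
    ultimately show "\<exists>S'. S \<union> S' \<in> vr_complex N e (t + \<epsilon>) \<and> finite (S \<union> S') \<and>
        continuous_map (simplex_space S) (simplex_space S') (push_coords \<phi> \<circ> push_coords \<psi>)"
      using finS by blast
  qed
  then show "homotopic_with (\<lambda>_. True) (Sp (vietoris_rips N e) s) (Sp (vietoris_rips N e) (t + \<epsilon>))
      (Tr (vietoris_rips N e) s (t + \<epsilon>))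
      (push_coords \<phi> \<circ> Tr (vietoris_rips M d) (s + \<epsilon>) t \<circ> push_coords \<psi>)"
    by (simp add: vietoris_rips_def o_def)
qed (use continuous_map_vietoris_rips \<epsilon> ab in auto)

text \<open>Choosing for every point a partner at distance at most \<open>r\<close> in
  \<open>Z\<close> gives the vertex maps. Each required estimate is a path of three legs, one of
  which is the original distance while the other two have length at most \<open>r\<close>.\<close>

lemma erosion_distance_vietoris_rips:
  fixes M :: "'c set" and N :: "'d set" and Z :: "'z set"
  assumes M: "Metric_space M d" and N: "Metric_space N e"
    and Z: "Metric_space Z m" and f: "isometric_embedding M d Z m f" and g: "isometric_embedding N e Z m g"
    and r: "0 \<le> r" and fg: "\<And>a. a \<in> f ` M \<Longrightarrow> \<exists>b\<in>g ` N. m a b \<le> r" and gf: "\<And>b. b \<in> g ` N \<Longrightarrow> \<exists>a\<in>f ` M. m a b \<le> r"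
  shows "erosion_distance (persistent_cup_length TYPE('k::field) (vietoris_rips M d))
           (persistent_cup_length TYPE('k) (vietoris_rips N e)) \<le> ereal (2 * r)"
proof -
  interpret M: Metric_space M d by (rule M)
  interpret N: Metric_space N e by (rule N)
  interpret Z: Metric_space Z m by (rule Z)
  have fZ: "f x \<in> Z" if "x \<in> M" for x
    using f that by (auto simp: isometric_embedding_def)
  have gZ: "g y \<in> Z" if "y \<in> N" for y
    using g that by (auto simp: isometric_embedding_def)
  have fd: "d x x' = m (f x) (f x')" if "x \<in> M" "x' \<in> M" for x x'
    using f that by (simp add: isometric_embedding_def)
  have gd: "e y y' = m (g y) (g y')" if "y \<in> N" "y' \<in> N" for y y'
    using g that by (simp add: isometric_embedding_def)
  have "\<forall>x\<in>M. \<exists>y\<in>N. m (f x) (g y) \<le> r"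
    using fg by blast
  then obtain \<phi> where \<phi>: "\<And>x. x \<in> M \<Longrightarrow> \<phi> x \<in> N" "\<And>x. x \<in> M \<Longrightarrow> m (f x) (g (\<phi> x)) \<le> r"
    by metis
  have "\<forall>y\<in>N. \<exists>x\<in>M. m (f x) (g y) \<le> r"
    using gf by blast
  then obtain \<psi> where \<psi>: "\<And>y. y \<in> N \<Longrightarrow> \<psi> y \<in> M" "\<And>y. y \<in> N \<Longrightarrow> m (f (\<psi> y)) (g y) \<le> r"
    by metis
  have tri: "m p q \<le> m p u + m u v + m v q" if "p \<in> Z" "q \<in> Z" "u \<in> Z" "v \<in> Z" for p q u v
    using Z.triangle [of p u q] Z.triangle [of u v q] that by linarith
  have \<phi>e: "e (\<phi> x) (\<phi> x') \<le> d x x' + 2 * r" if "x \<in> M" "x' \<in> M" for x x'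
  proof -
    have "m (g (\<phi> x)) (g (\<phi> x')) \<le> m (g (\<phi> x)) (f x) + m (f x) (f x') + m (f x') (g (\<phi> x'))"
      using that by (intro tri fZ gZ \<phi>)
    then show ?thesis
      using \<phi>(2) [OF that(1)] \<phi>(2) [OF that(2)] Z.commute [of "f x" "g (\<phi> x)"] that by (simp add: fd gd \<phi>(1))
  qed
  have \<psi>e: "d (\<psi> y) (\<psi> y') \<le> e y y' + 2 * r" if "y \<in> N" "y' \<in> N" for y y'
  proof -
    have "m (f (\<psi> y)) (f (\<psi> y')) \<le> m (f (\<psi> y)) (g y) + m (g y) (g y') + m (g y') (f (\<psi> y'))"
      using that by (intro tri fZ gZ \<psi>)
    then show ?thesis
      using \<psi>(2) [OF that(1)] \<psi>(2) [OF that(2)] Z.commute [of "f (\<psi> y')" "g y'"] that by (simp add: fd gd \<psi>(1))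
  qed
  have \<phi>\<psi>: "e y (\<phi> (\<psi> y')) \<le> e y y' + 2 * r" if "y \<in> N" "y' \<in> N" for y y'
  proof -
    have "m (g y) (g (\<phi> (\<psi> y'))) \<le> m (g y) (g y') + m (g y') (f (\<psi> y')) + m (f (\<psi> y')) (g (\<phi> (\<psi> y')))"
      using that by (intro tri fZ gZ \<phi> \<psi>)
    then show ?thesis
      using \<psi>(2) [OF that(2)] \<phi>(2) [OF \<psi>(1) [OF that(2)]] Z.commute [of "f (\<psi> y')" "g y'"] that
      by (simp add: gd \<phi>(1) \<psi>(1))
  qed
  have \<psi>\<phi>: "d x (\<psi> (\<phi> x')) \<le> d x x' + 2 * r" if "x \<in> M" "x' \<in> M" for x x'
  proof -
    have "m (f x) (f (\<psi> (\<phi> x'))) \<le> m (f x) (f x') + m (f x') (g (\<phi> x')) + m (g (\<phi> x')) (f (\<psi> (\<phi> x')))"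
      using that by (intro tri fZ gZ \<phi> \<psi>)
    then show ?thesis
      using \<phi>(2) [OF that(2)] \<psi>(2) [OF \<phi>(1) [OF that(2)]] Z.commute [of "f (\<psi> (\<phi> x'))" "g (\<phi> x')"] that
      by (simp add: fd \<phi>(1) \<psi>(1))
  qed
  have "eroded (2 * r) (persistent_cup_length TYPE('k) (vietoris_rips M d))
      (persistent_cup_length TYPE('k) (vietoris_rips N e))"
    unfolding eroded_def
  proof (intro allI impI conjI)
    fix a b :: real
    assume "a \<le> b"
    then show "persistent_cup_length TYPE('k) (vietoris_rips N e) (a - 2 * r) (b + 2 * r) \<le>
        persistent_cup_length TYPE('k) (vietoris_rips M d) a b"
      using \<phi>(1) \<psi>(1) r
      by (intro persistent_cup_length_vietoris_rips [of \<phi> M N e d "2 * r" \<psi>] \<phi>e \<psi>e \<phi>\<psi> N.commute) auto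
    show "persistent_cup_length TYPE('k) (vietoris_rips M d) (a - 2 * r) (b + 2 * r) \<le>
        persistent_cup_length TYPE('k) (vietoris_rips N e) a b"
      using \<phi>(1) \<psi>(1) r \<open>a \<le> b\<close>
      by (intro persistent_cup_length_vietoris_rips [of \<psi> N M d e "2 * r" \<phi>] \<phi>e \<psi>e \<psi>\<phi> M.commute) auto
  qed
  with r show ?thesis
    by (intro erosion_distance_le) auto
qed

theorem corollary1p1:
  fixes X :: "'a pspace" and Y :: "'b pspace"
    and M :: "'c set" and d :: "'c \<Rightarrow> 'c \<Rightarrow> real"
    and N :: "'d set" and e :: "'d \<Rightarrow> 'd \<Rightarrow> real"
  shows
    "(persistent_space X \<and> persistent_space Y \<longrightarrow>
        erosion_distance (persistent_cup_length TYPE('k::field) X) (persistent_cup_length TYPE('k) Y)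
          \<le> homotopy_interleaving_distance TYPE('u) X Y) \<and>
     (Metric_space M d \<and> compact_space (Metric_space.mtopology M d) \<and>
      Metric_space N e \<and> compact_space (Metric_space.mtopology N e) \<longrightarrow>
        erosion_distance (persistent_cup_length TYPE('k) (vietoris_rips M d))
                         (persistent_cup_length TYPE('k) (vietoris_rips N e))
          \<le> 2 * Gromov_Hausdorff_distance M d N e)"
proof (intro conjI impI; elim conjE)
  assume "persistent_space X" "persistent_space Y"
  then show "erosion_distance (persistent_cup_length TYPE('k) X) (persistent_cup_length TYPE('k) Y)
      \<le> homotopy_interleaving_distance TYPE('u) X Y"
    by (rule erosion_distance_le_homotopy_interleaving_distance)
next
  assume M: "Metric_space M d" and N: "Metric_space N e"
  let ?D = "erosion_distance (persistent_cup_length TYPE('k) (vietoris_rips M d))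
              (persistent_cup_length TYPE('k) (vietoris_rips N e))"
  \<comment> \<open>With the factor 2 moved to the left, the right-hand side is a plain infimum of
    infima, and each candidate radius can be treated separately.\<close>
  have "?D / 2 \<le> Gromov_Hausdorff_distance M d N e"
    unfolding Gromov_Hausdorff_distance_def
  proof (rule Inf_greatest, clarify)
    fix Z :: "('c + 'd) set" and m f g
    assume Z: "Metric_space Z m" "isometric_embedding M d Z m f" "isometric_embedding N e Z m g"
    show "?D / 2 \<le> Hausdorff_distance m (f ` M) (g ` N)"
      unfolding Hausdorff_distance_def
    proof (rule Inf_greatest, clarify)
      fix r :: real
      assume "0 \<le> r" "\<forall>a\<in>f ` M. \<exists>b\<in>g ` N. m a b \<le> r" "\<forall>b\<in>g ` N. \<exists>a\<in>f ` M. m a b \<le> r"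
      then have "?D \<le> ereal (2 * r)"
        by (intro erosion_distance_vietoris_rips [OF M N Z]) auto
      then show "?D / 2 \<le> ereal r"
        by (simp add: ereal_divide_le_pos)
    qed
  qed
  then show "?D \<le> 2 * Gromov_Hausdorff_distance M d N e"
    by (simp add: ereal_divide_le_pos)
qed

end
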